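(* Let $E$ be a Banach space, let $P\in\mathcal{P}(E)$ be a projector, and let $p_*\colon\pi_1(\mathcal{P}(E),P)\to\pi_1(\mathcal{P}(\mathcal{C}(E)),p(P))$ be the homomorphism induced by the quotient projection $p\colon\mathcal{P}(E)\to\mathcal{P}(\mathcal{C}(E))$. There exists a group homomorphism $\varphi_P\colon\pi_1(\mathcal{P}(\mathcal{C}(E)),p(P))\to\mathbb{Z}$ such that the sequence of homomorphisms $$\pi_1(\mathcal{P}(E),P)\xrightarrow{\;p_*\;}\pi_1(\mathcal{P}(\mathcal{C}(E)),p(P))\xrightarrow{\;\varphi_P\;}\mathbb{Z}$$ is exact, i.e. $\operatorname{Im}(p_* )=\ker\varphi_P$.
   Context: $\mathcal{L}(E)$ is the Banach algebra of bounded linear operators on $E$, $\mathcal{L}_c(E)$ its closed ideal of compact operators, $\mathcal{C}(E)=\mathcal{L}(E)/\mathcal{L}_c(E)$ the Calkin algebra, and $p(T)=T+\mathcal{L}_c(E)$ the quotient map. For a unital Banach algebra $\mathcal{B}$, $\mathcal{P}(\mathcal{B})=\{x\in\mathcal{B}: x^2=x\}$ with the norm topology; $\mathcal{P}(E)$ stands for $\mathcal{P}(\mathcal{L}(E))$, the space of projectors of $E$. *)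

theory Defs
  imports "HOL-Analysis.Analysis" "HOL-Algebra.QuotRing" "HOL-Algebra.Elementary_Groups"
begin

section \<open>Banach spaces over the real or the complex numbers\<close>

text \<open>
  Every instance of \<^class>\<open>real_normed_field\<close> is isometrically isomorphic to the real or to the
  complex numbers (Gelfand--Mazur), so the scalar type \<open>'k\<close> covers exactly the two usual cases.
  Additive structure, norm and completeness come from the class \<^class>\<open>banach\<close>; for \<open>'k = real\<close>
  the scalar multiplication is forced to be \<^const>\<open>scaleR\<close>.
\<close>

locale banach_space_over = vector_space smul
  for smul :: "'k::real_normed_field \<Rightarrow> 'a::banach \<Rightarrow> 'a" +
  assumes scale_of_real: "smul (of_real r) x = r *\<^sub>R x"
    and norm_scale: "norm (smul c x) = norm c * norm x"


section \<open>Bounded operators, compact operators and the Calkin algebra\<close>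

text \<open>
  The type of \<^emph>\<open>real\<close>-linear bounded operators carries the operator norm; the operators that
  are linear over \<open>'k\<close> are those commuting with \<open>smul\<close>.
\<close>

definition op_algebra :: "('k::real_normed_field \<Rightarrow> 'a::banach \<Rightarrow> 'a) \<Rightarrow> ('a \<Rightarrow>\<^sub>L 'a) ring" where
  "op_algebra smul =
    \<lparr>carrier = {T. \<forall>c x. blinfun_apply T (smul c x) = smul c (blinfun_apply T x)},
     monoid.mult = (o\<^sub>L), one = id_blinfun, ring.zero = 0, add = (+)\<rparr>"

definition compact_ops :: "('k::real_normed_field \<Rightarrow> 'a::banach \<Rightarrow> 'a) \<Rightarrow> ('a \<Rightarrow>\<^sub>L 'a) set" where
  "compact_ops smul =
    {T \<in> carrier (op_algebra smul). compact (closure (blinfun_apply T ` cball 0 1))}"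

definition calkin :: "('k::real_normed_field \<Rightarrow> 'a::banach \<Rightarrow> 'a) \<Rightarrow> ('a \<Rightarrow>\<^sub>L 'a) set ring" where
  "calkin smul = op_algebra smul Quot compact_ops smul"

definition calkin_proj ::
    "('k::real_normed_field \<Rightarrow> 'a::banach \<Rightarrow> 'a) \<Rightarrow> ('a \<Rightarrow>\<^sub>L 'a) \<Rightarrow> ('a \<Rightarrow>\<^sub>L 'a) set" where
  "calkin_proj smul T = compact_ops smul +>\<^bsub>op_algebra smul\<^esub> T"

definition quotient_norm :: "'b::real_normed_vector set \<Rightarrow> real" where
  "quotient_norm X = (INF T\<in>X. norm T)"


section \<open>Spaces of idempotents\<close>

definition idempotents :: "('b, 'm) ring_scheme \<Rightarrow> 'b set" where
  "idempotents R = {x \<in> carrier R. x \<otimes>\<^bsub>R\<^esub> x = x}"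

text \<open>
  The value \<open>0\<close> off the carrier is never used by the topology; it is there because the locale
  \<^locale>\<open>Metric_space\<close> requires symmetry and nonnegativity on the whole type.
\<close>

definition ring_dist :: "('b, 'm) ring_scheme \<Rightarrow> ('b \<Rightarrow> real) \<Rightarrow> 'b \<Rightarrow> 'b \<Rightarrow> real" where
  "ring_dist R nrm x y =
    (if x \<in> carrier R \<and> y \<in> carrier R then nrm (x \<ominus>\<^bsub>R\<^esub> y) else 0)"

definition idempotent_space :: "('b, 'm) ring_scheme \<Rightarrow> ('b \<Rightarrow> real) \<Rightarrow> 'b topology" where
  "idempotent_space R nrm =
    subtopology (Metric_space.mtopology (carrier R) (ring_dist R nrm)) (idempotents R)"

definition projector_space ::
    "('k::real_normed_field \<Rightarrow> 'a::banach \<Rightarrow> 'a) \<Rightarrow> ('a \<Rightarrow>\<^sub>L 'a) topology" where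
  "projector_space smul = idempotent_space (op_algebra smul) norm"

definition calkin_projector_space ::
    "('k::real_normed_field \<Rightarrow> 'a::banach \<Rightarrow> 'a) \<Rightarrow> ('a \<Rightarrow>\<^sub>L 'a) set topology" where
  "calkin_projector_space smul = idempotent_space (calkin smul) quotient_norm"


section \<open>The fundamental group\<close>

definition loops :: "'b topology \<Rightarrow> 'b \<Rightarrow> (real \<Rightarrow> 'b) set" where
  "loops X x = {g. pathin X g \<and> g 0 = x \<and> g 1 = x}"

text \<open>
  Values of a loop outside \<open>{0..1}\<close> are irrelevant: \<^const>\<open>homotopic_with\<close> identifies loops that
  agree on \<open>{0..1}\<close>.
\<close>

definition loop_homotopy :: "'b topology \<Rightarrow> 'b \<Rightarrow> ((real \<Rightarrow> 'b) \<times> (real \<Rightarrow> 'b)) set" where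
  "loop_homotopy X x =
    {(f, g). homotopic_with (\<lambda>h. h 0 = x \<and> h 1 = x) (top_of_set {0..1}) X f g}"

definition loop_join :: "(real \<Rightarrow> 'b) \<Rightarrow> (real \<Rightarrow> 'b) \<Rightarrow> real \<Rightarrow> 'b" where
  "loop_join f g = (\<lambda>t. if t \<le> 1/2 then f (2 * t) else g (2 * t - 1))"

definition fundamental_group :: "'b topology \<Rightarrow> 'b \<Rightarrow> (real \<Rightarrow> 'b) set monoid" where
  "fundamental_group X x =
    \<lparr>carrier = loops X x // loop_homotopy X x,
     monoid.mult = (\<lambda>A B. loop_homotopy X x `` {loop_join f g | f g. f \<in> A \<and> g \<in> B}),
     one = loop_homotopy X x `` {\<lambda>t. x}\<rparr>"

definition fundamental_group_map ::
    "'c topology \<Rightarrow> 'c \<Rightarrow> ('b \<Rightarrow> 'c) \<Rightarrow> (real \<Rightarrow> 'b) set \<Rightarrow> (real \<Rightarrow> 'c) set" where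
  "fundamental_group_map Y y h A = loop_homotopy Y y `` ((\<lambda>g. h \<circ> g) ` A)"

end

theory Submission
  imports Defs
begin

text \<open>
  A path of idempotents of the Calkin algebra starting at \<open>p(P)\<close> has the form \<open>p(g P g\<^sup>-\<^sup>1)\<close> for a
  path \<open>g\<close> of invertible operators starting at the identity: if idempotents \<open>a\<close>, \<open>b\<close> are close,
  then \<open>b a + (1 - b) (1 - a)\<close> is close to \<open>1\<close> and conjugates \<open>a\<close> to \<open>b\<close>, and it lifts to an invertible
  operator. For a loop, \<open>g(1)\<close> commutes with \<open>P\<close> modulo compact operators, and the value of the
  homomorphism is the Fredholm index of the compression of \<open>g(1)\<close> to the range of \<open>P\<close>. It depends only
  on the homotopy class, because homotopic loops have lifts with the same endpoint and the index is
  locally constant. If it vanishes, then \<open>P\<close> and \<open>g(1) P g(1)\<^sup>-\<^sup>1\<close> are joined by a path of projectors in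
  \<open>P + L\<^sub>c(E)\<close>: a finite-rank correction produces a common complement of their ranges, and
  projectors with a common range or a common kernel form convex sets. This closes the lift up to a
  loop of projectors. The index is defined algebraically, through the trace of finite-rank maps,
  which reduces its stability under compact perturbations to the Riesz decomposition of \<open>1 - K\<close>.
\<close>

section \<open>The fundamental group of a topological space\<close>

text \<open>The quotient is avoided by working with representatives: a selection theorem modulo a
  closed subspace replaces Calkin-valued loops and homotopies by norm-continuous families of
  operators that are idempotent modulo compact operators, and all inverses and congruences are then
  taken among operators. The delicate point is endpoint control. A homotopy has to be followed
  without moving \<open>g 1\<close>, so each small conjugating factor is corrected to be the
  identity at both ends; the correction is compact because the family does not move there modulo
  compact operators. The Riesz theory is developed over the reals; linearity over \<open>'k\<close>
  is recovered because the Riesz projection commutes with every additive map that commutes with the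
  operator. Operators on the range of \<open>P\<close> are extended by the identity on the kernel of
  \<open>P\<close>, so that only one space occurs. Index values lie in the scalar field and are
  recognised as integers through a dimension formula; characteristic zero makes
  \<open>of_int\<close> injective.\<close>

lemma loop_homotopy_iff:
  "(f, g) \<in> loop_homotopy X x \<longleftrightarrow>
    (\<exists>h. continuous_map (top_of_set ({0..1::real} \<times> {0..1::real})) X h \<and>
         (\<forall>t\<in>{0..1}. h (0, t) = f t \<and> h (1, t) = g t) \<and>
         (\<forall>s\<in>{0..1}. h (s, 0) = x \<and> h (s, 1) = x))"
proof -
  have "(f, g) \<in> loop_homotopy X x \<longleftrightarrow>
     (\<exists>h. continuous_map (prod_topology (top_of_set {0..1}) (top_of_set {0..1::real})) X h \<and>
              (\<forall>t \<in> topspace (top_of_set {0..1::real}). h(0,t) = f t) \<and>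
              (\<forall>t \<in> topspace (top_of_set {0..1::real}). h(1,t) = g t) \<and>
              (\<forall>s \<in> {0..1::real}. h (s, 0) = x \<and> h (s, 1) = x))"
    unfolding loop_homotopy_def mem_Collect_eq case_prod_conv
    by (rule homotopic_with[where P = "\<lambda>h. h 0 = x \<and> h 1 = x"]) auto
  then show ?thesis
    by (simp add: prod_topology_subtopology_eu) blast
qed

lemma loop_homotopyI:
  fixes h :: "real \<times> real \<Rightarrow> 'a"
  assumes "continuous_map (top_of_set ({0..1} \<times> {0..1})) X h"
    and "\<And>t. t \<in> {0..1} \<Longrightarrow> h (0, t) = f t" "\<And>t. t \<in> {0..1} \<Longrightarrow> h (1, t) = g t"
    and "\<And>s. s \<in> {0..1} \<Longrightarrow> h (s, 0) = x" "\<And>s. s \<in> {0..1} \<Longrightarrow> h (s, 1) = x"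
  shows "(f, g) \<in> loop_homotopy X x"
  unfolding loop_homotopy_iff using assms by (intro exI[of _ h]) auto

lemma loop_homotopy_equiv: "equiv (loops X x) (loop_homotopy X x)"
proof (rule equivI)
  show "refl_on (loops X x) (loop_homotopy X x)"
    by (auto simp: refl_on_def loop_homotopy_def loops_def pathin_def)
  show "sym (loop_homotopy X x)"
    by (auto simp: sym_def loop_homotopy_def intro: homotopic_with_symD)
  show "trans (loop_homotopy X x)"
    by (auto simp: trans_def loop_homotopy_def intro: homotopic_with_trans)
  show "loop_homotopy X x \<subseteq> loops X x \<times> loops X x"
    by (auto simp: loop_homotopy_def loops_def pathin_def
        dest: homotopic_with_imp_continuous_maps homotopic_with_imp_property)
qed

lemma loop_homotopy_trans:
  "(f, g) \<in> loop_homotopy X x \<Longrightarrow> (g, h) \<in> loop_homotopy X x \<Longrightarrow> (f, h) \<in> loop_homotopy X x"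
  using loop_homotopy_equiv by (meson equivE transD)

lemma loop_homotopy_class_eq:
  "(f, g) \<in> loop_homotopy X x \<Longrightarrow> loop_homotopy X x `` {f} = loop_homotopy X x `` {g}"
  using loop_homotopy_equiv by (metis equiv_class_eq)

lemma loop_homotopy_eq_on:
  assumes "f \<in> loops X x" "\<And>t. t \<in> {0..1} \<Longrightarrow> f t = g t"
  shows "(f, g) \<in> loop_homotopy X x"
  using assms by (auto simp: loop_homotopy_def loops_def pathin_def intro!: homotopic_with_equal)

lemma loop_homotopy_refl: "f \<in> loops X x \<Longrightarrow> (f, f) \<in> loop_homotopy X x"
  by (rule loop_homotopy_eq_on) auto

text \<open>All the group axioms reduce to this: both paths are \<open>f\<close> run through by paths in the
  convex set \<open>{0..1}\<close>.\<close>

lemma loop_reparam_homotopic: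
  assumes f: "pathin X f" and u: "continuous_on {0..1} u" and v: "continuous_on {0..1} v"
    and uv: "u \<in> {0..1} \<rightarrow> {0..1}" "v \<in> {0..1} \<rightarrow> {0..1}"
    and ends: "u 0 = v 0" "u 1 = v 1" "f (u 0) = x" "f (u 1) = x"
  shows "(f \<circ> u, f \<circ> v) \<in> loop_homotopy X x"
proof (rule loop_homotopyI)
  define k where "k = (\<lambda>(s::real, t). (1 - s) * u t + s * v t)"
  have "continuous_on ({0..1} \<times> {0..1}) k"
    unfolding k_def case_prod_unfold
    by (intro continuous_intros continuous_on_compose2[OF u] continuous_on_compose2[OF v]) auto
  moreover have "k ` ({0..1} \<times> {0..1}) \<subseteq> {0..1}"
  proof (clarsimp simp: k_def)
    fix s t :: real assume st: "0 \<le> s" "s \<le> 1" "0 \<le> t" "t \<le> 1"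
    then have "u t \<in> {0..1}" "v t \<in> {0..1}" using uv by auto
    then have "(1 - s) *\<^sub>R u t + s *\<^sub>R v t \<in> {0..1}"
      using st convex_real_interval(5)[of 0 1] by (intro convexD) auto
    then show "0 \<le> (1 - s) * u t + s * v t \<and> (1 - s) * u t + s * v t \<le> 1" by simp
  qed
  ultimately have "continuous_map (top_of_set ({0..1} \<times> {0..1})) (top_of_set {0..1}) k"
    by (auto simp: continuous_map_subtopology_eu)
  then show "continuous_map (top_of_set ({0..1} \<times> {0..1})) X (f \<circ> k)"
    using f unfolding pathin_def by (rule continuous_map_compose)
qed (use ends in \<open>auto simp: algebra_simps\<close>)

lemma continuous_map_restrict_compose:
  assumes "continuous_map (top_of_set T) X f" "continuous_on S k" "k ` S \<subseteq> T"
  shows "continuous_map (top_of_set S) X (\<lambda>z. f (k z))"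
  using continuous_map_compose[of "top_of_set S" "top_of_set T" k X f] assms
  by (auto simp: continuous_map_subtopology_eu o_def)

text \<open>The parameter set \<open>S\<close> is left free: \<open>{0}\<close> gives joins of
  paths, \<open>{0..1}\<close> joins of homotopies.\<close>

lemma continuous_map_join_square:
  fixes S :: "real set"
  assumes h: "continuous_map (top_of_set (S \<times> {0..1})) X h"
    and k: "continuous_map (top_of_set (S \<times> {0..1})) X k"
    and hk: "\<And>s. s \<in> S \<Longrightarrow> h (s, 1::real) = k (s, 0::real)"
  shows "continuous_map (top_of_set (S \<times> {0..1})) X
     (\<lambda>z. if snd z \<le> 1/2 then h (fst z, 2 * snd z) else k (fst z, 2 * snd z - 1))"
proof (rule continuous_map_cases_le)
  show "continuous_map (subtopology (top_of_set (S \<times> {0..1}))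
      {z \<in> topspace (top_of_set (S \<times> {0..1})). snd z \<le> 1/2}) X (\<lambda>z. h (fst z, 2 * snd z))"
    unfolding subtopology_subtopology
    by (rule continuous_map_restrict_compose[OF h]) (auto intro!: continuous_intros)
  show "continuous_map (subtopology (top_of_set (S \<times> {0..1}))
      {z \<in> topspace (top_of_set (S \<times> {0..1})). 1/2 \<le> snd z}) X (\<lambda>z. k (fst z, 2 * snd z - 1))"
    unfolding subtopology_subtopology
    by (rule continuous_map_restrict_compose[OF k]) (auto intro!: continuous_intros)
  show "h (fst z, 2 * snd z) = k (fst z, 2 * snd z - 1)"
    if "z \<in> topspace (top_of_set (S \<times> {0..1}))" "snd z = 1/2" for z
  proof -
    have "2 * snd z = 1" using that by simp
    then show ?thesis using that by (simp only: hk) (auto simp: hk)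
  qed
qed (auto intro!: continuous_intros)

lemma pathin_loop_join:
  assumes f: "pathin X f" and g: "pathin X g" and fg: "f 1 = g 0"
  shows "pathin X (loop_join f g)"
proof -
  have lift: "continuous_map (top_of_set ({0} \<times> {0..1})) X (\<lambda>z. k (snd z))"
    if "pathin X k" for k :: "real \<Rightarrow> 'a"
    by (rule continuous_map_restrict_compose[OF that[unfolded pathin_def]])
      (auto intro!: continuous_intros)
  have sq: "continuous_map (top_of_set ({0::real} \<times> {0..1})) X
     (\<lambda>z. if snd z \<le> 1/2 then f (2 * snd z) else g (2 * snd z - 1))"
    using continuous_map_join_square[OF lift[OF f] lift[OF g]] fg by (simp only: snd_conv refl)
  have "continuous_on {0..1::real} (\<lambda>t. (0::real, t))"
    by (intro continuous_intros)
  from continuous_map_restrict_compose[OF sq this]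
  show ?thesis by (simp add: pathin_def loop_join_def image_subset_iff cong: if_cong)
qed

lemma loop_join_loops:
  "f \<in> loops X x \<Longrightarrow> g \<in> loops X x \<Longrightarrow> loop_join f g \<in> loops X x"
  using pathin_loop_join[of X f g] by (auto simp: loops_def) (auto simp: loop_join_def)

lemma loop_join_homotopic:
  assumes "(f, f') \<in> loop_homotopy X x" "(g, g') \<in> loop_homotopy X x"
  shows "(loop_join f g, loop_join f' g') \<in> loop_homotopy X x"
proof -
  obtain h :: "real \<times> real \<Rightarrow> 'a" where h: "continuous_map (top_of_set ({0..1} \<times> {0..1})) X h"
    and h': "\<And>t. t\<in>{0..1} \<Longrightarrow> h (0, t) = f t \<and> h (1, t) = f' t"
         "\<And>s. s\<in>{0..1} \<Longrightarrow> h (s, 0) = x \<and> h (s, 1) = x"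
    using assms(1) unfolding loop_homotopy_iff by blast
  obtain k :: "real \<times> real \<Rightarrow> 'a" where k: "continuous_map (top_of_set ({0..1} \<times> {0..1})) X k"
    and k': "\<And>t. t\<in>{0..1} \<Longrightarrow> k (0, t) = g t \<and> k (1, t) = g' t"
         "\<And>s. s\<in>{0..1} \<Longrightarrow> k (s, 0) = x \<and> k (s, 1) = x"
    using assms(2) unfolding loop_homotopy_iff by blast
  show ?thesis
    by (rule loop_homotopyI[OF continuous_map_join_square[OF h k]])
      (use h' k' in \<open>auto simp: loop_join_def\<close>)
qed

lemma loop_join_const_left:
  assumes "f \<in> loops X x" shows "(loop_join (\<lambda>_. x) f, f) \<in> loop_homotopy X x"
proof -
  have "(f \<circ> (\<lambda>t. max 0 (2 * t - 1)), f \<circ> (\<lambda>t. t)) \<in> loop_homotopy X x"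
    using assms by (intro loop_reparam_homotopic) (auto simp: loops_def intro!: continuous_intros)
  moreover have "f (max 0 (2 * t - 1)) = loop_join (\<lambda>_. x) f t" for t
  proof (cases "2 * t = 1")
    case True
    then show ?thesis using assms by (simp add: True loop_join_def loops_def)
  qed (use assms in \<open>auto simp: loop_join_def loops_def max_def\<close>)
  ultimately show ?thesis by (simp add: o_def)
qed

lemma loop_join_const_right:
  assumes "f \<in> loops X x" shows "(loop_join f (\<lambda>_. x), f) \<in> loop_homotopy X x"
proof -
  have "(f \<circ> (\<lambda>t. min 1 (2 * t)), f \<circ> (\<lambda>t. t)) \<in> loop_homotopy X x"
    using assms by (intro loop_reparam_homotopic) (auto simp: loops_def intro!: continuous_intros)
  moreover have "f (min 1 (2 * t)) = loop_join f (\<lambda>_. x) t" for t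
  proof (cases "2 * t = 1")
    case True
    then show ?thesis using assms by (simp add: True loop_join_def loops_def)
  qed (use assms in \<open>auto simp: loop_join_def loops_def min_def\<close>)
  ultimately show ?thesis by (simp add: o_def)
qed

lemma loops_reverse:
  assumes "f \<in> loops X x" shows "(\<lambda>t. f (1 - t)) \<in> loops X x"
proof -
  have "continuous_map (top_of_set {0..1}) X (\<lambda>t. f (1 - t))"
    using assms by (rule_tac continuous_map_restrict_compose[of "{0..1}" X f])
      (auto simp: loops_def pathin_def intro!: continuous_intros)
  then show ?thesis using assms by (auto simp: loops_def pathin_def)
qed

lemma loop_join_reverse:
  assumes "f \<in> loops X x"
  shows "(loop_join (\<lambda>t. f (1 - t)) f, \<lambda>_. x) \<in> loop_homotopy X x"
proof -
  \<comment> \<open>The parameter runs from 1 down to 0 and back to 1, so within the interval it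
    contracts to the constant 1.\<close>
  have "(f \<circ> (\<lambda>t. \<bar>1 - 2 * t\<bar>), f \<circ> (\<lambda>t. 1)) \<in> loop_homotopy X x"
    using assms by (intro loop_reparam_homotopic) (auto simp: loops_def intro!: continuous_intros)
  moreover have "f \<circ> (\<lambda>t. \<bar>1 - 2 * t\<bar>) = loop_join (\<lambda>t. f (1 - t)) f"
    using assms by (auto simp: fun_eq_iff loop_join_def abs_if)
  ultimately show ?thesis using assms by (simp add: o_def loops_def)
qed

lemma loop_join_assoc:
  assumes "f \<in> loops X x" "g \<in> loops X x" "h \<in> loops X x"
  shows "(loop_join (loop_join f g) h, loop_join f (loop_join g h)) \<in> loop_homotopy X x"
proof -
  let ?j = "loop_join f (loop_join g h)"
  define u :: "real \<Rightarrow> real" where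
    "u t = (if t \<le> 1/2 then (if t \<le> 1/4 then 2 * t else t + 1/4) else t / 2 + 1/2)" for t
  \<comment> \<open>The slopes 2, 1, 1/2 decrease, so \<open>u\<close> is a minimum of affine
    functions and its continuity is immediate. It moves the break points 1/4 and 1/2 of the left
    bracketing to 1/2 and 3/4.\<close>
  have u_alt: "u = (\<lambda>t. min (min (2 * t) (t + 1/4)) (t / 2 + 1/2))"
    by (auto simp: fun_eq_iff u_def min_def)
  have "?j \<in> loops X x" by (intro loop_join_loops assms)
  then have "(?j \<circ> u, ?j \<circ> (\<lambda>t. t)) \<in> loop_homotopy X x"
    unfolding u_alt
    by (intro loop_reparam_homotopic) (auto simp: loops_def intro!: continuous_intros)
  moreover have "?j \<circ> u = loop_join (loop_join f g) h"
  proof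
    fix t :: real
    consider "t \<le> 1/4" | "1/4 < t" "t \<le> 1/2" | "t > 1/2" by linarith
    then show "(?j \<circ> u) t = loop_join (loop_join f g) h t"
    proof cases
      case 2
      then have "2 * (2 * (t + 1/4) - 1) \<le> 1" "2 * (2 * (t + 1/4) - 1) = 4 * t - 1" by auto
      then show ?thesis using 2 by (simp add: loop_join_def u_def)
    next
      case 3
      then show ?thesis using assms by (auto simp: loop_join_def u_def loops_def algebra_simps)
    qed (auto simp: loop_join_def u_def)
  qed
  ultimately show ?thesis by (simp add: o_def)
qed

text \<open>The product joins all pairs of representatives and saturates under homotopy; since
  joining respects homotopy, a single pair already produces the whole class.\<close>

lemma fundamental_group_mult:
  assumes f: "f \<in> loops X x" and g: "g \<in> loops X x"
  shows "loop_homotopy X x `` {f} \<otimes>\<^bsub>fundamental_group X x\<^esub> loop_homotopy X x `` {g}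
       = loop_homotopy X x `` {loop_join f g}"
proof -
  let ?r = "loop_homotopy X x"
  let ?A = "{loop_join f' g' | f' g'. f' \<in> ?r `` {f} \<and> g' \<in> ?r `` {g}}"
  have "f \<in> ?r `` {f}" "g \<in> ?r `` {g}"
    using f g loop_homotopy_refl by auto
  then have 1: "loop_join f g \<in> ?A" by (intro CollectI exI[of _ f] exI[of _ g]) simp
  have 2: "(loop_join f g, j) \<in> ?r" if "j \<in> ?A" for j
    using that by (auto simp del: Image_singleton simp add: Image_singleton_iff intro: loop_join_homotopic)
  have "?r `` ?A = ?r `` {loop_join f g}"
  proof
    show "?r `` {loop_join f g} \<subseteq> ?r `` ?A" using 1 by (intro Image_mono) auto
    show "?r `` ?A \<subseteq> ?r `` {loop_join f g}"
    proof
      fix k assume "k \<in> ?r `` ?A"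
      then obtain j where j: "j \<in> ?A" and k: "(j, k) \<in> ?r" by (rule ImageE)
      show "k \<in> ?r `` {loop_join f g}"
        using loop_homotopy_trans[OF 2[OF j] k] by simp
    qed
  qed
  then show ?thesis by (simp add: fundamental_group_def)
qed

lemma fundamental_group_carrierE:
  assumes "A \<in> carrier (fundamental_group X x)"
  obtains f where "f \<in> loops X x" "A = loop_homotopy X x `` {f}"
  using assms by (auto simp: fundamental_group_def elim: quotientE)

lemma fundamental_group_carrierI:
  "f \<in> loops X x \<Longrightarrow> loop_homotopy X x `` {f} \<in> carrier (fundamental_group X x)"
  by (auto simp: fundamental_group_def intro: quotientI)

lemma fundamental_group_one:
  "\<one>\<^bsub>fundamental_group X x\<^esub> = loop_homotopy X x `` {\<lambda>_. x}"
  by (simp add: fundamental_group_def)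

lemma const_loop: "x \<in> topspace X \<Longrightarrow> (\<lambda>_. x) \<in> loops X x"
  by (simp add: loops_def pathin_const)

theorem group_fundamental_group:
  assumes "x \<in> topspace X"
  shows "Group.group (fundamental_group X x)"
proof (rule groupI)
  let ?G = "fundamental_group X x"
  show "\<one>\<^bsub>?G\<^esub> \<in> carrier ?G"
    by (simp add: fundamental_group_one fundamental_group_carrierI const_loop assms)
  fix A assume "A \<in> carrier ?G"
  then obtain f where f: "f \<in> loops X x" "A = loop_homotopy X x `` {f}"
    by (rule fundamental_group_carrierE)
  show "\<one>\<^bsub>?G\<^esub> \<otimes>\<^bsub>?G\<^esub> A = A"
    using f assms
    by (simp add: fundamental_group_one fundamental_group_mult const_loop
        loop_homotopy_class_eq[OF loop_join_const_left])
  show "\<exists>B\<in>carrier ?G. B \<otimes>\<^bsub>?G\<^esub> A = \<one>\<^bsub>?G\<^esub>"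
  proof (rule bexI)
    show "loop_homotopy X x `` {\<lambda>t. f (1 - t)} \<otimes>\<^bsub>?G\<^esub> A = \<one>\<^bsub>?G\<^esub>"
      using f assms loops_reverse[OF f(1)]
      by (simp add: fundamental_group_one fundamental_group_mult
          loop_homotopy_class_eq[OF loop_join_reverse])
  qed (simp add: fundamental_group_carrierI loops_reverse f)
  fix B assume "B \<in> carrier ?G"
  then obtain g where g: "g \<in> loops X x" "B = loop_homotopy X x `` {g}"
    by (rule fundamental_group_carrierE)
  show "A \<otimes>\<^bsub>?G\<^esub> B \<in> carrier ?G"
    using f g by (simp add: fundamental_group_mult fundamental_group_carrierI loop_join_loops)
  fix C assume "C \<in> carrier ?G"
  then obtain h where h: "h \<in> loops X x" "C = loop_homotopy X x `` {h}"
    by (rule fundamental_group_carrierE)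
  show "A \<otimes>\<^bsub>?G\<^esub> B \<otimes>\<^bsub>?G\<^esub> C = A \<otimes>\<^bsub>?G\<^esub> (B \<otimes>\<^bsub>?G\<^esub> C)"
    using f g h
    by (simp add: fundamental_group_mult loop_join_loops loop_homotopy_class_eq[OF loop_join_assoc])
qed

section \<open>Functoriality of the fundamental group\<close>

lemma loops_compose:
  assumes "continuous_map X Y p" "f \<in> loops X x"
  shows "p \<circ> f \<in> loops Y (p x)"
  using assms by (auto simp: loops_def pathin_def intro: continuous_map_compose)

lemma loop_homotopy_compose:
  assumes p: "continuous_map X Y p" and "(f, g) \<in> loop_homotopy X x"
  shows "(p \<circ> f, p \<circ> g) \<in> loop_homotopy Y (p x)"
proof -
  obtain h :: "real \<times> real \<Rightarrow> 'a" where "continuous_map (top_of_set ({0..1} \<times> {0..1})) X h"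
    "\<And>t. t\<in>{0..1} \<Longrightarrow> h (0, t) = f t \<and> h (1, t) = g t"
    "\<And>s. s\<in>{0..1} \<Longrightarrow> h (s, 0) = x \<and> h (s, 1) = x"
    using assms(2) unfolding loop_homotopy_iff by blast
  then show ?thesis
    by (intro loop_homotopyI[of Y "p \<circ> h"]) (auto intro: continuous_map_compose[OF _ p])
qed

lemma fundamental_group_map_class:
  assumes p: "continuous_map X Y p" and f: "f \<in> loops X x"
  shows "fundamental_group_map Y (p x) p (loop_homotopy X x `` {f})
       = loop_homotopy Y (p x) `` {p \<circ> f}"
proof -
  let ?q = "loop_homotopy Y (p x)"
  let ?A = "loop_homotopy X x `` {f}"
  have cls: "?q `` {p \<circ> f'} = ?q `` {p \<circ> f}" if "f' \<in> ?A" for f'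
    using that loop_homotopy_class_eq[OF loop_homotopy_compose[OF p, of f f']] by simp
  have "?q `` ((\<lambda>g. p \<circ> g) ` ?A) = (\<Union>f'\<in>?A. ?q `` {p \<circ> f'})"
    by (auto simp only: Image_def image_def)
  also have "\<dots> = (\<Union>f'\<in>?A. ?q `` {p \<circ> f})"
    by (intro SUP_cong refl cls)
  also have "\<dots> = ?q `` {p \<circ> f}"
    using loop_homotopy_refl[OF f] by (intro cSUP_const) auto
  finally show ?thesis
    unfolding fundamental_group_map_def .
qed

theorem group_hom_fundamental_group_map:
  assumes p: "continuous_map X Y p" and x: "x \<in> topspace X"
  shows "group_hom (fundamental_group X x) (fundamental_group Y (p x))
     (fundamental_group_map Y (p x) p)"
proof -
  have px: "p x \<in> topspace Y" using continuous_map_image_subset_topspace[OF p] x by blast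
  have "fundamental_group_map Y (p x) p \<in> hom (fundamental_group X x) (fundamental_group Y (p x))"
  proof (rule homI)
    fix A assume "A \<in> carrier (fundamental_group X x)"
    then obtain f where f: "f \<in> loops X x" "A = loop_homotopy X x `` {f}"
      by (rule fundamental_group_carrierE)
    show "fundamental_group_map Y (p x) p A \<in> carrier (fundamental_group Y (p x))"
      using f by (simp add: fundamental_group_map_class[OF p] fundamental_group_carrierI
          loops_compose[OF p])
    fix B assume "B \<in> carrier (fundamental_group X x)"
    then obtain g where g: "g \<in> loops X x" "B = loop_homotopy X x `` {g}"
      by (rule fundamental_group_carrierE)
    have "p \<circ> loop_join f g = loop_join (p \<circ> f) (p \<circ> g)"
      by (auto simp: loop_join_def)
    then show "fundamental_group_map Y (p x) p (A \<otimes>\<^bsub>fundamental_group X x\<^esub> B) =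
      fundamental_group_map Y (p x) p A \<otimes>\<^bsub>fundamental_group Y (p x)\<^esub> fundamental_group_map Y (p x) p B"
      using f g by (simp add: fundamental_group_mult fundamental_group_map_class[OF p]
          loop_join_loops loops_compose[OF p])
  qed
  then show ?thesis
    using group_fundamental_group[OF x] group_fundamental_group[OF px]
    by (simp add: group_hom_def group_hom_axioms_def)
qed

section \<open>Trace and index of linear maps\<close>

text \<open>A locale of its own, so that the definitions below are not propagated to the existing
  interpretations of \<^locale>\<open>vector_space\<close>.\<close>

locale vector_space_endo = vector_space scale
  for scale :: "'a::field \<Rightarrow> 'b::ab_group_add \<Rightarrow> 'b"
begin

abbreviation endo :: "('b \<Rightarrow> 'b) \<Rightarrow> bool" where
  "endo f \<equiv> Vector_Spaces.linear scale scale f"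

lemma endoI:
  "\<lbrakk>\<And>x y. f (x + y) = f x + f y; \<And>c x. f (scale c x) = scale c (f x)\<rbrakk> \<Longrightarrow> endo f"
  using vector_space_axioms by (auto simp: Vector_Spaces.linear_iff)

lemma
  assumes "endo f"
  shows endo_add: "f (x + y) = f x + f y" and endo_scale: "f (scale c x) = scale c (f x)"
    and endo_diff: "f (x - y) = f x - f y" and endo_zero: "f 0 = 0"
    and endo_sum: "f (\<Sum>i\<in>I. h i) = (\<Sum>i\<in>I. f (h i))"
proof -
  interpret f: Vector_Spaces.linear scale scale f by fact
  show "f (x + y) = f x + f y" "f (scale c x) = scale c (f x)" "f (x - y) = f x - f y" "f 0 = 0"
    "f (\<Sum>i\<in>I. h i) = (\<Sum>i\<in>I. f (h i))"
    by (simp_all add: f.add f.scale f.diff f.sum)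
qed

lemmas endo_rules = endo_add endo_scale endo_diff endo_zero

section \<open>Finite-rank maps and their trace\<close>

definition finite_rank :: "('b \<Rightarrow> 'b) \<Rightarrow> bool" where
  "finite_rank f \<longleftrightarrow> endo f \<and> (\<exists>S. finite S \<and> range f \<subseteq> span S)"

lemma finite_rank_endo: "finite_rank f \<Longrightarrow> endo f"
  by (simp add: finite_rank_def)

lemma
  assumes f: "endo f"
  shows endo_compose: "endo g \<Longrightarrow> endo (\<lambda>x. f (g x))"
    and endo_diff_id: "endo (\<lambda>x. x - f x)"
    and endo_plus: "endo g \<Longrightarrow> endo (\<lambda>x. f x + g x)"
proof -
  note f = endo_rules[OF f]
  show "endo (\<lambda>x. x - f x)"
    by (rule endoI) (simp_all add: f scale_right_diff_distrib)
  assume "endo g"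
  note g = endo_rules[OF this]
  show "endo (\<lambda>x. f (g x))" "endo (\<lambda>x. f x + g x)"
    by (rule endoI, simp_all add: f g scale_right_distrib)+
qed

lemma finite_rank_compose_left: "finite_rank f \<Longrightarrow> endo g \<Longrightarrow> finite_rank (\<lambda>x. f (g x))"
  by (auto simp: finite_rank_def endo_compose)

lemma finite_rank_compose_right:
  assumes "finite_rank f" "endo g" shows "finite_rank (\<lambda>x. g (f x))"
proof -
  obtain S where S: "finite S" "range f \<subseteq> span S" and f: "endo f"
    using assms by (auto simp: finite_rank_def)
  interpret g: Vector_Spaces.linear scale scale g by fact
  have "range (\<lambda>x. g (f x)) \<subseteq> span (g ` S)"
    using S by (auto simp: g.span_image)
  then show ?thesis
    using S assms f by (auto simp: finite_rank_def endo_compose intro!: exI[of _ "g ` S"])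
qed

lemma finite_rank_add:
  assumes "finite_rank f" "finite_rank g" shows "finite_rank (\<lambda>x. f x + g x)"
proof -
  obtain S T where "finite S" "range f \<subseteq> span S" "finite T" "range g \<subseteq> span T" "endo f" "endo g"
    using assms by (auto simp: finite_rank_def)
  then have "finite (S \<union> T)" "range (\<lambda>x. f x + g x) \<subseteq> span (S \<union> T)" "endo (\<lambda>x. f x + g x)"
    using span_mono[of S "S \<union> T"] span_mono[of T "S \<union> T"]
    by (auto intro!: span_add simp: endo_plus)
  then show ?thesis unfolding finite_rank_def by blast
qed

lemma finite_rank_minus: "finite_rank f \<Longrightarrow> finite_rank (\<lambda>x. - f x)"
  using finite_rank_compose_right[of f "\<lambda>x. - x"] endoI[of "\<lambda>x. - x"] by (simp add: scale_minus_right)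

lemma finite_rank_diff:
  "finite_rank f \<Longrightarrow> finite_rank g \<Longrightarrow> finite_rank (\<lambda>x. f x - g x)"
  using finite_rank_add[of f "\<lambda>x. - g x"] finite_rank_minus[of g] by simp

lemma finite_rank_zero: "finite_rank (\<lambda>x. 0)"
  unfolding finite_rank_def by (auto intro!: endoI exI[of _ "{}"])

text \<open>The diagonal sum in an arbitrary Hamel basis. For finite-rank maps only finitely many
  entries are nonzero, and by \<open>trace_expansion\<close> the value does not depend on the
  basis.\<close>

definition trace :: "('b \<Rightarrow> 'b) \<Rightarrow> 'a" where
  "trace f = (\<Sum>b | representation (extend_basis {}) (f b) b \<noteq> 0.
     representation (extend_basis {}) (f b) b)"

abbreviation functional :: "('b \<Rightarrow> 'a) \<Rightarrow> bool" where
  "functional c \<equiv> (\<forall>x y. c (x + y) = c x + c y) \<and> (\<forall>a x. c (scale a x) = a * c x)"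

lemma functional_sum:
  assumes "functional c" "finite I" shows "c (\<Sum>i\<in>I. h i) = (\<Sum>i\<in>I. c (h i))"
proof -
  have "c 0 = 0" using assms(1) by (metis mult_zero_left scale_zero_left)
  with assms(2,1) show ?thesis by (induction I rule: finite_induct) auto
qed

text \<open>The right-hand side mentions no basis, so any decomposition into rank-one terms computes
  the trace. Only the finitely many basis vectors occurring in the \<open>v i\<close> contribute to
  the diagonal, which permits exchanging the two sums.\<close>

lemma trace_expansion:
  assumes I: "finite I" and c: "\<And>i. i \<in> I \<Longrightarrow> functional (c i)"
    and f: "\<And>x. f x = (\<Sum>i\<in>I. scale (c i x) (v i))"
  shows "trace f = (\<Sum>i\<in>I. c i (v i))"
    and "finite {b. representation (extend_basis {}) (f b) b \<noteq> 0}"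
proof -
  let ?B = "extend_basis {}"
  let ?r = "representation ?B"
  have B: "independent ?B" "\<And>x. x \<in> span ?B"
    using independent_extend_basis[OF independent_empty] span_extend_basis[OF independent_empty]
    by auto
  define U where "U = (\<Union>i\<in>I. {b. ?r (v i) b \<noteq> 0})"
  have U: "finite U" using I by (auto simp: U_def finite_representation)
  have rf: "?r (f x) b = (\<Sum>i\<in>I. c i x * ?r (v i) b)" for x b
    unfolding f by (simp add: representation_sum[OF B] representation_scale[OF B])
  have sub: "{b. ?r (f b) b \<noteq> 0} \<subseteq> U"
    unfolding rf U_def by (auto elim!: sum.not_neutral_contains_not_neutral)
  then show "finite {b. ?r (f b) b \<noteq> 0}" using U finite_subset by blast
  have v: "v i = (\<Sum>b\<in>U. scale (?r (v i) b) b)" if "i \<in> I" for i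
  proof -
    have "v i = (\<Sum>b | ?r (v i) b \<noteq> 0. scale (?r (v i) b) b)"
      using B by (simp add: sum_nonzero_representation_eq)
    also have "\<dots> = (\<Sum>b\<in>U. scale (?r (v i) b) b)"
      using that U by (intro sum.mono_neutral_left) (auto simp: U_def)
    finally show ?thesis .
  qed
  have "trace f = (\<Sum>b\<in>U. ?r (f b) b)"
    unfolding trace_def using sub U by (intro sum.mono_neutral_left) auto
  also have "\<dots> = (\<Sum>b\<in>U. \<Sum>i\<in>I. c i b * ?r (v i) b)" by (simp add: rf)
  also have "\<dots> = (\<Sum>i\<in>I. \<Sum>b\<in>U. c i b * ?r (v i) b)" by (rule sum.swap)
  also have "\<dots> = (\<Sum>i\<in>I. c i (\<Sum>b\<in>U. scale (?r (v i) b) b))"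
    using c U by (intro sum.cong refl) (simp add: functional_sum mult.commute)
  also have "\<dots> = (\<Sum>i\<in>I. c i (v i))" using v by simp
  finally show "trace f = (\<Sum>i\<in>I. c i (v i))" .
qed

lemma finite_rank_basis:
  assumes "finite_rank f"
  obtains S where "finite S" "independent S" "S \<subseteq> range f" "span S = range f" "card S = dim (range f)"
    "\<And>x. f x = (\<Sum>s\<in>S. scale (representation S (f x) s) s)"
    "\<And>s. s \<in> S \<Longrightarrow> functional (\<lambda>x. representation S (f x) s)"
proof -
  obtain T where T: "finite T" "range f \<subseteq> span T" and f: "endo f"
    using assms by (auto simp: finite_rank_def)
  obtain S where S: "S \<subseteq> range f" "independent S" "range f \<subseteq> span S" "card S = dim (range f)"
    using basis_exists by blast
  interpret f: Vector_Spaces.linear scale scale f by fact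
  have sub: "subspace (range f)" using f.subspace_image[OF subspace_UNIV] .
  have fin: "finite S"
    using independent_span_bound[OF T(1) S(2)] S(1) T(2) by blast
  have fS: "f x \<in> span S" for x using S(3) by auto
  show thesis
  proof (rule that[OF fin S(2,1) _ S(4)])
    show "span S = range f" using S sub by (simp add: span_minimal subset_antisym)
    show "f x = (\<Sum>s\<in>S. scale (representation S (f x) s) s)" for x
      by (rule sum_representation_eq[OF S(2) fS fin subset_refl, symmetric])
    show "functional (\<lambda>x. representation S (f x) s)" for s
      by (simp add: f.add f.scale representation_add[OF S(2) fS fS] representation_scale[OF S(2) fS])
  qed
qed

text \<open>Writing \<open>f\<close> as a sum of rank-one maps turns both traces into the same sum
  of coordinates of \<open>f (g s)\<close>.\<close>

lemma trace_comp_commute: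
  assumes f: "finite_rank f" and g: "endo g"
  shows "trace (\<lambda>x. f (g x)) = trace (\<lambda>x. g (f x))"
proof -
  obtain S where S: "finite S"
    and fx: "\<And>x. f x = (\<Sum>s\<in>S. scale (representation S (f x) s) s)"
    and c: "\<And>s. s \<in> S \<Longrightarrow> functional (\<lambda>x. representation S (f x) s)"
    by (rule finite_rank_basis[OF f]) blast
  have 1: "trace (\<lambda>x. f (g x)) = (\<Sum>s\<in>S. representation S (f (g s)) s)"
    using c g by (intro trace_expansion[OF S, where c = "\<lambda>s x. representation S (f (g x)) s"] fx)
      (simp add: endo_rules)
  have 2: "trace (\<lambda>x. g (f x)) = (\<Sum>s\<in>S. representation S (f (g s)) s)"
  proof (rule trace_expansion[OF S, where c = "\<lambda>s x. representation S (f x) s"])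
    show "g (f x) = (\<Sum>i\<in>S. scale (representation S (f x) i) (g i))" for x
      by (subst fx) (simp add: endo_sum[OF g] endo_scale[OF g])
  qed (rule c)
  show ?thesis using 1 2 by simp
qed

lemma
  assumes "finite_rank f" "finite_rank g"
  shows trace_add: "trace (\<lambda>x. f x + g x) = trace f + trace g"
    and trace_diff: "trace (\<lambda>x. f x - g x) = trace f - trace g"
proof -
  let ?B = "extend_basis {}"
  let ?r = "representation ?B"
  have B: "independent ?B" "\<And>x. x \<in> span ?B"
    using independent_extend_basis[OF independent_empty] span_extend_basis[OF independent_empty]
    by auto
  have fin: "finite {b. ?r (h b) b \<noteq> 0}" if h: "finite_rank h" for h
    by (rule finite_rank_basis[OF h], rule trace_expansion(2)) blast+
  define U where "U = {b. ?r (f b) b \<noteq> 0} \<union> {b. ?r (g b) b \<noteq> 0}"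
  have U: "finite U" unfolding U_def using assms fin by blast
  have tr: "trace h = (\<Sum>b\<in>U. ?r (h b) b)" if "{b. ?r (h b) b \<noteq> 0} \<subseteq> U" for h
    unfolding trace_def using U that by (intro sum.mono_neutral_left) auto
  show "trace (\<lambda>x. f x + g x) = trace f + trace g"
    by (subst (1 2 3) tr) (auto simp: U_def representation_add[OF B(1,2,2)] sum.distrib)
  show "trace (\<lambda>x. f x - g x) = trace f - trace g"
    by (subst (1 2 3) tr) (auto simp: U_def representation_diff[OF B(1,2,2)] sum_subtractf)
qed

text \<open>\<open>f\<close> fixes each vector of a basis of its range, so every diagonal term is
  1.\<close>

lemma trace_idempotent:
  assumes f: "finite_rank f" and ff: "\<And>x. f (f x) = f x"
  shows "trace f = of_nat (dim (range f))"
proof -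
  obtain S where S: "finite S" "independent S" "S \<subseteq> range f" "card S = dim (range f)"
    and fx: "\<And>x. f x = (\<Sum>s\<in>S. scale (representation S (f x) s) s)"
    and c: "\<And>s. s \<in> S \<Longrightarrow> functional (\<lambda>x. representation S (f x) s)"
    by (rule finite_rank_basis[OF f]) blast
  have "trace f = (\<Sum>s\<in>S. representation S (f s) s)"
    using c fx by (intro trace_expansion[OF S(1), where c = "\<lambda>s x. representation S (f x) s"])
  also have "\<dots> = (\<Sum>s\<in>S. 1)"
  proof (intro sum.cong refl)
    fix s assume s: "s \<in> S"
    then have "f s = s" using S(3) ff by auto
    then show "representation S (f s) s = 1" using representation_basis[OF S(2) s] by simp
  qed
  finally show ?thesis using S by simp
qed

section \<open>The algebraic index\<close>

definition parametrix :: "('b \<Rightarrow> 'b) \<Rightarrow> ('b \<Rightarrow> 'b) \<Rightarrow> bool" where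
  "parametrix f g \<longleftrightarrow> endo f \<and> endo g \<and>
     finite_rank (\<lambda>x. x - g (f x)) \<and> finite_rank (\<lambda>x. x - f (g x))"

text \<open>Fedosov's trace formula for the Fredholm index. The choice of parametrix is immaterial
  by \<open>index_eq\<close>, and \<open>generalized_inverse_parametrix\<close> identifies the value
  with a difference of dimensions.\<close>

definition index :: "('b \<Rightarrow> 'b) \<Rightarrow> 'a" where
  "index f = (let g = (SOME g. parametrix f g)
              in trace (\<lambda>x. x - g (f x)) - trace (\<lambda>x. x - f (g x)))"

lemma parametrixD:
  assumes "parametrix f g"
  shows "endo f" "endo g" "finite_rank (\<lambda>x. x - g (f x))" "finite_rank (\<lambda>x. x - f (g x))"
  using assms by (simp_all add: parametrix_def)

lemma parametrixI:
  "\<lbrakk>endo f; endo g; finite_rank (\<lambda>x. x - g (f x)); finite_rank (\<lambda>x. x - f (g x))\<rbrakk> \<Longrightarrow> parametrix f g"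
  by (simp add: parametrix_def)

lemma index_eq:
  assumes fg: "parametrix f g"
  shows "index f = trace (\<lambda>x. x - g (f x)) - trace (\<lambda>x. x - f (g x))"
proof -
  define h where "h = (SOME g. parametrix f g)"
  have fh: "parametrix f h" unfolding h_def by (rule someI[where P = "parametrix f", OF fg])
  note G = parametrixD[OF fg] and H = parametrixD[OF fh]
  note f = endo_rules[OF G(1)] and h = endo_rules[OF H(2)]
  define d where "d = (\<lambda>x. h x - g x)"
  \<comment> \<open>Two parametrices differ by a finite-rank \<open>d\<close>, because
    \<open>h - g = h (1 - f g) - (1 - h f) g\<close>. The two traces then change by those of
    \<open>d f\<close> and \<open>f d\<close>, which agree.\<close>
  have d: "d = (\<lambda>x. h (x - f (g x)) - (g x - h (f (g x))))"
    by (simp add: d_def h)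
  have frd: "finite_rank d"
    unfolding d
    by (rule finite_rank_diff[OF finite_rank_compose_right[OF G(4) H(2)]
        finite_rank_compose_left[OF H(3) G(2)]])
  have "trace (\<lambda>x. x - g (f x)) = trace (\<lambda>x. (x - h (f x)) + d (f x))"
    by (simp add: d_def)
  also have "\<dots> = trace (\<lambda>x. x - h (f x)) + trace (\<lambda>x. d (f x))"
    by (rule trace_add[OF H(3) finite_rank_compose_left[OF frd G(1)]])
  finally have 1: "trace (\<lambda>x. x - g (f x)) = trace (\<lambda>x. x - h (f x)) + trace (\<lambda>x. d (f x))" .
  have "trace (\<lambda>x. x - f (g x)) = trace (\<lambda>x. (x - f (h x)) + f (d x))"
    by (simp add: d_def f)
  also have "\<dots> = trace (\<lambda>x. x - f (h x)) + trace (\<lambda>x. f (d x))"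
    by (rule trace_add[OF H(4) finite_rank_compose_right[OF frd G(1)]])
  finally have 2: "trace (\<lambda>x. x - f (g x)) = trace (\<lambda>x. x - f (h x)) + trace (\<lambda>x. f (d x))" .
  show ?thesis
    unfolding index_def Let_def h_def[symmetric] 1 2 trace_comp_commute[OF frd G(1)] by simp
qed

text \<open>\<open>g' g\<close> is a parametrix of \<open>f f'\<close>. With
  \<open>p = 1 - g f\<close> and \<open>q = 1 - f' g'\<close>, cyclicity of the trace gives the
  extra terms \<open>trace p - trace (p q)\<close> and \<open>trace q - trace (q p)\<close>, whose
  mixed parts cancel.\<close>

lemma index_compose:
  assumes fg: "parametrix f g" and fg': "parametrix f' g'"
  shows "index (\<lambda>x. f (f' x)) = index f + index f'"
proof -
  define p where "p = (\<lambda>x. x - g (f x))"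
  define q where "q = (\<lambda>x. x - f' (g' x))"
  note G = parametrixD[OF fg] and G' = parametrixD[OF fg']
  have pq: "finite_rank p" "finite_rank q"
    unfolding p_def q_def by (fact G G')+
  note epq = pq[THEN finite_rank_endo]
  note f = endo_rules[OF G(1)] and g' = endo_rules[OF G'(2)]
    and p = endo_rules[OF epq(1)] and q = endo_rules[OF epq(2)]
  have 1: "(\<lambda>x. x - g' (g (f (f' x)))) = (\<lambda>x. (x - g' (f' x)) + g' (p (f' x)))"
    by (simp add: p_def g')
  have 2: "(\<lambda>x. x - f (f' (g' (g x)))) = (\<lambda>x. (x - f (g x)) + f (q (g x)))"
    by (simp add: q_def f)
  note fr1 = finite_rank_compose_left[OF pq(1) G'(1)] and fr2 = finite_rank_compose_left[OF pq(2) G(2)]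
  note fr3 = finite_rank_compose_right[OF fr1 G'(2)] and fr4 = finite_rank_compose_right[OF fr2 G(1)]
  have par: "parametrix (\<lambda>x. f (f' x)) (\<lambda>x. g' (g x))"
  proof (rule parametrixI)
    show "endo (\<lambda>x. f (f' x))" by (rule endo_compose[OF G(1) G'(1)])
    show "endo (\<lambda>x. g' (g x))" by (rule endo_compose[OF G'(2) G(2)])
    show "finite_rank (\<lambda>x. x - g' (g (f (f' x))))"
      unfolding 1 by (rule finite_rank_add[OF G'(3) fr3])
    show "finite_rank (\<lambda>x. x - f (f' (g' (g x))))"
      unfolding 2 by (rule finite_rank_add[OF G(4) fr4])
  qed
  have A: "trace (\<lambda>x. g' (p (f' x))) = trace p - trace (\<lambda>x. p (q x))"
  proof -
    have "trace (\<lambda>x. g' (p (f' x))) = trace (\<lambda>x. p (f' (g' x)))"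
      by (rule trace_comp_commute[OF fr1 G'(2), symmetric])
    also have "\<dots> = trace (\<lambda>x. p x - p (q x))"
      by (simp add: q_def p)
    also have "\<dots> = trace p - trace (\<lambda>x. p (q x))"
      by (rule trace_diff[OF pq(1) finite_rank_compose_left[OF pq(1) epq(2)]])
    finally show ?thesis .
  qed
  have B: "trace (\<lambda>x. f (q (g x))) = trace q - trace (\<lambda>x. q (p x))"
  proof -
    have "trace (\<lambda>x. f (q (g x))) = trace (\<lambda>x. q (g (f x)))"
      by (rule trace_comp_commute[OF fr2 G(1), symmetric])
    also have "\<dots> = trace (\<lambda>x. q x - q (p x))"
      by (simp add: p_def q)
    also have "\<dots> = trace q - trace (\<lambda>x. q (p x))"
      by (rule trace_diff[OF pq(2) finite_rank_compose_left[OF pq(2) epq(1)]])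
    finally show ?thesis .
  qed
  have "index (\<lambda>x. f (f' x)) =
     trace (\<lambda>x. (x - g' (f' x)) + g' (p (f' x))) - trace (\<lambda>x. (x - f (g x)) + f (q (g x)))"
    unfolding index_eq[OF par] 1 2 ..
  also have "\<dots> = trace (\<lambda>x. x - g' (f' x)) + trace p - (trace (\<lambda>x. x - f (g x)) + trace q)"
    unfolding trace_add[OF G'(3) fr3] trace_add[OF G(4) fr4] A B trace_comp_commute[OF pq(1) epq(2)]
    by simp
  also have "\<dots> = index f + index f'"
    unfolding index_eq[OF fg] index_eq[OF fg'] p_def q_def by simp
  finally show "index (\<lambda>x. f (f' x)) = index f + index f'" .
qed

text \<open>The same \<open>g\<close> remains a parametrix, and the two traces change by those of
  \<open>g h\<close> and \<open>h g\<close>, which are equal.\<close>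

lemma index_finite_rank:
  assumes fg: "parametrix f g" and h: "finite_rank h"
  shows "index (\<lambda>x. f x + h x) = index f"
proof -
  note G = parametrixD[OF fg] and eh = finite_rank_endo[OF h]
  have 1: "(\<lambda>x. x - g (f x + h x)) = (\<lambda>x. (x - g (f x)) - g (h x))"
    and 2: "(\<lambda>x. x - (f (g x) + h (g x))) = (\<lambda>x. (x - f (g x)) - h (g x))"
    by (simp_all add: endo_rules[OF G(2)] diff_diff_eq)
  note fr = finite_rank_compose_right[OF h G(2)] finite_rank_compose_left[OF h G(2)]
  have par: "parametrix (\<lambda>x. f x + h x) g"
  proof (rule parametrixI)
    show "endo (\<lambda>x. f x + h x)" by (rule endo_plus[OF G(1) eh])
    show "finite_rank (\<lambda>x. x - g (f x + h x))"
      unfolding 1 by (rule finite_rank_diff[OF G(3) fr(1)])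
    show "finite_rank (\<lambda>x. x - (f (g x) + h (g x)))"
      unfolding 2 by (rule finite_rank_diff[OF G(4) fr(2)])
  qed (rule G(2))
  show "index (\<lambda>x. f x + h x) = index f"
    unfolding index_eq[OF fg] index_eq[OF par] 1 2 trace_diff[OF G(3) fr(1)] trace_diff[OF G(4) fr(2)]
      trace_comp_commute[OF h G(2)]
    by simp
qed

lemma
  assumes "endo f" "endo g" "\<And>x. g (f x) = x" "\<And>x. f (g x) = x"
  shows parametrix_inverse: "parametrix f g" and index_inverse: "index f = 0"
proof -
  show par: "parametrix f g" using assms by (simp add: parametrix_def finite_rank_zero)
  show "index f = 0" using assms(3,4) by (simp add: index_eq[OF par])
qed

text \<open>As in a monoid, a left and a right inverse coincide, here modulo finite rank:
  \<open>f h - f g = f (1 - g f) h - f g (1 - f h)\<close>.\<close>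

lemma parametrix_left_right:
  assumes f: "endo f" and g: "endo g" and h: "endo h"
    and gf: "finite_rank (\<lambda>x. x - g (f x))" and fh: "finite_rank (\<lambda>x. x - f (h x))"
  shows "parametrix f g"
proof -
  have eq: "(\<lambda>x. x - f (g x)) = (\<lambda>x. (x - f (h x)) + (f (h x - g (f (h x))) - f (g (x - f (h x)))))"
    by (simp add: endo_rules[OF f] endo_rules[OF g])
  have 1: "finite_rank (\<lambda>x. f (h x - g (f (h x))))"
    by (rule finite_rank_compose_right[OF finite_rank_compose_left[OF gf h] f])
  have 2: "finite_rank (\<lambda>x. f (g (x - f (h x))))"
    by (rule finite_rank_compose_right[OF finite_rank_compose_right[OF fh g] f])
  have "finite_rank (\<lambda>x. x - f (g x))"
    unfolding eq by (rule finite_rank_add[OF fh finite_rank_diff[OF 1 2]])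
  then show ?thesis by (rule parametrixI[OF f g gf])
qed

text \<open>A parametrix that is a generalized inverse turns both traces into dimensions.\<close>

lemma generalized_inverse_parametrix:
  assumes "parametrix f g0"
  obtains g where "parametrix f g" "\<And>x. f (g (f x)) = f x"
    "{x. f x = 0} = range (\<lambda>x. x - g (f x))"
    "index f = of_nat (dim {x. f x = 0}) - of_nat (dim (range (\<lambda>x. x - f (g x))))"
proof -
  note G = parametrixD[OF assms]
  interpret vs: vector_space_pair scale scale ..
  obtain g where g: "endo g" "\<And>x. f (g (f x)) = f x"
    using vs.linear_exists_right_inverse_on[OF G(1) subspace_UNIV] by auto
  note fr = endo_rules[OF G(1)] and gr = endo_rules[OF g(1)] and g0r = endo_rules[OF G(2)]
  have e1: "endo (\<lambda>x. x - g (f x))" and e2: "endo (\<lambda>x. f (g x))"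
    using endo_diff_id[OF endo_compose[OF g(1) G(1)]] endo_compose[OF G(1) g(1)] by auto
  \<comment> \<open>\<open>f\<close> annihilates \<open>x - g (f x)\<close>, so applying
    \<open>1 - g0 f\<close>, which has finite rank, changes nothing. For the other side,
    \<open>1 - f g\<close> annihilates the range of \<open>f\<close>, so it equals its product with
    \<open>1 - f g0\<close>.\<close>
  have "(\<lambda>x. x - g (f x)) = (\<lambda>x. (x - g (f x)) - g0 (f (x - g (f x))))"
    by (simp add: fr gr g0r g(2))
  then have fr1: "finite_rank (\<lambda>x. x - g (f x))"
    using finite_rank_compose_left[OF G(3) e1] by simp
  have "(\<lambda>x. x - f (g x)) = (\<lambda>x. (x - f (g0 x)) - f (g (x - f (g0 x))))"
    by (simp add: fr gr g(2))
  then have fr2: "finite_rank (\<lambda>x. x - f (g x))"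
    using finite_rank_diff[OF G(4) finite_rank_compose_right[OF G(4) e2]] by simp
  have par: "parametrix f g" by (rule parametrixI[OF G(1) g(1) fr1 fr2])
  have ker: "{x. f x = 0} = range (\<lambda>x. x - g (f x))"
  proof (intro equalityI subsetI)
    fix x assume "x \<in> {x. f x = 0}"
    then have "x = x - g (f x)" by (simp add: gr)
    then show "x \<in> range (\<lambda>x. x - g (f x))" by blast
  qed (auto simp: fr g(2))
  have 1: "trace (\<lambda>x. x - g (f x)) = of_nat (dim (range (\<lambda>x. x - g (f x))))"
    by (rule trace_idempotent[OF fr1]) (simp add: fr gr g(2))
  have 2: "trace (\<lambda>x. x - f (g x)) = of_nat (dim (range (\<lambda>x. x - f (g x))))"
    by (rule trace_idempotent[OF fr2]) (simp add: fr gr g(2))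
  show thesis
    by (rule that[OF par g(2) ker]) (unfold index_eq[OF par] ker 1 2, rule refl)
qed

text \<open>Used in \<open>kernel_correction\<close> to identify a kernel with a cokernel of the
  same dimension.\<close>

lemma finite_rank_iso_exists:
  assumes f: "finite_rank f" and g: "finite_rank g" and eq: "dim (range f) = dim (range g)"
  obtains h where "endo h" "h ` range f = range g" "inj_on h (range f)"
proof -
  interpret vs: vector_space_pair scale scale ..
  obtain S where S: "finite S" "independent S" "S \<subseteq> range f" "span S = range f" "card S = dim (range f)"
    by (rule finite_rank_basis[OF f]) blast
  obtain T where T: "finite T" "independent T" "T \<subseteq> range g" "span T = range g" "card T = dim (range g)"
    by (rule finite_rank_basis[OF g]) blast
  show thesis
    using vs.finite_basis_to_basis_subspace_isomorphism[of "range f" "range g" S T] S T eq that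
      subspace_span[of S] subspace_span[of T] by auto
qed

end

section \<open>Continuous selections modulo a closed subspace\<close>

lemma infdist_lessE:
  assumes "infdist x A < e" "A \<noteq> {}"
  obtains a where "a \<in> A" "dist x a < e"
  using assms by (auto simp: infdist_def cINF_less_iff split: if_splits)

section \<open>The distance to a subspace as the quotient seminorm\<close>

lemma infdist_subspace_le_norm: "subspace K \<Longrightarrow> infdist x K \<le> norm x"
  for x :: "'b::real_normed_vector"
  using infdist_le[of 0 K x] by (simp add: subspace_0)

lemma infdist_subspace_zero_iff:
  "subspace K \<Longrightarrow> closed K \<Longrightarrow> infdist x K = 0 \<longleftrightarrow> x \<in> K" for x :: "'b::real_normed_vector"
  using in_closed_iff_infdist_zero[of K x] subspace_0 by blast

lemma infdist_subspace_add:
  fixes x y :: "'b::real_normed_vector"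
  assumes K: "subspace K" shows "infdist (x + y) K \<le> infdist x K + infdist y K"
proof (rule field_le_epsilon)
  fix e :: real assume e: "0 < e"
  have ne: "K \<noteq> {}" using K subspace_0 by blast
  obtain a where a: "a \<in> K" "dist x a < infdist x K + e/2"
    using e ne by (rule_tac infdist_lessE[of x K "infdist x K + e/2"]) auto
  obtain b where b: "b \<in> K" "dist y b < infdist y K + e/2"
    using e ne by (rule_tac infdist_lessE[of y K "infdist y K + e/2"]) auto
  have "infdist (x + y) K \<le> dist (x + y) (a + b)"
    using a b K by (intro infdist_le subspace_add)
  also have "\<dots> \<le> dist x a + dist y b" by (rule dist_triangle_add)
  finally show "infdist (x + y) K \<le> infdist x K + infdist y K + e" using a b by simp
qed

lemma infdist_subspace_scale_le:
  fixes x :: "'b::real_normed_vector"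
  assumes K: "subspace K" shows "infdist (c *\<^sub>R x) K \<le> \<bar>c\<bar> * infdist x K"
proof (cases "c = 0")
  case True then show ?thesis using K by (simp add: infdist_zero subspace_0)
next
  case False
  show ?thesis
  proof (rule field_le_epsilon)
    fix e :: real assume e: "0 < e"
    obtain a where a: "a \<in> K" "dist x a < infdist x K + e/\<bar>c\<bar>"
      using e False K subspace_0 by (rule_tac infdist_lessE[of x K "infdist x K + e/\<bar>c\<bar>"]) auto
    have "infdist (c *\<^sub>R x) K \<le> dist (c *\<^sub>R x) (c *\<^sub>R a)"
      using a K by (intro infdist_le subspace_scale)
    also have "\<dots> = \<bar>c\<bar> * dist x a"
      by (simp add: dist_norm flip: scaleR_diff_right)
    also have "\<dots> \<le> \<bar>c\<bar> * (infdist x K + e/\<bar>c\<bar>)" using a by (intro mult_left_mono) auto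
    finally show "infdist (c *\<^sub>R x) K \<le> \<bar>c\<bar> * infdist x K + e"
      using False by (simp add: algebra_simps)
  qed
qed

lemma infdist_subspace_minus:
  "subspace K \<Longrightarrow> infdist (- x) K = infdist x K" for x :: "'b::real_normed_vector"
  using infdist_subspace_scale_le[of K "-1" x] infdist_subspace_scale_le[of K "-1" "- x"] by simp

lemma infdist_subspace_diff:
  "subspace K \<Longrightarrow> infdist (x - y) K \<le> infdist x K + infdist y K" for x y :: "'b::real_normed_vector"
  using infdist_subspace_add[of K x "- y"] by (simp add: infdist_subspace_minus)

lemma infdist_subspace_mod:
  fixes x y :: "'b::real_normed_vector"
  assumes K: "subspace K" and "x - y \<in> K" shows "infdist x K = infdist y K"
proof -
  have "infdist (x - y) K = 0" "infdist (y - x) K = 0"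
    using assms subspace_neg[OF K assms(2)] by auto
  then show ?thesis
    using infdist_subspace_add[OF K, of "x - y" y] infdist_subspace_add[OF K, of "y - x" x] by simp
qed

lemma infdist_subspace_sum:
  fixes v :: "'i \<Rightarrow> 'b::real_normed_vector"
  assumes K: "subspace K" and F: "finite F" and w: "\<And>i. i \<in> F \<Longrightarrow> 0 \<le> w i"
  shows "infdist (\<Sum>i\<in>F. w i *\<^sub>R v i) K \<le> (\<Sum>i\<in>F. w i * infdist (v i) K)"
  using F w
proof (induction F rule: finite_induct)
  case empty then show ?case using K by (simp add: subspace_0)
next
  case (insert i F)
  have "infdist (\<Sum>i\<in>insert i F. w i *\<^sub>R v i) K
      \<le> infdist (w i *\<^sub>R v i) K + infdist (\<Sum>i\<in>F. w i *\<^sub>R v i) K"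
    using insert by (simp add: infdist_subspace_add[OF K])
  also have "\<dots> \<le> w i * infdist (v i) K + (\<Sum>i\<in>F. w i * infdist (v i) K)"
    using insert infdist_subspace_scale_le[OF K, of "w i" "v i"] by (intro add_mono) auto
  finally show ?case using insert by simp
qed

text \<open>Each \<open>A x\<close> has a representative \<open>l x\<close> of norm below
  \<open>r\<close> modulo \<open>K\<close>, and it still approximates the class of
  \<open>A y\<close> for \<open>y\<close> near \<open>x\<close>. A partition of unity over finitely
  many balls averages these choices without exceeding the norm bound.\<close>

lemma selection_approx:
  fixes A :: "'m::metric_space \<Rightarrow> 'b::real_normed_vector"
  assumes K: "subspace K" and S: "compact S" and e: "0 < e"
    and cont: "\<And>x e. x \<in> S \<Longrightarrow> 0 < e \<Longrightarrow> \<exists>d>0. \<forall>y\<in>S. dist y x < d \<longrightarrow> infdist (A y - A x) K < e"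
    and bd: "\<And>x. x \<in> S \<Longrightarrow> infdist (A x) K < r"
  obtains b where "continuous_on S b" "\<And>x. x \<in> S \<Longrightarrow> norm (b x) \<le> r"
    "\<And>x. x \<in> S \<Longrightarrow> infdist (A x - b x) K < e"
proof -
  have "\<forall>x\<in>S. \<exists>d>0. \<forall>y\<in>S. dist y x < d \<longrightarrow> infdist (A y - A x) K < e/2"
    using cont e by (meson half_gt_zero)
  then obtain d where d: "\<And>x. x \<in> S \<Longrightarrow> 0 < d x"
    "\<And>x y. x \<in> S \<Longrightarrow> y \<in> S \<Longrightarrow> dist y x < d x \<Longrightarrow> infdist (A y - A x) K < e/2"
    by metis
  have "\<forall>x\<in>S. \<exists>l. A x - l \<in> K \<and> norm l < r"
  proof
    fix x assume "x \<in> S"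
    then obtain k where "k \<in> K" "dist (A x) k < r"
      using infdist_lessE[OF bd] K subspace_0 by blast
    then show "\<exists>l. A x - l \<in> K \<and> norm l < r" by (intro exI[of _ "A x - k"]) (auto simp: dist_norm)
  qed
  then obtain l where l: "\<And>x. x \<in> S \<Longrightarrow> A x - l x \<in> K" "\<And>x. x \<in> S \<Longrightarrow> norm (l x) < r" by metis
  have "S \<subseteq> (\<Union>x\<in>S. ball x (d x))" using d by auto
  then obtain F where F: "F \<subseteq> S" "finite F" "S \<subseteq> (\<Union>x\<in>F. ball x (d x))"
    using compactE_image[OF S, of S "\<lambda>x. ball x (d x)"] by auto
  \<comment> \<open>Unnormalised tent functions: \<open>u x\<close> vanishes exactly outside the
    ball of radius \<open>d x\<close> about \<open>x\<close>, where the approximation by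
    \<open>l x\<close> is not controlled.\<close>
  define u where "u x y = max 0 (d x - dist y x)" for x y
  define U where "U y = (\<Sum>x\<in>F. u x y)" for y
  define w where "w x y = u x y / U y" for x y
  define b where "b y = (\<Sum>x\<in>F. w x y *\<^sub>R l x)" for y
  have u0: "0 \<le> u x y" for x y by (simp add: u_def)
  have U: "0 < U y" if y: "y \<in> S" for y
  proof -
    obtain x where x: "x \<in> F" "y \<in> ball x (d x)" using F(3) y by blast
    then have "0 < u x y" by (simp add: u_def dist_commute)
    then show ?thesis unfolding U_def using x F u0 by (intro sum_pos2[of F x]) auto
  qed
  have w0: "0 \<le> w x y" if "y \<in> S" for x y using u0 U[OF that] by (simp add: w_def)
  have w1: "(\<Sum>x\<in>F. w x y) = 1" if "y \<in> S" for y
    using U[OF that] by (simp add: w_def U_def flip: sum_divide_distrib)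
  show thesis
  proof
    show "continuous_on S b"
      unfolding b_def w_def U_def u_def
      by (intro continuous_intros) (use U in \<open>force simp: U_def u_def\<close>)
  next
    fix y assume y: "y \<in> S"
    have "norm (b y) \<le> (\<Sum>x\<in>F. w x y * norm (l x))"
      unfolding b_def using w0[OF y] by (intro order.trans[OF norm_sum]) simp
    also have "\<dots> \<le> (\<Sum>x\<in>F. w x y * r)"
      using F l w0[OF y] by (intro sum_mono mult_left_mono) (auto simp: less_imp_le)
    finally show "norm (b y) \<le> r" by (simp add: w1[OF y] flip: sum_distrib_right)
    have "A y - b y = (\<Sum>x\<in>F. w x y *\<^sub>R (A y - l x))"
      by (simp add: b_def scaleR_diff_right sum_subtractf w1[OF y] flip: scaleR_sum_left)
    then have "infdist (A y - b y) K \<le> (\<Sum>x\<in>F. w x y * infdist (A y - l x) K)"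
      using infdist_subspace_sum[OF K F(2)] w0[OF y] by simp
    also have "\<dots> \<le> (\<Sum>x\<in>F. w x y * (e/2))"
    proof (intro sum_mono)
      fix x assume x: "x \<in> F"
      show "w x y * infdist (A y - l x) K \<le> w x y * (e/2)"
      proof (cases "dist y x < d x")
        case True
        have "infdist (A y - l x) K = infdist (A y - A x) K"
          using x F l by (intro infdist_subspace_mod[OF K]) auto
        then show ?thesis using d(2)[of x y] x F y True w0[OF y] by (intro mult_left_mono) auto
      next
        case False then show ?thesis by (simp add: w_def u_def)
      qed
    qed
    also have "\<dots> = e/2" by (simp only: w1[OF y] mult_1 flip: sum_distrib_right)
    finally show "infdist (A y - b y) K < e" using e by simp
  qed
qed

text \<open>A lifting theorem in the manner of Bartle and Graves for a map that is continuous only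
  modulo \<open>K\<close>. Each round approximates the remaining error by a continuous function no
  larger in norm than the current bound on the quotient seminorm, so the bounds halve and the
  increments sum geometrically.\<close>

theorem continuous_selection_mod_subspace:
  fixes A :: "'m::metric_space \<Rightarrow> 'b::banach"
  assumes K: "subspace K" "closed K" and S: "compact S"
    and cont: "\<And>x e. x \<in> S \<Longrightarrow> 0 < e \<Longrightarrow> \<exists>d>0. \<forall>y\<in>S. dist y x < d \<longrightarrow> infdist (A y - A x) K < e"
  obtains B where "continuous_on S B" "\<And>x. x \<in> S \<Longrightarrow> A x - B x \<in> K"
proof -
  have "continuous_on S (\<lambda>x. infdist (A x) K)"
    unfolding continuous_on_iff
  proof (intro ballI allI impI)
    fix x and e :: real assume "x \<in> S" "0 < e"
    then obtain d where d: "d > 0" "\<And>y. y \<in> S \<Longrightarrow> dist y x < d \<Longrightarrow> infdist (A y - A x) K < e"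
      using cont by blast
    have "dist (infdist (A y) K) (infdist (A x) K) < e" if "y \<in> S" "dist y x < d" for y
      using infdist_subspace_add[OF K(1), of "A y - A x" "A x"]
        infdist_subspace_diff[OF K(1), of "A y" "A y - A x"] d(2)[OF that]
      by (simp add: dist_real_def)
    with d(1) show "\<exists>d>0. \<forall>x'\<in>S. dist x' x < d \<longrightarrow> dist (infdist (A x') K) (infdist (A x) K) < e"
      by blast
  qed
  then have "bounded ((\<lambda>x. infdist (A x) K) ` S)"
    by (intro compact_imp_bounded compact_continuous_image S)
  then obtain r0 where "\<forall>y\<in>(\<lambda>x. infdist (A x) K) ` S. norm y \<le> r0"
    unfolding bounded_iff by blast
  then have r0: "\<And>x. x \<in> S \<Longrightarrow> infdist (A x) K \<le> r0"
    by (simp add: infdist_nonneg)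
  define r where "r = max 0 r0 + 1"
  have r: "0 < r" "\<And>x. x \<in> S \<Longrightarrow> infdist (A x) K < r"
    using r0 by (force simp: r_def)+
  \<comment> \<open>The clause for \<open>n = 0\<close> starts the sequence at zero, so that the
    telescoping sum of the increments is exactly \<open>g n\<close>.\<close>
  have "\<exists>g. \<forall>n. (continuous_on S (g n) \<and> (\<forall>x\<in>S. infdist (A x - g n x) K < r / 2^n) \<and> (n = 0 \<longrightarrow> g n = (\<lambda>_. 0)))
     \<and> (\<forall>x\<in>S. norm (g (Suc n) x - g n x) \<le> r / 2^n)"
  proof (intro dependent_nat_choice conjI)
    show "\<exists>g. continuous_on S g \<and> (\<forall>x\<in>S. infdist (A x - g x) K < r / 2^0) \<and> (0 = (0::nat) \<longrightarrow> g = (\<lambda>_. 0))"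
      by (intro exI[of _ "\<lambda>_. 0"]) (use r in auto)
  next
    fix g :: "'m \<Rightarrow> 'b" and n :: nat
    assume "continuous_on S g \<and> (\<forall>x\<in>S. infdist (A x - g x) K < r / 2^n) \<and> (n = 0 \<longrightarrow> g = (\<lambda>_. 0))"
    then have g: "continuous_on S g" "\<And>x. x \<in> S \<Longrightarrow> infdist (A x - g x) K < r / 2^n" by auto
    have cont': "\<exists>d>0. \<forall>y\<in>S. dist y x < d \<longrightarrow> infdist ((A y - g y) - (A x - g x)) K < e"
      if xe: "x \<in> S" "0 < e" for x e
    proof -
      obtain d where d: "d > 0" "\<And>y. y \<in> S \<Longrightarrow> dist y x < d \<Longrightarrow> infdist (A y - A x) K < e/2"
        using cont[of x "e/2"] xe by auto
      obtain d' where d': "d' > 0" "\<And>y. y \<in> S \<Longrightarrow> dist y x < d' \<Longrightarrow> dist (g y) (g x) < e/2"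
        using g(1) xe unfolding continuous_on_iff by (meson half_gt_zero)
      show ?thesis
      proof (intro exI[of _ "min d d'"] conjI ballI impI)
        fix y assume y: "y \<in> S" "dist y x < min d d'"
        have "infdist ((A y - A x) - (g y - g x)) K \<le> infdist (A y - A x) K + infdist (g y - g x) K"
          by (rule infdist_subspace_diff[OF K(1)])
        also have "\<dots> \<le> infdist (A y - A x) K + norm (g y - g x)"
          using infdist_subspace_le_norm[OF K(1)] by simp
        also have "\<dots> < e" using d(2)[of y] d'(2)[of y] y by (simp add: dist_norm)
        finally show "infdist ((A y - g y) - (A x - g x)) K < e" by (simp add: algebra_simps)
      qed (use d d' in auto)
    qed
    obtain b where b: "continuous_on S b" "\<And>x. x \<in> S \<Longrightarrow> norm (b x) \<le> r / 2^n"
      "\<And>x. x \<in> S \<Longrightarrow> infdist (A x - g x - b x) K < r / 2^Suc n"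
      using selection_approx[OF K(1) S _ cont' g(2), of "r / 2^Suc n"] r by auto
    then show "\<exists>g'. (continuous_on S g' \<and> (\<forall>x\<in>S. infdist (A x - g' x) K < r / 2^Suc n)
       \<and> (Suc n = 0 \<longrightarrow> g' = (\<lambda>_. 0))) \<and> (\<forall>x\<in>S. norm (g' x - g x) \<le> r / 2^n)"
      by (intro exI[of _ "\<lambda>x. g x + b x"]) (auto intro!: continuous_intros g simp: diff_diff_eq)
  qed
  then obtain g where g: "\<And>n. continuous_on S (g n)" "\<And>n x. x \<in> S \<Longrightarrow> infdist (A x - g n x) K < r / 2^n"
    "g 0 = (\<lambda>_. 0)" "\<And>n x. x \<in> S \<Longrightarrow> norm (g (Suc n) x - g n x) \<le> r / 2^n" by blast
  define B where "B x = (\<Sum>i. g (Suc i) x - g i x)" for x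
  have "summable (\<lambda>n. r * (1/2)^n)" by (intro summable_mult summable_geometric) simp
  then have summ: "summable (\<lambda>n. r / 2^n)" by (simp add: power_divide)
  have "uniform_limit S (\<lambda>n x. \<Sum>i<n. g (Suc i) x - g i x) B sequentially"
    unfolding B_def by (rule Weierstrass_m_test[OF g(4) summ])
  moreover have "(\<Sum>i<n. g (Suc i) x - g i x) = g n x" for n x
    using sum_lessThan_telescope[of "\<lambda>i. g i x" n] g(3) by simp
  ultimately have lim: "uniform_limit S g B sequentially" by simp
  show thesis
  proof
    show "continuous_on S B"
      by (rule uniform_limit_theorem[OF always_eventually lim]) (use g(1) in auto)
    fix x assume x: "x \<in> S"
    have "(\<lambda>n. g n x) \<longlonglongrightarrow> B x" using lim x by (rule tendsto_uniform_limitI)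
    then have "(\<lambda>n. infdist (A x - g n x) K) \<longlonglongrightarrow> infdist (A x - B x) K"
      by (intro tendsto_infdist tendsto_intros)
    moreover have "(\<lambda>n. infdist (A x - g n x) K) \<longlonglongrightarrow> 0"
    proof (rule tendsto_sandwich[of "\<lambda>_. 0"])
      show "\<forall>\<^sub>F n in sequentially. infdist (A x - g n x) K \<le> r / 2^n"
        by (intro always_eventually allI less_imp_le g(2)[OF x])
    qed (use summable_LIMSEQ_zero[OF summ] in \<open>auto simp: infdist_nonneg intro!: always_eventually\<close>)
    ultimately have "infdist (A x - B x) K = 0" using LIMSEQ_unique by blast
    then show "A x - B x \<in> K" using infdist_subspace_zero_iff[OF K] by blast
  qed
qed

section \<open>Compact perturbations of the identity\<close>

text \<open>The topological half of membership in \<open>compact_ops\<close>, free of the scalar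
  field, so that the Riesz theory can be carried out over the reals.\<close>

definition compact_op :: "('a::real_normed_vector \<Rightarrow>\<^sub>L 'b::real_normed_vector) \<Rightarrow> bool" where
  "compact_op T \<longleftrightarrow> compact (closure (blinfun_apply T ` cball 0 1))"

lemma compact_opI: "compact C \<Longrightarrow> blinfun_apply T ` cball 0 1 \<subseteq> C \<Longrightarrow> compact_op T"
proof -
  assume C: "compact C" and sub: "blinfun_apply T ` cball 0 1 \<subseteq> C"
  have "closure (blinfun_apply T ` cball 0 1) \<subseteq> C"
    by (rule closure_minimal[OF sub compact_imp_closed[OF C]])
  then have "closure (blinfun_apply T ` cball 0 1) = C \<inter> closure (blinfun_apply T ` cball 0 1)" by blast
  then show "compact_op T"
    unfolding compact_op_def using compact_Int_closed[OF C closed_closure] by metis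
qed

lemma compact_op_image_cball:
  assumes "compact_op T"
  obtains C where "compact C" "blinfun_apply T ` cball 0 M \<subseteq> C"
proof -
  define N where "N = max 1 \<bar>M\<bar>"
  have N: "N > 0" "M \<le> N" by (auto simp: N_def)
  show thesis
  proof
    show "compact ((\<lambda>x. N *\<^sub>R x) ` closure (blinfun_apply T ` cball 0 1))"
      using assms by (intro compact_scaling) (simp add: compact_op_def)
    show "blinfun_apply T ` cball 0 M \<subseteq> (\<lambda>x. N *\<^sub>R x) ` closure (blinfun_apply T ` cball 0 1)"
    proof (clarsimp)
      fix x :: 'a assume x: "norm x \<le> M"
      have "T x = N *\<^sub>R T (x /\<^sub>R N)" using N by (simp add: blinfun.scaleR_right)
      moreover have "T (x /\<^sub>R N) \<in> closure (blinfun_apply T ` cball 0 1)"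
        using x N by (intro subsetD[OF closure_subset] imageI) (auto simp: field_simps)
      ultimately show "T x \<in> (\<lambda>x. N *\<^sub>R x) ` closure (blinfun_apply T ` cball 0 1)" by blast
    qed
  qed
qed

lemma compact_op_subsequence:
  assumes T: "compact_op T" and x: "\<And>n. norm (x n) \<le> M"
  obtains l r where "strict_mono (r :: nat \<Rightarrow> nat)" "(\<lambda>n. T (x (r n))) \<longlonglongrightarrow> l"
proof -
  obtain C where C: "compact C" "blinfun_apply T ` cball 0 M \<subseteq> C"
    by (rule compact_op_image_cball[OF T])
  have "\<forall>n. T (x n) \<in> C" using C x by auto
  then obtain l r where "strict_mono (r :: nat \<Rightarrow> nat)" "((\<lambda>n. T (x n)) \<circ> r) \<longlonglongrightarrow> l"
    using C(1) unfolding compact_def by metis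
  then show thesis using that by (simp add: o_def)
qed

lemma compact_op_compose_left: "compact_op T \<Longrightarrow> compact_op (A o\<^sub>L T)"
proof (erule compact_op_image_cball)
  fix C assume "compact C" "blinfun_apply T ` cball 0 1 \<subseteq> C"
  then show "compact_op (A o\<^sub>L T)"
    by (intro compact_opI[of "blinfun_apply A ` C"] compact_continuous_image continuous_intros) auto
qed

lemma compact_op_compose_right: "compact_op T \<Longrightarrow> compact_op (T o\<^sub>L A)"
proof (erule compact_op_image_cball)
  fix C assume C: "compact C" "blinfun_apply T ` cball 0 (norm A) \<subseteq> C"
  have "norm (A x) \<le> norm A" if "norm x \<le> 1" for x
    using norm_blinfun[of A x] mult_left_mono[OF that, of "norm A"] by simp
  then show "compact_op (T o\<^sub>L A)"
    using C by (intro compact_opI[of C]) (auto simp: image_subset_iff)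
qed

lemma compact_op_add:
  assumes "compact_op S" "compact_op T" shows "compact_op (S + T)"
proof -
  obtain C D where "compact C" "blinfun_apply S ` cball 0 1 \<subseteq> C"
    "compact D" "blinfun_apply T ` cball 0 1 \<subseteq> D"
    using assms by (metis compact_op_image_cball)
  then show ?thesis
    by (intro compact_opI[OF compact_sums[of C D]]) (force simp: blinfun.add_left image_subset_iff)+
qed

lemma compact_op_scaleR: "compact_op T \<Longrightarrow> compact_op (c *\<^sub>R T)"
proof (erule compact_op_image_cball)
  fix C assume "compact C" "blinfun_apply T ` cball 0 1 \<subseteq> C"
  then show "compact_op (c *\<^sub>R T)"
    by (intro compact_opI[OF compact_scaling[of C c]]) (auto simp: blinfun.scaleR_left)
qed

lemma compact_op_minus: "compact_op T \<Longrightarrow> compact_op (- T)"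
  using compact_op_scaleR[of T "-1"] by simp

lemma compact_op_diff: "compact_op S \<Longrightarrow> compact_op T \<Longrightarrow> compact_op (S - T)"
  using compact_op_add[of S "- T"] compact_op_minus[of T] by simp

lemma compact_op_zero: "compact_op 0"
  by (rule compact_opI[of "{0}"]) auto

text \<open>If \<open>F n\<close> is within \<open>e/3\<close> of \<open>T\<close>, the centres of a
  finite \<open>e/3\<close>-net for the image of the unit ball under \<open>F n\<close> also serve
  \<open>T\<close>. Completeness of the target turns total boundedness into compactness.\<close>

lemma closed_compact_op: "closed {T :: 'a::real_normed_vector \<Rightarrow>\<^sub>L 'b::banach. compact_op T}"
  unfolding closed_sequential_limits
proof (intro allI impI, elim conjE, simp)
  fix F :: "nat \<Rightarrow> 'a \<Rightarrow>\<^sub>L 'b" and T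
  assume F: "\<forall>n. compact_op (F n)" and lim: "F \<longlonglongrightarrow> T"
  let ?A = "closure (blinfun_apply T ` cball 0 1)"
  have "\<exists>k. finite k \<and> ?A \<subseteq> (\<Union>x\<in>k. ball x e)" if e: "e > 0" for e
  proof -
    obtain n where "dist (F n) T < e/3"
      using lim e unfolding lim_sequentially by (meson divide_pos_pos le_refl zero_less_numeral)
    then have n: "norm (F n - T) < e/3" by (simp add: dist_norm)
    have "compact (closure (blinfun_apply (F n) ` cball 0 1))"
      using F by (simp add: compact_op_def)
    then obtain k where k: "finite k"
      "closure (blinfun_apply (F n) ` cball 0 1) \<subseteq> (\<Union>x\<in>k. ball x (e/3))"
      unfolding compact_eq_totally_bounded using e by (metis divide_pos_pos zero_less_numeral)
    have "blinfun_apply T ` cball 0 1 \<subseteq> (\<Union>x\<in>k. cball x (2*e/3))"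
    proof clarsimp
      fix x :: 'a assume x: "norm x \<le> 1"
      then have "F n x \<in> closure (blinfun_apply (F n) ` cball 0 1)"
        by (intro subsetD[OF closure_subset]) auto
      then obtain y where y: "y \<in> k" "F n x \<in> ball y (e/3)" using k by blast
      have "norm ((F n - T) x) \<le> norm (F n - T) * norm x" by (rule norm_blinfun)
      also have "\<dots> \<le> norm (F n - T)" using x by (simp add: mult_left_le)
      finally have "dist (F n x) (T x) \<le> e/3" using n by (simp add: dist_norm blinfun.diff_left)
      then have "dist y (T x) \<le> 2*e/3"
        using dist_triangle[of y "T x" "F n x"] y by simp
      then show "\<exists>x'\<in>k. dist x' (T x) * 3 \<le> 2 * e" using y by (intro bexI[of _ y]) auto
    qed
    then have "?A \<subseteq> (\<Union>x\<in>k. cball x (2*e/3))"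
      using k by (intro closure_minimal closed_UN) auto
    also have "\<dots> \<subseteq> (\<Union>x\<in>k. ball x e)" using e by (intro UN_mono) auto
    finally show ?thesis using k by blast
  qed
  then show "compact_op T"
    unfolding compact_op_def compact_eq_totally_bounded by (simp add: complete_eq_closed)
qed

section \<open>Finite-dimensional subspaces of normed spaces\<close>

lemma closed_span_insert:
  fixes V :: "'a::real_normed_vector set"
  assumes V: "subspace V" "closed V" and b: "b \<notin> V"
  shows "0 < infdist b V" "\<And>c w. w \<in> V \<Longrightarrow> \<bar>c\<bar> * infdist b V \<le> norm (c *\<^sub>R b + w)"
proof -
  have ne: "V \<noteq> {}" using V subspace_0 by blast
  show pos: "0 < infdist b V"
    using b V ne infdist_nonneg[of b V] in_closed_iff_infdist_zero[OF V(2) ne, of b] by linarith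
  fix c :: real and w assume w: "w \<in> V"
  show "\<bar>c\<bar> * infdist b V \<le> norm (c *\<^sub>R b + w)"
  proof (cases "c = 0")
    case False
    have "infdist b V \<le> dist b ((- inverse c) *\<^sub>R w)"
      using w V by (intro infdist_le subspace_scale)
    then have "\<bar>c\<bar> * infdist b V \<le> \<bar>c\<bar> * norm (b + inverse c *\<^sub>R w)"
      by (intro mult_left_mono) (auto simp: dist_norm)
    also have "\<dots> = norm (c *\<^sub>R (b + inverse c *\<^sub>R w))" by simp
    also have "c *\<^sub>R (b + inverse c *\<^sub>R w) = c *\<^sub>R b + w"
      using False by (simp add: scaleR_add_right)
    finally show ?thesis .
  qed simp
qed

text \<open>One induction on \<open>B\<close> proves both claims. By
  \<open>closed_span_insert\<close> the coefficient of a vector \<open>b\<close> outside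
  \<open>span B\<close> is at most the norm divided by the distance of \<open>b\<close> to
  \<open>span B\<close>. Hence the coefficients of a convergent sequence are Cauchy, and a linear
  map can be bounded on each summand.\<close>

lemma
  fixes B :: "'a::real_normed_vector set"
  assumes "finite B"
  shows closed_span_finite: "closed (span B)"
    and bounded_on_span_finite: "\<And>f :: 'a \<Rightarrow> 'c::real_normed_vector.
      (\<And>x y. f (x + y) = f x + f y) \<Longrightarrow> (\<And>r x. f (r *\<^sub>R x) = r *\<^sub>R f x) \<Longrightarrow>
      \<exists>C. \<forall>v\<in>span B. norm (f v) \<le> C * norm v"
proof -
  have "closed (span B) \<and> (\<forall>f :: 'a \<Rightarrow> 'c. (\<forall>x y. f (x + y) = f x + f y) \<longrightarrow>
      (\<forall>r x. f (r *\<^sub>R x) = r *\<^sub>R f x) \<longrightarrow> (\<exists>C. \<forall>v\<in>span B. norm (f v) \<le> C * norm v))"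
    using assms
  proof (induction B rule: finite_induct)
    case empty
    have "f 0 = 0" if "\<forall>r x. f (r *\<^sub>R x) = r *\<^sub>R f x" for f :: "'a \<Rightarrow> 'c"
      using that by (metis scaleR_zero_left)
    then show ?case by auto
  next
    case (insert b B)
    show ?case
    proof (cases "b \<in> span B")
      case True
      then show ?thesis using insert by (simp add: span_redundant)
    next
      case False
      define d where "d = infdist b (span B)"
      have d: "0 < d" "\<And>c w. w \<in> span B \<Longrightarrow> \<bar>c\<bar> * d \<le> norm (c *\<^sub>R b + w)"
        unfolding d_def using closed_span_insert[OF _ _ False] insert.IH by auto
      have dec: "\<exists>c w. v = c *\<^sub>R b + w \<and> w \<in> span B" if "v \<in> span (insert b B)" for v
      proof -
        from that obtain k where "v - k *\<^sub>R b \<in> span B" unfolding span_insert by blast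
        then show ?thesis by (intro exI[of _ k] exI[of _ "v - k *\<^sub>R b"]) simp
      qed
      show ?thesis
      proof (intro conjI allI impI)
        fix f :: "'a \<Rightarrow> 'c"
        assume f: "\<forall>x y. f (x + y) = f x + f y" "\<forall>r x. f (r *\<^sub>R x) = r *\<^sub>R f x"
        from insert.IH[THEN conjunct2, rule_format, OF f[rule_format]]
        obtain C where C: "\<And>v. v \<in> span B \<Longrightarrow> norm (f v) \<le> C * norm v" by auto
        define D where "D = max 0 C"
        have D: "norm (f v) \<le> D * norm v" if "v \<in> span B" for v
          using C[OF that] mult_right_mono[of C D "norm v"] by (simp add: D_def)
        show "\<exists>C. \<forall>v\<in>span (insert b B). norm (f v) \<le> C * norm v"
        proof (intro exI ballI)
          fix v assume "v \<in> span (insert b B)"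
          from dec[OF this] obtain c w where v: "v = c *\<^sub>R b + w" "w \<in> span B" by (elim exE conjE)
          have c: "\<bar>c\<bar> \<le> norm v / d" using d(2)[OF v(2), of c] d(1) v(1) by (simp add: field_simps)
          have "norm w \<le> norm v + \<bar>c\<bar> * norm b"
            using norm_triangle_ineq4[of v "c *\<^sub>R b"] v(1) by simp
          then have w: "norm w \<le> norm v + norm v / d * norm b"
            using mult_right_mono[OF c, of "norm b"] by simp
          have "norm (f v) \<le> \<bar>c\<bar> * norm (f b) + norm (f w)"
            using f v(1) norm_triangle_ineq[of "c *\<^sub>R f b" "f w"] by simp
          also have "\<dots> \<le> norm v / d * norm (f b) + D * (norm v + norm v / d * norm b)"
            using c w D[OF v(2)]
            by (intro add_mono mult_right_mono order.trans[OF D[OF v(2)]] mult_left_mono)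
               (auto simp: D_def)
          also have "\<dots> = (norm (f b) / d + D * (1 + norm b / d)) * norm v"
            by (simp add: algebra_simps)
          finally show "norm (f v) \<le> (norm (f b) / d + D * (1 + norm b / d)) * norm v" .
        qed
      next
        show "closed (span (insert b B))"
          unfolding closed_sequential_limits
        proof (intro allI impI, elim conjE)
          fix v l assume v: "\<forall>n. v n \<in> span (insert b B)" and l: "v \<longlonglongrightarrow> l"
          have "\<forall>n. \<exists>c w. v n = c *\<^sub>R b + w \<and> w \<in> span B" using v dec by (intro allI) simp
          then obtain c w where cw: "\<And>n. v n = c n *\<^sub>R b + w n" "\<And>n. w n \<in> span B" by metis
          have "Cauchy c"
          proof (rule CauchyI)
            fix e :: real assume e: "0 < e"
            have "0 < e * d" using e d by simp
            from CauchyD[OF LIMSEQ_imp_Cauchy[OF l] this]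
            obtain M where M: "\<And>m n. m \<ge> M \<Longrightarrow> n \<ge> M \<Longrightarrow> norm (v m - v n) < e * d" by blast
            have "norm (c m - c n) < e" if "m \<ge> M" "n \<ge> M" for m n
            proof -
              have "\<bar>c m - c n\<bar> * d \<le> norm ((c m - c n) *\<^sub>R b + (w m - w n))"
                using cw(2) by (intro d(2) span_diff)
              also have "(c m - c n) *\<^sub>R b + (w m - w n) = v m - v n"
                by (simp add: cw(1) algebra_simps)
              also have "norm \<dots> < e * d" using M that by blast
              finally show ?thesis using d by simp
            qed
            then show "\<exists>M. \<forall>m\<ge>M. \<forall>n\<ge>M. norm (c m - c n) < e" by blast
          qed
          then obtain a where a: "c \<longlonglongrightarrow> a" using real_Cauchy_convergent convergent_def by blast
          have "(\<lambda>n. v n - c n *\<^sub>R b) \<longlonglongrightarrow> l - a *\<^sub>R b" by (intro tendsto_intros l a)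
          then have "w \<longlonglongrightarrow> l - a *\<^sub>R b" by (simp add: cw(1))
          then have "l - a *\<^sub>R b \<in> span B"
            using closed_sequentially[OF insert.IH[THEN conjunct1] cw(2)] by simp
          then show "l \<in> span (insert b B)" unfolding span_insert by blast
        qed
      qed
    qed
  qed
  note * = this
  show "closed (span B)" using * by (rule conjunct1)
  fix f :: "'a \<Rightarrow> 'c"
  assume "\<And>x y. f (x + y) = f x + f y" "\<And>r x. f (r *\<^sub>R x) = r *\<^sub>R f x"
  then show "\<exists>C. \<forall>v\<in>span B. norm (f v) \<le> C * norm v"
    using *[THEN conjunct2, rule_format, of f] by blast
qed

text \<open>Take \<open>m\<close> in \<open>M\<close> less than twice as far from \<open>x\<close>
  as the infimum and normalise \<open>x - m\<close>; this factor 2 is the origin of the bound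
  1/2.\<close>

lemma riesz_lemma:
  fixes M V :: "'a::real_normed_vector set"
  assumes M: "subspace M" "closed M" and V: "subspace V" and sub: "M \<subset> V"
  obtains y where "y \<in> V" "norm y = 1" "\<And>z. z \<in> M \<Longrightarrow> 1/2 \<le> dist y z"
proof -
  obtain x where x: "x \<in> V" "x \<notin> M" using sub by blast
  define d where "d = infdist x M"
  have ne: "M \<noteq> {}" using M subspace_0 by blast
  have d: "0 < d" unfolding d_def by (rule closed_span_insert[OF M x(2)])
  then have "infdist x M < 2 * d" by (simp add: d_def)
  then obtain m where m: "m \<in> M" "dist x m < 2 * d"
    using ne by (auto simp: infdist_def cINF_less_iff)
  define n where "n = norm (x - m)"
  have n: "0 < n" "n < 2 * d" using m x by (auto simp: n_def dist_norm)
  define y where "y = (x - m) /\<^sub>R n"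
  show thesis
  proof
    show "y \<in> V" using x m sub V by (auto simp: y_def intro!: subspace_scale subspace_diff)
    show "norm y = 1" using n by (simp add: y_def n_def)
    fix z assume z: "z \<in> M"
    have "d \<le> dist x (m + n *\<^sub>R z)"
      unfolding d_def using m z M by (intro infdist_le subspace_add subspace_scale)
    also have "\<dots> = norm (n *\<^sub>R (y - z))"
      using n by (simp add: y_def dist_norm scaleR_diff_right scaleR_add_right diff_diff_eq)
    also have "\<dots> = n * dist y z" using n by (simp add: dist_norm)
    also have "\<dots> \<le> (2 * d) * dist y z" using n by (intro mult_right_mono) auto
    finally have "d * 1 \<le> d * (2 * dist y z)" by simp
    then show "1/2 \<le> dist y z" using d by (simp only: mult_le_cancel_left_pos)
  qed
qed

lemma compact_op_not_separated:
  fixes x :: "nat \<Rightarrow> 'a::real_normed_vector"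
  assumes K: "compact_op K" and x: "\<And>n. norm (x n) \<le> 1"
    and sep: "\<And>m n. m < n \<Longrightarrow> 1/2 \<le> dist (K (x m)) (K (x n))"
  shows False
proof -
  obtain l r where r: "strict_mono (r :: nat \<Rightarrow> nat)" and l: "(\<lambda>n. K (x (r n))) \<longlonglongrightarrow> l"
    by (rule compact_op_subsequence[OF K x])
  obtain M where M: "\<And>m n. m \<ge> M \<Longrightarrow> n \<ge> M \<Longrightarrow> dist (K (x (r m))) (K (x (r n))) < 1/2"
    using metric_CauchyD[OF LIMSEQ_imp_Cauchy[OF l], of "1/2"] by auto
  show False
    using M[of M "Suc M"] sep[of "r M" "r (Suc M)"] strict_monoD[OF r, of M "Suc M"] by simp
qed

section \<open>Riesz theory of the identity minus a compact operator\<close>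

context
  fixes K :: "'a::banach \<Rightarrow>\<^sub>L 'a" and S :: "'a \<Rightarrow> 'a"
  assumes K: "compact_op K"
  defines "S \<equiv> \<lambda>x. x - K x"
begin

lemma S_linear:
  "S (x + y) = S x + S y" "S (x - y) = S x - S y" "S (c *\<^sub>R x) = c *\<^sub>R S x" "S 0 = 0"
  by (simp_all add: S_def blinfun.add_right blinfun.diff_right blinfun.scaleR_right scaleR_diff_right)

text \<open>Choose unit vectors \<open>y n\<close> in \<open>M (Suc n)\<close> at distance at least
  1/2 from \<open>M n\<close>. For \<open>m < n\<close> the difference
  \<open>K (y n) - K (y m)\<close> is \<open>y n\<close> minus an element of \<open>M n\<close>, so
  the images stay 1/2 apart, against compactness.\<close>

lemma ascending_chain_stops:
  assumes M: "\<And>n. subspace (M n)" "\<And>n. closed (M n)" and inc: "\<And>n. M n \<subset> M (Suc n)"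
    and SM: "\<And>n x. x \<in> M (Suc n) \<Longrightarrow> S x \<in> M n"
  shows False
proof -
  have "\<forall>n. \<exists>y. y \<in> M (Suc n) \<and> norm y = 1 \<and> (\<forall>z\<in>M n. 1/2 \<le> dist y z)"
  proof
    fix n
    from riesz_lemma[OF M(1) M(2) M(1) inc[of n]]
    obtain y where "y \<in> M (Suc n)" "norm y = 1" "\<And>z. z \<in> M n \<Longrightarrow> 1/2 \<le> dist y z" by blast
    then show "\<exists>y. y \<in> M (Suc n) \<and> norm y = 1 \<and> (\<forall>z\<in>M n. 1/2 \<le> dist y z)" by blast
  qed
  then obtain y where y: "\<And>n. y n \<in> M (Suc n)" "\<And>n. norm (y n) = 1"
    "\<And>n z. z \<in> M n \<Longrightarrow> 1/2 \<le> dist (y n) z" by metis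
  have mono: "M m \<subseteq> M n" if "m \<le> n" for m n
    by (rule lift_Suc_mono_le[where f = M, OF psubset_imp_subset[OF inc] that])
  show False
  proof (rule compact_op_not_separated[OF K, of y])
    fix m n :: nat assume mn: "m < n"
    have "y m \<in> M n" "S (y m) \<in> M n" "S (y n) \<in> M n"
      using y(1) SM mono[of "Suc m" n] mono[of m n] mn by (auto simp: less_imp_le Suc_le_eq)
    then have "y m - S (y m) + S (y n) \<in> M n" using M(1) by (auto intro: subspace_add subspace_diff)
    from y(3)[OF this] show "1/2 \<le> dist (K (y m)) (K (y n))"
      by (simp add: S_def dist_norm norm_minus_commute algebra_simps)
  qed (simp add: y(2))
qed

text \<open>Mirror image of the ascending case: for \<open>m < n\<close>,
  \<open>K (y m) - K (y n)\<close> is \<open>y m\<close> minus an element of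
  \<open>M (Suc m)\<close>.\<close>

lemma descending_chain_stops:
  assumes M: "\<And>n. subspace (M n)" "\<And>n. closed (M n)" and dec: "\<And>n. M (Suc n) \<subset> M n"
    and SM: "\<And>n x. x \<in> M n \<Longrightarrow> S x \<in> M (Suc n)"
  shows False
proof -
  have "\<forall>n. \<exists>y. y \<in> M n \<and> norm y = 1 \<and> (\<forall>z\<in>M (Suc n). 1/2 \<le> dist y z)"
  proof
    fix n
    from riesz_lemma[OF M(1) M(2) M(1) dec[of n]]
    obtain y where "y \<in> M n" "norm y = 1" "\<And>z. z \<in> M (Suc n) \<Longrightarrow> 1/2 \<le> dist y z" by blast
    then show "\<exists>y. y \<in> M n \<and> norm y = 1 \<and> (\<forall>z\<in>M (Suc n). 1/2 \<le> dist y z)" by blast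
  qed
  then obtain y where y: "\<And>n. y n \<in> M n" "\<And>n. norm (y n) = 1"
    "\<And>n z. z \<in> M (Suc n) \<Longrightarrow> 1/2 \<le> dist (y n) z" by metis
  have mono: "M n \<subseteq> M m" if "m \<le> n" for m n
    by (rule lift_Suc_antimono_le[where f = M, OF psubset_imp_subset[OF dec] that])
  show False
  proof (rule compact_op_not_separated[OF K, of y])
    fix m n :: nat assume mn: "m < n"
    have "S (y m) \<in> M (Suc m)" "y n \<in> M (Suc m)" "S (y n) \<in> M (Suc m)"
      using y(1) SM mono[of "Suc m" n] mono[of "Suc m" "Suc n"] mn by (auto simp: less_imp_le Suc_le_eq)
    then have "S (y m) + y n - S (y n) \<in> M (Suc m)" using M(1) by (auto intro: subspace_add subspace_diff)
    from y(3)[OF this] show "1/2 \<le> dist (K (y m)) (K (y n))"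
      by (simp add: S_def dist_norm norm_minus_commute algebra_simps)
  qed (simp add: y(2))
qed

text \<open>Otherwise, adjoining one independent kernel vector at a time gives a strictly increasing
  chain of closed spans on which \<open>S\<close> vanishes, which
  \<open>ascending_chain_stops\<close> forbids.\<close>

lemma kernel_finite_span:
  obtains B where "finite B" "{x. S x = 0} = span B"
proof (rule ccontr)
  let ?N = "{x. S x = 0}"
  assume "\<not> thesis"
  with that have no: "?N \<noteq> span B" if "finite B" for B using that by blast
  have N: "subspace ?N" by (auto simp: subspace_def S_linear)
  have "\<exists>b. b \<in> ?N \<and> b \<notin> span B" if "finite B" "B \<subseteq> ?N" for B
    using no[OF that(1)] span_minimal[OF that(2) N] by blast
  then obtain pick where pick: "\<And>B. finite B \<Longrightarrow> B \<subseteq> ?N \<Longrightarrow> pick B \<in> ?N \<and> pick B \<notin> span B"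
    by metis
  define F where "F = rec_nat {} (\<lambda>_ B. insert (pick B) B)"
  have F: "F 0 = {}" "\<And>n. F (Suc n) = insert (pick (F n)) (F n)" by (auto simp: F_def)
  have fin: "finite (F n) \<and> F n \<subseteq> ?N" for n
    using pick by (induction n) (auto simp: F)
  show False
  proof (rule ascending_chain_stops[of "\<lambda>n. span (F n)"])
    show "subspace (span (F n))" "closed (span (F n))" for n
      using closed_span_finite[of "F n"] fin[of n] by auto
    show "span (F n) \<subset> span (F (Suc n))" for n
      using span_mono[of "F n" "F (Suc n)"] span_base[of "pick (F n)" "F (Suc n)"]
        pick[OF fin[THEN conjunct1] fin[THEN conjunct2], of n]
      by (auto simp: F)
    fix n x assume "x \<in> span (F (Suc n))"
    then have "x \<in> ?N" using fin[of "Suc n"] span_minimal[OF _ N] by blast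
    then show "S x \<in> span (F n)" by (simp add: span_zero)
  qed
qed

text \<open>In \<open>x n = S (x n) + K (x n)\<close> the first summand converges by assumption and
  the second along a subsequence.\<close>

lemma convergent_subsequence:
  fixes x :: "nat \<Rightarrow> 'a"
  assumes x: "\<And>n. norm (x n) \<le> M" and Sx: "(\<lambda>n. S (x n)) \<longlonglongrightarrow> y"
  obtains l r where "strict_mono (r :: nat \<Rightarrow> nat)" "(\<lambda>n. x (r n)) \<longlonglongrightarrow> l" "S l = y"
proof -
  obtain k r where r: "strict_mono (r :: nat \<Rightarrow> nat)" and k: "(\<lambda>n. K (x (r n))) \<longlonglongrightarrow> k"
    by (rule compact_op_subsequence[OF K x])
  have Sr: "(\<lambda>n. S (x (r n))) \<longlonglongrightarrow> y" using LIMSEQ_subseq_LIMSEQ[OF Sx r] by (simp add: o_def)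
  have "(\<lambda>n. S (x (r n)) + K (x (r n))) \<longlonglongrightarrow> y + k" by (intro tendsto_add Sr k)
  then have xr: "(\<lambda>n. x (r n)) \<longlonglongrightarrow> y + k" by (simp add: S_def)
  have "(\<lambda>n. S (x (r n))) \<longlonglongrightarrow> S (y + k)"
    unfolding S_def by (intro tendsto_intros xr)
  then have "S (y + k) = y" using Sr LIMSEQ_unique by blast
  then show thesis using that r xr by blast
qed

text \<open>Without a lower bound there are unit vectors of \<open>V\<close> whose images tend to
  zero; a subsequence converges to a unit vector of \<open>V\<close> in the kernel.\<close>

lemma bounded_below_on:
  assumes V: "subspace V" "closed V" and inj: "\<And>x. x \<in> V \<Longrightarrow> S x = 0 \<Longrightarrow> x = 0"
  obtains c where "0 < c" "\<And>x. x \<in> V \<Longrightarrow> c * norm x \<le> norm (S x)"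
proof (rule ccontr)
  assume "\<not> thesis"
  then have "\<forall>n. \<exists>x\<in>V. norm (S x) < inverse (real (Suc n)) * norm x"
    using that by (meson inverse_positive_iff_positive not_le of_nat_0_less_iff zero_less_Suc)
  then obtain x where x: "\<And>n. x n \<in> V" "\<And>n. norm (S (x n)) < inverse (real (Suc n)) * norm (x n)"
    by metis
  have x0: "0 < norm (x n)" for n using x(2)[of n] S_linear(4) by (cases "x n = 0") auto
  define u where "u n = x n /\<^sub>R norm (x n)" for n
  have u: "norm (u n) = 1" "u n \<in> V" for n
    using x0[of n] x(1)[of n] V by (auto simp: u_def subspace_scale)
  have Su: "norm (S (u n)) \<le> inverse (real (Suc n))" for n
    using x(2)[of n] x0[of n] by (simp add: u_def S_linear divide_simps)
  have "(\<lambda>n. S (u n)) \<longlonglongrightarrow> 0"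
    by (rule Lim_null_comparison[OF _ LIMSEQ_inverse_real_of_nat]) (rule always_eventually, rule allI, rule Su)
  then obtain l r where r: "(\<lambda>n. u (r n)) \<longlonglongrightarrow> l" "S l = 0"
    using convergent_subsequence[of u 1 0] u(1) by (metis order_refl)
  have "l \<in> V" using closed_sequentially[OF V(2) _ r(1)] u(2) by blast
  then have "l = 0" using inj r(2) by blast
  moreover have "norm l = 1"
    using tendsto_norm[OF r(1)] u(1) by (simp add: LIMSEQ_const_iff)
  ultimately show False by simp
qed

text \<open>Division by the distance to the kernel replaces the choice of a closed complement, whose
  existence would require the Hahn--Banach theorem.\<close>

lemma closed_range: "closed (range S)"
proof -
  let ?N = "{x. S x = 0}"
  have N: "subspace ?N" by (auto simp: subspace_def S_linear)
  have ne: "?N \<noteq> {}" using S_linear(4) by blast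
  have "\<exists>C. \<forall>x. infdist x ?N \<le> C * norm (S x)"
  proof (rule ccontr)
    assume "\<not> ?thesis"
    then have "\<forall>n. \<exists>x. real (Suc n) * norm (S x) < infdist x ?N" by (meson not_le)
    then obtain x where x: "\<And>n. real (Suc n) * norm (S (x n)) < infdist (x n) ?N" by metis
    define d where "d n = infdist (x n) ?N" for n
    have d: "0 < d n" for n
      unfolding d_def by (rule le_less_trans[OF _ x[of n]]) simp
    have near: "\<exists>z\<in>?N. dist (x n) z < 2 * d n" for n
      using d[of n] ne by (rule_tac infdist_lessE[of "x n" ?N "2 * d n"]) (simp add: d_def, assumption, blast)
    obtain z where z: "\<And>n. z n \<in> ?N" "\<And>n. dist (x n) (z n) < 2 * d n"
      using near by metis
    \<comment> \<open>Rescaled by the distance to the kernel, \<open>u n\<close> has norm at most 2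
      and distance at least 1 from each kernel vector, while \<open>S (u n)\<close> tends to zero.
      The limit of a subsequence would itself be a kernel vector.\<close>
    define u where "u n = (x n - z n) /\<^sub>R d n" for n
    have u: "norm (u n) \<le> 2" for n
      using z(2)[of n] d[of n] by (simp add: u_def dist_norm divide_simps)
    have Su: "norm (S (u n)) \<le> inverse (real (Suc n))" for n
      using x[of n] d[of n] z(1)[of n]
      by (simp add: u_def S_linear d_def field_simps del: of_nat_Suc)
    have "(\<lambda>n. S (u n)) \<longlonglongrightarrow> 0"
      by (rule Lim_null_comparison[OF _ LIMSEQ_inverse_real_of_nat]) (rule always_eventually, rule allI, rule Su)
    then obtain l r where r: "(\<lambda>n. u (r n)) \<longlonglongrightarrow> l" "S l = 0"
      using convergent_subsequence[of u 2 0] u by metis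
    have "1 \<le> dist (u n) l" for n
    proof -
      have "d n \<le> dist (x n) (z n + d n *\<^sub>R l)"
        unfolding d_def using z r(2) by (intro infdist_le) (auto simp: S_linear)
      also have "\<dots> = norm (d n *\<^sub>R (u n - l))"
        using d[of n] by (simp add: u_def dist_norm scaleR_diff_right scaleR_add_right diff_diff_eq)
      finally show ?thesis using d[of n] by (simp add: dist_norm)
    qed
    then have "1 \<le> (0::real)"
      using r(1)[THEN tendsto_dist_iff[THEN iffD1]] by (intro LIMSEQ_le_const[of "\<lambda>n. dist (u (r n)) l" 0 1]) auto
    then show False by simp
  qed
  then obtain C where C: "\<And>x. infdist x ?N \<le> C * norm (S x)" by blast
  show ?thesis
    unfolding closed_sequential_limits
  proof (intro allI impI, elim conjE)
    fix y l assume "\<forall>n. y n \<in> range S" and l: "y \<longlonglongrightarrow> l"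
    then have "\<forall>n. \<exists>x. y n = S x" by auto
    then obtain x where x: "\<And>n. y n = S (x n)" by metis
    \<comment> \<open>The preimages \<open>x n\<close> may be unbounded; subtracting a nearly
      closest kernel vector bounds them through the estimate with \<open>C\<close>.\<close>
    have near: "\<exists>z\<in>?N. dist (x n) z < infdist (x n) ?N + 1" for n
      using ne by (rule_tac infdist_lessE[of "x n" ?N "infdist (x n) ?N + 1"]) (simp, assumption, blast)
    obtain z where z: "\<And>n. z n \<in> ?N" "\<And>n. dist (x n) (z n) < infdist (x n) ?N + 1"
      using near by metis
    obtain D where D: "\<And>n. norm (y n) \<le> D"
      using convergent_imp_Bseq[of y] l unfolding convergent_def Bseq_def by blast
    have w: "norm (x n - z n) \<le> \<bar>C\<bar> * D + 1" for n
    proof -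
      have "norm (x n - z n) \<le> C * norm (y n) + 1"
        using z(2)[of n] C[of "x n"] x by (simp add: dist_norm)
      also have "C * norm (y n) \<le> \<bar>C\<bar> * D"
        using D[of n] by (intro mult_mono) auto
      finally show ?thesis by simp
    qed
    have "S (x n - z n) = y n" for n using z(1) x by (simp add: S_linear)
    then obtain l' where "S l' = l"
      using convergent_subsequence[where x = "\<lambda>n. x n - z n" and y = l, OF w] l by auto
    then show "l \<in> range S" by blast
  qed
qed

lemma closed_kernel: "closed {x. S x = 0}"
  unfolding S_def by (intro closed_Collect_eq continuous_intros)

text \<open>Every power of \<open>S\<close> is again the identity minus a compact operator, so the
  results on kernels and ranges apply to all powers.\<close>

lemma power_compact: "\<exists>K'. compact_op K' \<and> (\<forall>x. (S ^^ n) x = x - blinfun_apply K' x)"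
proof (induction n)
  case 0 show ?case by (intro exI[of _ 0]) (simp add: compact_op_zero)
next
  case (Suc n)
  then obtain K' where K': "compact_op K'" "\<And>x. (S ^^ n) x = x - K' x" by blast
  show ?case
  proof (intro exI conjI allI)
    show "compact_op (K' + K - (K o\<^sub>L K'))"
      by (intro compact_op_diff compact_op_add K K' compact_op_compose_right)
    fix x
    have "(S ^^ Suc n) x = S (x - K' x)" by (simp add: K')
    also have "\<dots> = x - (K' + K - (K o\<^sub>L K')) x"
      by (simp add: S_def blinfun.diff_right blinfun.diff_left blinfun.add_left)
    finally show "(S ^^ Suc n) x = x - (K' + K - (K o\<^sub>L K')) x" .
  qed
qed

end

text \<open>The lower bound bounds the set-theoretic inverse directly, with constant
  \<open>1 / c\<close>.\<close>

lemma bounded_inverse: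
  fixes G :: "'a::real_normed_vector \<Rightarrow>\<^sub>L 'b::real_normed_vector"
  assumes c: "0 < c" "\<And>x. c * norm x \<le> norm (G x)" and surj: "surj (blinfun_apply G)"
  obtains G' where "\<And>x. blinfun_apply G' (G x) = x" "\<And>y. G (blinfun_apply G' y) = y"
proof -
  define g where "g = inv_into UNIV (blinfun_apply G)"
  have Gg: "G (g y) = y" for y unfolding g_def by (rule surj_f_inv_f[OF surj])
  have eq: "x = x'" if "G x = G x'" for x x'
    using c(1) c(2)[of "x - x'"] that by (simp add: blinfun.diff_right mult_le_0_iff)
  have gG: "g (G x) = x" for x by (rule eq) (rule Gg)
  have "bounded_linear g"
  proof (rule bounded_linear_intro)
    show "g (x + y) = g x + g y" for x y by (rule eq) (simp add: Gg blinfun.add_right)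
    show "g (r *\<^sub>R x) = r *\<^sub>R g x" for r x by (rule eq) (simp add: Gg blinfun.scaleR_right)
    show "norm (g x) \<le> norm x * (1 / c)" for x
      using c(2)[of "g x"] c(1) by (simp add: Gg field_simps)
  qed
  then show thesis using that[of "Blinfun g"] Gg gG by (simp add: bounded_linear_Blinfun_apply)
qed

text \<open>\<open>p\<close> projects onto the kernel of a high power of \<open>S\<close> along its
  range. \<open>G\<close> keeps \<open>S\<close> on that range, where it is bijective, and is the
  identity on that kernel, so \<open>S\<close> differs from an invertible operator by a map
  factoring through \<open>p\<close>. The commutation clause asks only for additivity of
  \<open>f\<close>, so that it covers scalar multiplications.\<close>

theorem riesz_decomposition:
  fixes K :: "'a::banach \<Rightarrow>\<^sub>L 'a"
  assumes K: "compact_op K"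
  defines "S \<equiv> \<lambda>x. x - K x"
  obtains p G G' :: "'a \<Rightarrow>\<^sub>L 'a" and B where
    "finite B" "range (blinfun_apply p) = span B" "\<And>x. p (p x) = p x" "compact_op p"
    "\<And>x. S x = 0 \<Longrightarrow> p x = x"
    "\<And>f x. \<lbrakk>\<And>x. S (f x) = f (S x); \<And>x y. f (x - y) = f x - f y\<rbrakk> \<Longrightarrow> p (f x) = f (p x)"
    "\<And>x. G x = S (x - p x) + p x" "\<And>x. G' (G x) = x" "\<And>x. G (G' x) = x"
proof -
  have SK: "S x = x - K x" for x by (simp add: S_def)
  note SL = S_linear[OF K, folded SK]
  obtain C where C: "\<And>n. compact_op (C n)" "\<And>n x. (S ^^ n) x = x - blinfun_apply (C n) x"
    using power_compact[OF K, folded S_def] by metis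
  have powS: "(S ^^ n) (S x) = S ((S ^^ n) x)" for n x
    by (rule funpow_swap1[symmetric])
  define N where "N n = {x. (S ^^ n) x = 0}" for n
  define R where "R n = range (S ^^ n)" for n
  have N_alt: "N n = {x. x - C n x = 0}" and R_alt: "R n = range (\<lambda>x. x - C n x)" for n
    by (auto simp: N_def R_def C(2))
  have subN: "subspace (N n)" "closed (N n)" for n
  proof -
    show "subspace (N n)"
      unfolding N_alt by (auto simp: subspace_def blinfun.add_right blinfun.scaleR_right)
    show "closed (N n)" unfolding N_alt by (rule closed_kernel[OF C(1)])
  qed
  have clR: "closed (R n)" for n
    unfolding R_alt by (rule closed_range[OF C(1)])
  have "linear (\<lambda>x. x - C n x)" for n
    by (intro linearI S_linear(1,3)[OF C(1)])
  then have subR: "subspace (R n)" for n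
    unfolding R_alt by (rule linear_subspace_image[OF _ subspace_UNIV])
  have N_Suc: "x \<in> N (Suc n) \<longleftrightarrow> S x \<in> N n" for n x by (simp add: N_def powS)
  have N_mono: "N n \<subseteq> N (Suc n)" for n by (auto simp: N_def SL)
  have R_Suc: "R (Suc n) = S ` R n" for n by (auto simp: R_def image_comp)
  have R_SucI: "S x \<in> R n" if "x \<in> R n" for n x using that by (auto simp: R_def simp flip: powS)
  have R_mono: "R (Suc n) \<subseteq> R n" for n using R_SucI by (auto simp: R_Suc)
  have "\<exists>n. N (Suc n) = N n"
  proof (rule ccontr)
    assume "\<not> ?thesis"
    then have "N n \<subset> N (Suc n)" for n using N_mono[of n] by blast
    from ascending_chain_stops[OF K, where M = N, folded SK, OF subN this] show False by (simp add: N_Suc)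
  qed
  then obtain a where a: "N (Suc a) = N a" by blast
  have N_stable: "N (a + m) = N a" for m
  proof (induction m)
    case (Suc m)
    have "x \<in> N (a + Suc m) \<longleftrightarrow> x \<in> N (Suc a)" for x using Suc by (simp add: N_Suc)
    then show ?case using a by blast
  qed simp
  have "\<exists>n. R (Suc n) = R n"
  proof (rule ccontr)
    assume "\<not> ?thesis"
    then have "R (Suc n) \<subset> R n" for n using R_mono[of n] by blast
    from descending_chain_stops[OF K, where M = R, folded SK, OF subR clR this] show False by (auto simp: R_Suc)
  qed
  then obtain b where b: "R (Suc b) = R b" by blast
  have R_stable: "R (b + m) = R b" for m
    by (induction m) (simp_all add: R_Suc b[unfolded R_Suc])
  \<comment> \<open>The kernels are constant from \<open>a\<close> on and the ranges from
    \<open>b\<close> on; the sum serves both.\<close>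
  define q where "q = a + b"
  define T where "T = S ^^ q"
  have TC: "T x = x - C q x" for x by (simp add: T_def C(2))
  note TL = S_linear[OF C(1)[of q], folded TC]
  have TT: "T (T x) = (S ^^ (q + q)) x" for x by (simp add: T_def funpow_add)
  have kerT: "T x = 0" if "T (T x) = 0" for x
  proof -
    have "x \<in> N (q + q)" using that by (simp add: TT N_def)
    also have "N (q + q) = N q" using N_stable[of b] N_stable[of "b + q"] by (simp add: q_def ac_simps)
    finally show ?thesis by (simp add: N_def T_def)
  qed
  have ranT: "\<exists>y. T x = T (T y)" for x
  proof -
    have "T x \<in> R q" by (auto simp: R_def T_def)
    also have "R q = R (q + q)" using R_stable[of a] R_stable[of "a + q"] by (simp add: q_def ac_simps)
    finally show ?thesis by (auto simp: R_def TT)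
  qed
  have kerS: "T x = 0" if "S x = 0" for x
  proof -
    have "x \<in> N (Suc q)" using that subspace_0[OF subN(1)] by (simp add: N_Suc)
    also have "N (Suc q) = N q" using N_stable[of b] N_stable[of "Suc b"] by (simp add: q_def)
    finally show ?thesis by (simp add: N_def T_def)
  qed
  have ST: "S (T x) = T (S x)" for x by (simp add: T_def powS)
  have SR: "\<exists>y. T x = S (T y)" for x
  proof -
    have "T x \<in> R q" by (auto simp: R_def T_def)
    also have "R q = R (Suc q)" using R_stable[of a] R_stable[of "Suc a"] by (simp add: q_def ac_simps)
    finally show ?thesis by (auto simp: R_Suc) (auto simp: R_def T_def)
  qed
  \<comment> \<open>\<open>T\<close> is injective on its range because \<open>T\<close> and its
    square have the same kernel.\<close>
  have uniq: "r = r'" if "r \<in> range T" "r' \<in> range T" "T r = T r'" for r r'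
  proof -
    obtain z z' where "r = T z" "r' = T z'" using \<open>r \<in> range T\<close> \<open>r' \<in> range T\<close> by blast
    then have "T (T (z - z')) = 0" using \<open>T r = T r'\<close> by (simp add: TL)
    then have "T (z - z') = 0" by (rule kerT)
    then show ?thesis using \<open>r = T z\<close> \<open>r' = T z'\<close> by (simp add: TL)
  qed
  \<comment> \<open>\<open>r x\<close> will be the component of \<open>x\<close> in
    \<open>range T\<close>: since \<open>T\<close> and its square have the same range,
    \<open>T x\<close> has a preimage there, and it is unique by \<open>uniq\<close>.\<close>
  have "\<exists>r. r \<in> range T \<and> T r = T x" for x using ranT[of x] by (metis rangeI)
  then obtain r where r: "\<And>x. r x \<in> range T" "\<And>x. T (r x) = T x" by metis
  have sub: "subspace (range T)" and cl: "closed (range T)"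
    using subR[of q] clR[of q] by (simp_all add: R_def T_def)
  have "x = 0" if "x \<in> range T" "x - C q x = 0" for x
    using uniq[of x 0] that TL(4) by (metis TC rangeI)
  then obtain c where c: "0 < c" "\<And>x. x \<in> range T \<Longrightarrow> c * norm x \<le> norm (T x)"
    using bounded_below_on[OF C(1)[of q] sub cl] unfolding TC by blast
  have "bounded_linear r"
  proof (rule bounded_linear_intro)
    show "r (x + y) = r x + r y" for x y
      by (rule uniq) (simp_all add: r TL subspace_add[OF sub])
    show "r (k *\<^sub>R x) = k *\<^sub>R r x" for k x
      by (rule uniq) (simp_all add: r TL subspace_scale[OF sub])
    show "norm (r x) \<le> norm x * ((1 + norm (C q)) / c)" for x
    proof -
      have "c * norm (r x) \<le> norm (T x)" using c(2)[OF r(1)] by (simp add: r)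
      also have "\<dots> \<le> norm x + norm (C q) * norm x"
        unfolding TC using norm_triangle_ineq4[of x "C q x"] norm_blinfun[of "C q" x] by linarith
      finally show ?thesis using c(1) by (simp add: field_simps)
    qed
  qed
  then have blp: "bounded_linear (\<lambda>x. x - r x)" by (intro bounded_linear_intros)
  define p where "p = Blinfun (\<lambda>x. x - r x)"
  have p: "p x = x - r x" for x unfolding p_def by (simp add: bounded_linear_Blinfun_apply[OF blp])
  have Tp: "T (p x) = 0" for x by (simp add: p TL r)
  have r0: "r x = 0" if "T x = 0" for x
    using uniq[of "r x" 0] r that TL(4) by (metis rangeI)
  have p_id: "p x = x" if "T x = 0" for x using r0[OF that] by (simp add: p)
  have rR: "r x = x" if "x \<in> range T" for x using uniq[OF r(1) that r(2)] .
  have ranp: "range (blinfun_apply p) = {x. x - C q x = 0}"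
    using Tp p_id unfolding TC by (auto intro: range_eqI[OF sym])
  obtain B where B: "finite B" "{x. x - C q x = 0} = span B"
    by (rule kernel_finite_span[OF C(1)])
  \<comment> \<open>\<open>f\<close> commutes with \<open>T\<close>, so \<open>f (r x)\<close> is
    again in \<open>range T\<close> and has the same image under \<open>T\<close> as
    \<open>r (f x)\<close>.\<close>
  have comm: "p (f x) = f (p x)"
    if f: "\<And>x. S (f x) = f (S x)" "\<And>x y. f (x - y) = f x - f y" for f x
  proof -
    have "(S ^^ n) (f x) = f ((S ^^ n) x)" for n x by (induction n) (simp_all add: f)
    then have Tf: "T (f x) = f (T x)" for x by (simp add: T_def)
    obtain z where "r x = T z" using r(1)[of x] by (rule rangeE)
    then have "f (r x) = T (f z)" by (simp only: Tf)
    then have 1: "f (r x) \<in> range T" by (simp only: rangeI)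
    have "T (r (f x)) = T (f (r x))" by (simp only: r(2) Tf)
    then have "r (f x) = f (r x)" by (rule uniq[OF r(1) 1])
    then show ?thesis by (simp add: p f)
  qed
  have pS: "p (S x) = S (p x)" for x by (rule comm) (simp_all add: SL)
  define L where "L = K - (K o\<^sub>L p)"
  define G where "G = id_blinfun - L"
  have G: "G x = S (x - p x) + p x" for x
    by (simp add: G_def L_def S_def blinfun.diff_left blinfun.diff_right)
  have L: "compact_op L" unfolding L_def by (intro compact_op_diff K compact_op_compose_right)
  have GL: "G x = x - L x" for x by (simp add: G_def blinfun.diff_left)
  have xp: "x - p x \<in> range T" for x using r(1) by (simp add: p)
  have injG: "x = 0" if "G x = 0" for x
  proof -
    have "p (G x) = S (p x - p (p x)) + p (p x)" by (simp add: G blinfun.add_right pS blinfun.diff_right)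
    then have px: "p x = 0" using p_id[OF Tp[of x]] that by (simp add: SL)
    then have "S x = 0" using that by (simp add: G)
    then have "p x = x" by (intro p_id kerS)
    then show ?thesis using px by simp
  qed
  obtain d where d: "0 < d" "\<And>x. d * norm x \<le> norm (G x)"
    using bounded_below_on[OF L subspace_UNIV closed_UNIV] injG unfolding GL by auto
  have "\<exists>x. G x = y" for y
  proof -
    obtain z where z: "y - p y = S (T z)" using SR xp[of y] by (metis imageE)
    have pT: "p (T z) = 0" using rR[of "T z"] by (simp add: p)
    have "G (T z + p y) = S (T z) + p y"
      using pT p_id[OF Tp[of y]] by (simp add: G blinfun.add_right SL(4))
    also have "\<dots> = y" by (simp flip: z)
    finally show ?thesis by blast
  qed
  then have "surj (blinfun_apply G)" by (metis surjI)
  then obtain G' where G': "\<And>x. blinfun_apply G' (G x) = x" "\<And>y. G (blinfun_apply G' y) = y"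
    using bounded_inverse[OF d] by blast
  \<comment> \<open>\<open>T\<close> vanishes on the range of \<open>p\<close> and is the identity
    minus the compact \<open>C q\<close>; hence \<open>p\<close> factors through \<open>C q\<close>
    and is compact.\<close>
  have p_eq: "p = C q o\<^sub>L p"
  proof (rule blinfun_eqI)
    show "p x = (C q o\<^sub>L p) x" for x using Tp[of x] unfolding TC by simp
  qed
  have cp: "compact_op p" by (subst p_eq) (rule compact_op_compose_right[OF C(1)])
  show thesis
  proof (rule that[OF B(1) _ p_id[OF Tp] cp _ comm G G'])
    show "range (blinfun_apply p) = span B" unfolding ranp B(2) ..
    show "p x = x" if "S x = 0" for x by (rule p_id[OF kerS[OF that]])
  qed
qed

section \<open>Operators over the scalar field and the Calkin algebra\<close>

lemma id_compose_blinfun [simp]: "id_blinfun o\<^sub>L A = A" "A o\<^sub>L id_blinfun = A"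
  by (auto intro: blinfun_eqI)

lemmas blinfun_compose_distrib =
  bounded_bilinear.add_left[OF bounded_bilinear_blinfun_compose]
  bounded_bilinear.add_right[OF bounded_bilinear_blinfun_compose]
  bounded_bilinear.diff_left[OF bounded_bilinear_blinfun_compose]
  bounded_bilinear.diff_right[OF bounded_bilinear_blinfun_compose]

lemmas blinfun_compose_scale =
  bounded_bilinear.scaleR_left[OF bounded_bilinear_blinfun_compose]
  bounded_bilinear.scaleR_right[OF bounded_bilinear_blinfun_compose]
  bounded_bilinear.minus_left[OF bounded_bilinear_blinfun_compose]
  bounded_bilinear.minus_right[OF bounded_bilinear_blinfun_compose]
  bounded_bilinear.zero_left[OF bounded_bilinear_blinfun_compose]
  bounded_bilinear.zero_right[OF bounded_bilinear_blinfun_compose]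

lemma blinfun_compose_assoc: "(A o\<^sub>L B) o\<^sub>L C = A o\<^sub>L (B o\<^sub>L C)"
  by (rule blinfun_eqI) simp

lemmas continuous_on_blinfun_compose [continuous_intros] =
  bounded_bilinear.continuous_on[OF bounded_bilinear_blinfun_compose]

lemma continuous_map_iff_continuous_on_mtopology:
  fixes S :: "'m::metric_space set"
  assumes "Metric_space M d"
  shows "continuous_map (top_of_set S) (Metric_space.mtopology M d) f \<longleftrightarrow>
     f ` S \<subseteq> M \<and> (\<forall>x\<in>S. \<forall>e>0. \<exists>\<delta>>0. \<forall>y\<in>S. dist y x < \<delta> \<longrightarrow> d (f x) (f y) < e)"
    (is "?L \<longleftrightarrow> ?R")
proof -
  interpret Metric_space M d by fact
  show ?thesis
  proof
    assume L: ?L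
    have fM: "f ` S \<subseteq> M" using continuous_map_image_subset_topspace[OF L] by simp
    moreover have "\<exists>\<delta>>0. \<forall>y\<in>S. dist y x < \<delta> \<longrightarrow> d (f x) (f y) < e" if "x \<in> S" "e > 0" for x e
    proof -
      obtain U where U: "openin (top_of_set S) U" "x \<in> U" "\<forall>y\<in>U. f y \<in> mball (f x) e"
        using L \<open>x \<in> S\<close> \<open>e > 0\<close> unfolding continuous_map_to_metric by force
      then obtain \<delta> where "\<delta> > 0" "\<And>y. y \<in> S \<Longrightarrow> dist y x < \<delta> \<Longrightarrow> y \<in> U"
        unfolding openin_euclidean_subtopology_iff by blast
      then show ?thesis using U(3) by auto
    qed
    ultimately show ?R by blast
  next
    assume R: ?R
    show ?L
      unfolding continuous_map_to_metric
    proof (intro ballI allI impI)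
      fix x and e :: real assume "x \<in> topspace (top_of_set S)" "e > 0"
      then obtain \<delta> where \<delta>: "\<delta> > 0" "\<And>y. y \<in> S \<Longrightarrow> dist y x < \<delta> \<Longrightarrow> d (f x) (f y) < e"
        and x: "x \<in> S" using R by force
      show "\<exists>U. openin (top_of_set S) U \<and> x \<in> U \<and> (\<forall>y\<in>U. f y \<in> mball (f x) e)"
      proof (intro exI[of _ "S \<inter> ball x \<delta>"] conjI ballI)
        show "f y \<in> mball (f x) e" if "y \<in> S \<inter> ball x \<delta>" for y
          using that R x \<delta>(2)[of y] by (auto simp: dist_commute image_subset_iff)
      qed (use x \<delta> in \<open>auto simp: openin_open_Int\<close>)
    qed
  qed
qed

sublocale banach_space_over \<subseteq> vector_space_endo smul ..

context banach_space_over
begin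

abbreviation Ops :: "('a \<Rightarrow>\<^sub>L 'a) set" where "Ops \<equiv> carrier (op_algebra smul)"
abbreviation Comp :: "('a \<Rightarrow>\<^sub>L 'a) set" where "Comp \<equiv> compact_ops smul"
abbreviation proj :: "('a \<Rightarrow>\<^sub>L 'a) \<Rightarrow> ('a \<Rightarrow>\<^sub>L 'a) set" where "proj \<equiv> calkin_proj smul"

lemma Ops_iff: "T \<in> Ops \<longleftrightarrow> (\<forall>c x. T (smul c x) = smul c (T x))"
  by (simp add: op_algebra_def)

lemma smul_scaleR: "smul c (r *\<^sub>R x) = r *\<^sub>R smul c x"
  by (simp add: scale_left_commute mult.commute flip: scale_of_real)

lemma bounded_linear_smul: "bounded_linear (smul c)"
  by (rule bounded_linear_intro[of _ "norm c"])
     (simp_all add: scale_right_distrib smul_scaleR norm_scale mult.commute)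

lemma Ops_endo: "T \<in> Ops \<Longrightarrow> endo (blinfun_apply T)"
  by (rule endoI) (simp_all add: blinfun.add_right Ops_iff)

lemma Ops_add: "S \<in> Ops \<Longrightarrow> T \<in> Ops \<Longrightarrow> S + T \<in> Ops"
  by (simp add: Ops_iff blinfun.add_left scale_right_distrib)

lemma Ops_diff: "S \<in> Ops \<Longrightarrow> T \<in> Ops \<Longrightarrow> S - T \<in> Ops"
  by (simp add: Ops_iff blinfun.diff_left scale_right_diff_distrib)

lemma Ops_scaleR: "T \<in> Ops \<Longrightarrow> r *\<^sub>R T \<in> Ops"
  by (simp add: Ops_iff blinfun.scaleR_left smul_scaleR)

lemma Ops_minus: "T \<in> Ops \<Longrightarrow> - T \<in> Ops"
  using Ops_scaleR[of T "-1"] by simp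

lemma Ops_compose: "S \<in> Ops \<Longrightarrow> T \<in> Ops \<Longrightarrow> S o\<^sub>L T \<in> Ops"
  by (simp add: Ops_iff)

lemma Ops_id: "id_blinfun \<in> Ops" and Ops_zero: "0 \<in> Ops"
  by (simp_all add: Ops_iff)

lemmas Ops_intros = Ops_add Ops_diff Ops_scaleR Ops_minus Ops_compose Ops_id Ops_zero

lemma Ops_inverse:
  fixes G G' :: "'a \<Rightarrow>\<^sub>L 'a"
  assumes "G \<in> Ops" "\<And>x. G' (G x) = x" "\<And>x. G (blinfun_apply G' x) = x"
  shows "G' \<in> Ops"
  unfolding Ops_iff
proof (intro allI)
  fix c x
  have "G' (smul c x) = G' (smul c (G (G' x)))" by (simp add: assms(3))
  also have "\<dots> = G' (G (smul c (G' x)))" using assms(1) by (simp add: Ops_iff)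
  also have "\<dots> = smul c (G' x)" by (rule assms(2))
  finally show "G' (smul c x) = smul c (G' x)" .
qed

lemma closed_Ops: "closed Ops"
proof -
  have 1: "Ops = (\<Inter>c. \<Inter>x. {T. blinfun_apply T (smul c x) = smul c (blinfun_apply T x)})"
    by (auto simp: Ops_iff)
  have 2: "closed {T :: 'a \<Rightarrow>\<^sub>L 'a. blinfun_apply T (smul c x) = smul c (blinfun_apply T x)}" for c x
    by (intro closed_Collect_eq continuous_intros bounded_linear.continuous_on[OF bounded_linear_smul])
  show ?thesis unfolding 1 by (intro closed_INT ballI 2)
qed

lemma Comp_iff: "T \<in> Comp \<longleftrightarrow> T \<in> Ops \<and> compact_op T"
  by (simp add: compact_ops_def compact_op_def)

lemma Comp_Ops: "T \<in> Comp \<Longrightarrow> T \<in> Ops"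
  by (simp add: Comp_iff)

lemma subspace_Comp: "Real_Vector_Spaces.subspace Comp"
  by (auto simp: real_vector.subspace_def Comp_iff Ops_intros compact_op_zero compact_op_add compact_op_scaleR)

lemma closed_Comp: "closed Comp"
proof -
  have "Comp = Ops \<inter> {T. compact_op T}" by (auto simp: Comp_iff)
  then show ?thesis using closed_Ops closed_compact_op by auto
qed

lemma Comp_compose_left: "A \<in> Ops \<Longrightarrow> T \<in> Comp \<Longrightarrow> A o\<^sub>L T \<in> Comp"
  and Comp_compose_right: "A \<in> Ops \<Longrightarrow> T \<in> Comp \<Longrightarrow> T o\<^sub>L A \<in> Comp"
  by (simp_all add: Comp_iff Ops_compose compact_op_compose_left compact_op_compose_right)

lemmas Comp_add = real_vector.subspace_add[OF subspace_Comp] and Comp_diff = real_vector.subspace_diff[OF subspace_Comp]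
  and Comp_minus = real_vector.subspace_neg[OF subspace_Comp] and Comp_zero = real_vector.subspace_0[OF subspace_Comp]
  and Comp_scaleR = real_vector.subspace_scale[OF subspace_Comp]

section \<open>The Calkin algebra as a quotient ring and a metric space\<close>

lemma op_algebra_simps:
  "x \<otimes>\<^bsub>op_algebra smul\<^esub> y = x o\<^sub>L y" "\<one>\<^bsub>op_algebra smul\<^esub> = id_blinfun"
  "\<zero>\<^bsub>op_algebra smul\<^esub> = 0" "x \<oplus>\<^bsub>op_algebra smul\<^esub> y = x + y"
  by (simp_all add: op_algebra_def)

lemma ring_op_algebra: "ring (op_algebra smul)"
proof (intro ringI abelian_groupI monoidI)
  show "\<exists>y\<in>Ops. y \<oplus>\<^bsub>op_algebra smul\<^esub> x = \<zero>\<^bsub>op_algebra smul\<^esub>" if "x \<in> Ops" for x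
    by (rule bexI[of _ "- x"]) (simp_all add: op_algebra_simps Ops_minus that)
qed (simp_all add: op_algebra_simps Ops_intros blinfun_compose_distrib blinfun_compose_assoc add_ac)

lemma op_algebra_minus: "T \<in> Ops \<Longrightarrow> \<ominus>\<^bsub>op_algebra smul\<^esub> T = - T"
proof -
  interpret ring "op_algebra smul" by (rule ring_op_algebra)
  show "T \<in> Ops \<Longrightarrow> \<ominus>\<^bsub>op_algebra smul\<^esub> T = - T"
    by (rule minus_equality) (simp_all add: op_algebra_simps Ops_minus)
qed

lemma ideal_Comp: "ideal Comp (op_algebra smul)"
proof (rule idealI[OF ring_op_algebra])
  interpret ring "op_algebra smul" by (rule ring_op_algebra)
  show "subgroup Comp (add_monoid (op_algebra smul))"
  proof (rule group.subgroupI[OF a_group])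
    show "inv\<^bsub>add_monoid (op_algebra smul)\<^esub> T \<in> Comp" if "T \<in> Comp" for T
      using that op_algebra_minus[OF Comp_Ops[OF that]] Comp_minus[OF that] by (simp add: a_inv_def)
  qed (use Comp_Ops Comp_zero Comp_add in \<open>auto simp: op_algebra_simps\<close>)
qed (simp_all add: op_algebra_simps Comp_compose_left Comp_compose_right)

lemma proj_ring_hom: "ring_hom_ring (op_algebra smul) (calkin smul) proj"
proof -
  have "proj = (+>\<^bsub>op_algebra smul\<^esub>) Comp" by (simp add: fun_eq_iff calkin_proj_def)
  then show ?thesis unfolding calkin_def using ideal.rcos_ring_hom_ring[OF ideal_Comp] by simp
qed

lemma proj_eq: "proj T = (\<lambda>k. k + T) ` Comp"
  by (auto simp: calkin_proj_def a_r_coset_def' op_algebra_simps)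

lemma proj_eq_iff: "proj S = proj T \<longleftrightarrow> S - T \<in> Comp"
proof
  assume "proj S = proj T"
  moreover have "S \<in> proj S" unfolding proj_eq using Comp_zero by force
  ultimately show "S - T \<in> Comp" unfolding proj_eq by auto
next
  assume ST: "S - T \<in> Comp"
  have "k + S \<in> (\<lambda>k. k + T) ` Comp" if "k \<in> Comp" for k
    using Comp_add[OF that ST] by (intro image_eqI[of _ _ "k + (S - T)"]) auto
  moreover have "k + T \<in> (\<lambda>k. k + S) ` Comp" if "k \<in> Comp" for k
    using Comp_diff[OF that ST] by (intro image_eqI[of _ _ "k - (S - T)"]) auto
  ultimately show "proj S = proj T" unfolding proj_eq by blast
qed

lemma carrier_calkin: "carrier (calkin smul) = proj ` Ops"
  by (auto simp: calkin_def FactRing_def A_RCOSETS_def' calkin_proj_def)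

text \<open>This identity makes the results on distances to a closed subspace available for the
  Calkin algebra.\<close>

lemma quotient_norm_proj: "quotient_norm (proj T) = infdist T Comp"
proof -
  have "quotient_norm (proj T) = (INF k\<in>Comp. norm (k + T))"
    by (simp add: quotient_norm_def proj_eq image_image)
  also have "(\<lambda>k. norm (k + T)) ` Comp = (\<lambda>k. dist T k) ` Comp"
  proof (intro equalityI subsetI)
    fix r assume "r \<in> (\<lambda>k. norm (k + T)) ` Comp"
    then obtain k where "k \<in> Comp" "r = norm (k + T)" by blast
    then show "r \<in> (\<lambda>k. dist T k) ` Comp"
      by (intro image_eqI[of _ _ "- k"]) (auto simp: dist_norm add.commute Comp_minus)
  next
    fix r assume "r \<in> (\<lambda>k. dist T k) ` Comp"
    then obtain k where "k \<in> Comp" "r = dist T k" by blast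
    then show "r \<in> (\<lambda>k. norm (k + T)) ` Comp"
      by (intro image_eqI[of _ _ "- k"]) (auto simp: dist_norm Comp_minus)
  qed
  finally show ?thesis using Comp_zero by (auto simp: infdist_def)
qed

lemma ring_dist_Ops: "S \<in> Ops \<Longrightarrow> T \<in> Ops \<Longrightarrow> ring_dist (op_algebra smul) norm S T = dist S T"
  by (simp add: ring_dist_def a_minus_def op_algebra_minus op_algebra_simps dist_norm)

lemma ring_dist_calkin:
  assumes "S \<in> Ops" "T \<in> Ops"
  shows "ring_dist (calkin smul) quotient_norm (proj S) (proj T) = infdist (S - T) Comp"
proof -
  interpret ring_hom_ring "op_algebra smul" "calkin smul" proj by (rule proj_ring_hom)
  have "proj S \<ominus>\<^bsub>calkin smul\<^esub> proj T = proj (S \<ominus>\<^bsub>op_algebra smul\<^esub> T)"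
    using assms by (simp add: a_minus_def)
  also have "\<dots> = proj (S - T)"
    using assms by (simp add: a_minus_def op_algebra_minus op_algebra_simps)
  finally show ?thesis using assms by (simp add: ring_dist_def quotient_norm_proj)
qed

lemma Metric_space_Ops: "Metric_space Ops (ring_dist (op_algebra smul) norm)"
proof
  show "0 \<le> ring_dist (op_algebra smul) norm x y" for x y by (simp add: ring_dist_def)
  show "ring_dist (op_algebra smul) norm x y = ring_dist (op_algebra smul) norm y x" for x y
    by (cases "x \<in> Ops \<and> y \<in> Ops") (auto simp: ring_dist_Ops dist_commute, auto simp: ring_dist_def)
qed (auto simp: ring_dist_Ops dist_triangle)

lemma Metric_space_calkin: "Metric_space (carrier (calkin smul)) (ring_dist (calkin smul) quotient_norm)"
proof
  let ?d = "ring_dist (calkin smul) quotient_norm"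
  have sym: "?d (proj S) (proj T) = ?d (proj T) (proj S)" if "S \<in> Ops" "T \<in> Ops" for S T
    using that infdist_subspace_minus[OF subspace_Comp, of "S - T"] by (simp add: ring_dist_calkin)
  show "0 \<le> ?d x y" for x y
    by (cases "x \<in> carrier (calkin smul) \<and> y \<in> carrier (calkin smul)")
      (auto simp: carrier_calkin ring_dist_calkin infdist_nonneg, auto simp: ring_dist_def carrier_calkin)
  show "?d x y = ?d y x" for x y
    by (cases "x \<in> carrier (calkin smul) \<and> y \<in> carrier (calkin smul)")
      (auto simp: carrier_calkin sym, auto simp: ring_dist_def carrier_calkin)
  show "(?d x y = 0) = (x = y)" if xy: "x \<in> carrier (calkin smul)" "y \<in> carrier (calkin smul)" for x y
  proof -
    obtain S T where "S \<in> Ops" "T \<in> Ops" "x = proj S" "y = proj T"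
      using xy unfolding carrier_calkin by blast
    then show ?thesis
      by (simp add: ring_dist_calkin proj_eq_iff infdist_subspace_zero_iff[OF subspace_Comp closed_Comp])
  qed
  show "?d x z \<le> ?d x y + ?d y z" if "x \<in> carrier (calkin smul)" "y \<in> carrier (calkin smul)"
    "z \<in> carrier (calkin smul)" for x y z
  proof -
    obtain S T U where "S \<in> Ops" "T \<in> Ops" "U \<in> Ops" "x = proj S" "y = proj T" "z = proj U"
      using \<open>x \<in> _\<close> \<open>y \<in> _\<close> \<open>z \<in> _\<close> unfolding carrier_calkin by blast
    then show ?thesis
      using infdist_subspace_add[OF subspace_Comp, of "S - T" "T - U"] by (simp add: ring_dist_calkin)
  qed
qed

section \<open>Continuous maps into the spaces of idempotents\<close>

lemma idempotents_Ops: "idempotents (op_algebra smul) = {T \<in> Ops. T o\<^sub>L T = T}"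
  by (simp add: idempotents_def op_algebra_simps)

lemma idempotents_calkin: "T \<in> Ops \<Longrightarrow> proj T \<in> idempotents (calkin smul) \<longleftrightarrow> (T o\<^sub>L T) - T \<in> Comp"
proof -
  assume T: "T \<in> Ops"
  interpret ring_hom_ring "op_algebra smul" "calkin smul" proj by (rule proj_ring_hom)
  have "proj T \<otimes>\<^bsub>calkin smul\<^esub> proj T = proj (T o\<^sub>L T)"
    using hom_mult[OF T T] by (simp add: op_algebra_simps)
  then show ?thesis using T by (simp add: idempotents_def proj_eq_iff)
qed

lemma continuous_map_projector_space:
  fixes S :: "'m::metric_space set"
  shows "continuous_map (top_of_set S) (projector_space smul) f \<longleftrightarrow>
    continuous_on S f \<and> (\<forall>x\<in>S. f x \<in> Ops \<and> f x o\<^sub>L f x = f x)"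
proof -
  have "continuous_map (top_of_set S) (projector_space smul) f \<longleftrightarrow>
    (f ` S \<subseteq> Ops \<and> (\<forall>x\<in>S. \<forall>e>0. \<exists>\<delta>>0. \<forall>y\<in>S. dist y x < \<delta> \<longrightarrow>
        ring_dist (op_algebra smul) norm (f x) (f y) < e)) \<and> f ` S \<subseteq> idempotents (op_algebra smul)"
    unfolding projector_space_def idempotent_space_def continuous_map_in_subtopology
      continuous_map_iff_continuous_on_mtopology[OF Metric_space_Ops] by (simp add: image_subset_iff_funcset)
  also have "\<dots> \<longleftrightarrow> (\<forall>x\<in>S. \<forall>e>0. \<exists>\<delta>>0. \<forall>y\<in>S. dist y x < \<delta> \<longrightarrow> dist (f y) (f x) < e) \<and>
      f ` S \<subseteq> idempotents (op_algebra smul)"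
  proof (cases "f ` S \<subseteq> idempotents (op_algebra smul)")
    case True
    then have "f ` S \<subseteq> Ops" by (auto simp: idempotents_Ops)
    moreover have "ring_dist (op_algebra smul) norm (f x) (f y) = dist (f y) (f x)"
      if "x \<in> S" "y \<in> S" for x y
      using calculation that by (simp add: image_subset_iff ring_dist_Ops dist_commute)
    ultimately show ?thesis using True by (simp cong: ball_cong)
  qed simp
  finally show ?thesis
    by (simp only: continuous_on_iff idempotents_Ops image_subset_iff mem_Collect_eq)
qed

text \<open>Representatives are first chosen pointwise without regard to continuity and then made
  continuous by \<open>continuous_selection_mod_subspace\<close>, which is where compactness of
  \<open>S\<close> enters.\<close>

lemma continuous_map_calkin_projector_space:
  fixes S :: "'m::metric_space set"
  assumes "compact S"
  shows "continuous_map (top_of_set S) (calkin_projector_space smul) f \<longleftrightarrow>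
    (\<exists>A. continuous_on S A \<and> (\<forall>x\<in>S. A x \<in> Ops \<and> (A x o\<^sub>L A x) - A x \<in> Comp \<and> f x = proj (A x)))"
    (is "_ \<longleftrightarrow> ?R")
proof -
  let ?d = "ring_dist (calkin smul) quotient_norm"
  have eq: "continuous_map (top_of_set S) (calkin_projector_space smul) f \<longleftrightarrow>
    (f ` S \<subseteq> carrier (calkin smul) \<and> (\<forall>x\<in>S. \<forall>e>0. \<exists>\<delta>>0. \<forall>y\<in>S. dist y x < \<delta> \<longrightarrow>
        ?d (f x) (f y) < e)) \<and> f ` S \<subseteq> idempotents (calkin smul)"
    unfolding calkin_projector_space_def idempotent_space_def continuous_map_in_subtopology
      continuous_map_iff_continuous_on_mtopology[OF Metric_space_calkin]
    by (simp add: image_subset_iff_funcset)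
  show ?thesis
  proof
    assume "continuous_map (top_of_set S) (calkin_projector_space smul) f"
    then have f1: "f ` S \<subseteq> carrier (calkin smul)" and f3: "f ` S \<subseteq> idempotents (calkin smul)"
      and f2: "\<And>x e. x \<in> S \<Longrightarrow> 0 < e \<Longrightarrow> \<exists>\<delta>>0. \<forall>y\<in>S. dist y x < \<delta> \<longrightarrow> ?d (f x) (f y) < e"
      unfolding eq by auto
    have "\<forall>x\<in>S. \<exists>T. T \<in> Ops \<and> f x = proj T" using f1 unfolding carrier_calkin by blast
    then obtain A0 where A0: "\<And>x. x \<in> S \<Longrightarrow> A0 x \<in> Ops" "\<And>x. x \<in> S \<Longrightarrow> f x = proj (A0 x)" by metis
    have cont: "\<exists>\<delta>>0. \<forall>y\<in>S. dist y x < \<delta> \<longrightarrow> infdist (A0 y - A0 x) Comp < e" if "x \<in> S" "0 < e" for x e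
    proof -
      obtain \<delta> where \<delta>: "\<delta> > 0" "\<And>y. y \<in> S \<Longrightarrow> dist y x < \<delta> \<Longrightarrow> ?d (f x) (f y) < e"
        using f2[OF \<open>x \<in> S\<close> \<open>0 < e\<close>] by blast
      have "infdist (A0 y - A0 x) Comp < e" if "y \<in> S" "dist y x < \<delta>" for y
        using \<delta>(2)[OF that] A0 \<open>x \<in> S\<close> \<open>y \<in> S\<close> infdist_subspace_minus[OF subspace_Comp, of "A0 x - A0 y"]
        by (simp add: ring_dist_calkin)
      then show ?thesis using \<delta>(1) by blast
    qed
    obtain A where A: "continuous_on S A" "\<And>x. x \<in> S \<Longrightarrow> A0 x - A x \<in> Comp"
      using continuous_selection_mod_subspace[OF subspace_Comp closed_Comp assms cont] by blast
    show ?R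
    proof (intro exI[of _ A] conjI ballI A(1))
      fix x assume x: "x \<in> S"
      have "A0 x - (A0 x - A x) \<in> Ops" by (intro Ops_diff A0(1) x Comp_Ops A(2))
      then show Ax: "A x \<in> Ops" by simp
      show fx: "f x = proj (A x)" using A0(2)[OF x] A(2)[OF x] by (simp add: proj_eq_iff)
      have "proj (A x) \<in> idempotents (calkin smul)" using f3 x by (simp only: flip: fx) blast
      then show "(A x o\<^sub>L A x) - A x \<in> Comp" using idempotents_calkin[OF Ax] by simp
    qed
  next
    assume ?R
    then obtain A where A: "continuous_on S A" "\<And>x. x \<in> S \<Longrightarrow> A x \<in> Ops"
      "\<And>x. x \<in> S \<Longrightarrow> (A x o\<^sub>L A x) - A x \<in> Comp" "\<And>x. x \<in> S \<Longrightarrow> f x = proj (A x)" by blast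
    show "continuous_map (top_of_set S) (calkin_projector_space smul) f"
      unfolding eq
    proof (intro conjI ballI allI impI)
      show "f ` S \<subseteq> carrier (calkin smul)" using A by (auto simp: carrier_calkin)
      show "f ` S \<subseteq> idempotents (calkin smul)" using A idempotents_calkin by auto
      fix x and e :: real assume x: "x \<in> S" and e: "0 < e"
      then obtain \<delta> where \<delta>: "\<delta> > 0" "\<And>y. y \<in> S \<Longrightarrow> dist y x < \<delta> \<Longrightarrow> dist (A y) (A x) < e"
        using A(1) unfolding continuous_on_iff by blast
      have "?d (f x) (f y) < e" if y: "y \<in> S" "dist y x < \<delta>" for y
      proof -
        have "?d (f x) (f y) \<le> norm (A x - A y)"
          using A x y infdist_subspace_le_norm[OF subspace_Comp] by (simp add: ring_dist_calkin)
        then show ?thesis using \<delta>(2)[OF y] by (simp add: dist_norm norm_minus_commute)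
      qed
      then show "\<exists>\<delta>>0. \<forall>y\<in>S. dist y x < \<delta> \<longrightarrow> ?d (f x) (f y) < e" using \<delta>(1) by blast
    qed
  qed
qed

end

section \<open>The Fredholm index\<close>

text \<open>Solving \<open>x + C x = y\<close> is a fixed-point problem for the contraction sending
  \<open>x\<close> to \<open>y - C x\<close>; the lower bound \<open>1 - norm C\<close> controls the
  inverse.\<close>

lemma neumann_inverse:
  fixes C :: "'a::banach \<Rightarrow>\<^sub>L 'a"
  assumes C: "norm C < 1"
  obtains D where "(id_blinfun + C) o\<^sub>L D = id_blinfun" "D o\<^sub>L (id_blinfun + C) = id_blinfun"
    "norm D \<le> 1 / (1 - norm C)"
proof -
  let ?G = "id_blinfun + C"
  have low: "(1 - norm C) * norm x \<le> norm (?G x)" for x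
    using norm_triangle_ineq2[of x "- C x"] norm_blinfun[of C x]
    by (simp add: blinfun.add_left algebra_simps)
  have "\<exists>x. ?G x = y" for y
  proof -
    have "\<exists>!x. y - C x = x"
    proof (rule banach_fix_type[OF norm_ge_zero C], intro allI)
      show "dist (y - C x) (y - C z) \<le> norm C * dist x z" for x z
        using norm_blinfun[of C "x - z"]
        by (simp add: dist_norm blinfun.diff_right norm_minus_commute)
    qed
    then obtain x where "y - C x = x" by blast
    then have "?G x = y" by (metis blinfun.add_left diff_add_cancel id_blinfun.rep_eq)
    then show ?thesis by blast
  qed
  then have "surj (blinfun_apply ?G)" by (metis surjI)
  then obtain D where D: "\<And>x. blinfun_apply D (?G x) = x" "\<And>x. ?G (blinfun_apply D x) = x"
    using bounded_inverse[of "1 - norm C" ?G] low C by auto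
  show thesis
  proof
    show "?G o\<^sub>L D = id_blinfun" "D o\<^sub>L ?G = id_blinfun"
      using D by (auto intro!: blinfun_eqI)
    show "norm D \<le> 1 / (1 - norm C)"
    proof (rule norm_blinfun_bound)
      show "norm (D x) \<le> 1 / (1 - norm C) * norm x" for x
        using low[of "D x"] C by (simp add: D field_simps)
    qed (use C in simp)
  qed
qed

context banach_space_over
begin

text \<open>Equality in the Calkin algebra, kept on representatives so that computations stay among
  operators.\<close>

definition ceq :: "('a \<Rightarrow>\<^sub>L 'a) \<Rightarrow> ('a \<Rightarrow>\<^sub>L 'a) \<Rightarrow> bool" (infix "\<simeq>\<^sub>K" 50) where
  "A \<simeq>\<^sub>K B \<longleftrightarrow> A - B \<in> Comp"

lemma ceq_refl [simp]: "A \<simeq>\<^sub>K A"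
  by (simp add: ceq_def Comp_zero)

lemma ceq_sym: "A \<simeq>\<^sub>K B \<Longrightarrow> B \<simeq>\<^sub>K A"
  using Comp_minus[of "A - B"] by (simp add: ceq_def)

lemma ceq_trans [trans]: "A \<simeq>\<^sub>K B \<Longrightarrow> B \<simeq>\<^sub>K C \<Longrightarrow> A \<simeq>\<^sub>K C"
  using Comp_add[of "A - B" "B - C"] by (simp add: ceq_def)

lemma ceq_add: "A \<simeq>\<^sub>K A' \<Longrightarrow> B \<simeq>\<^sub>K B' \<Longrightarrow> A + B \<simeq>\<^sub>K A' + B'"
  using Comp_add[of "A - A'" "B - B'"] by (simp add: ceq_def algebra_simps)

lemma ceq_left: "B \<simeq>\<^sub>K B' \<Longrightarrow> A \<in> Ops \<Longrightarrow> A o\<^sub>L B \<simeq>\<^sub>K A o\<^sub>L B'"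
  by (simp add: ceq_def Comp_compose_left flip: blinfun_compose_distrib)

lemma ceq_right: "A \<simeq>\<^sub>K A' \<Longrightarrow> B \<in> Ops \<Longrightarrow> A o\<^sub>L B \<simeq>\<^sub>K A' o\<^sub>L B"
  by (simp add: ceq_def Comp_compose_right flip: blinfun_compose_distrib)

lemma ceq_proj: "A \<simeq>\<^sub>K B \<longleftrightarrow> proj A = proj B"
  by (simp add: ceq_def proj_eq_iff)

text \<open>The Riesz theory yields finite spanning sets over the reals; this inclusion makes them
  spanning sets over \<open>'k\<close>.\<close>

lemma real_span_subset_span: "real_vector.span B \<subseteq> span B"
proof (rule real_vector.span_minimal)
  show "B \<subseteq> span B" by (rule span_superset)
  show "Real_Vector_Spaces.subspace (span B)"
    unfolding real_vector.subspace_def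
    by (auto simp: span_zero span_add span_scale simp flip: scale_of_real)
qed

lemma finite_rank_Ops:
  assumes "T \<in> Ops" "finite B" "range (blinfun_apply T) \<subseteq> real_vector.span B"
  shows "finite_rank (blinfun_apply T)"
  unfolding finite_rank_def using assms real_span_subset_span[of B] Ops_endo by blast

text \<open>\<open>p\<close> is the spectral projection of \<open>T\<close> at \<open>0\<close>.\<close>

lemma ceq_id_decomposition:
  assumes T: "T \<in> Ops" "T \<simeq>\<^sub>K id_blinfun"
  obtains p G G' B where "p \<in> Comp" "G \<in> Ops" "G' \<in> Ops" "finite B"
    "range (blinfun_apply p) = real_vector.span B" "\<And>x. p (p x) = p x" "\<And>x. T x = 0 \<Longrightarrow> p x = x"
    "\<And>x. blinfun_apply G' (G x) = x" "\<And>x. G (blinfun_apply G' x) = x"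
    "finite_rank (\<lambda>x. T x - G x)"
proof -
  define K where "K = id_blinfun - T"
  have K: "K \<in> Comp" using ceq_sym[OF T(2)] by (simp add: K_def ceq_def)
  have TK: "x - K x = T x" for x by (simp add: K_def blinfun.diff_left)
  have KO: "K \<in> Ops" and Kc: "compact_op K" using K by (simp_all add: Comp_iff)
  obtain p G G' :: "'a \<Rightarrow>\<^sub>L 'a" and B where
    pG: "finite B" "range (blinfun_apply p) = real_vector.span B" "\<And>x. p (p x) = p x" "compact_op p"
    "\<And>x. T x = 0 \<Longrightarrow> p x = x"
    "\<And>f x. \<lbrakk>\<And>x. T (f x) = f (T x); \<And>x y. f (x - y) = f x - f y\<rbrakk> \<Longrightarrow> p (f x) = f (p x)"
    "\<And>x. G x = T (x - p x) + p x" "\<And>x. G' (G x) = x" "\<And>x. G (G' x) = x"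
    by (rule riesz_decomposition[OF Kc, unfolded TK]) blast
  \<comment> \<open>Scalar multiplication by any element of \<open>'k\<close> is additive and
    commutes with \<open>T\<close>, hence commutes with \<open>p\<close>.\<close>
  have pO: "p \<in> Ops"
    unfolding Ops_iff using pG(6)[of "smul _"] T(1) by (simp add: Ops_iff scale_right_diff_distrib)
  have GO: "G \<in> Ops"
    using T(1) pO by (simp add: Ops_iff pG(7) scale_right_diff_distrib scale_right_distrib blinfun.diff_right)
  \<comment> \<open>\<open>T\<close> and \<open>G\<close> agree on the complement of the range of
    \<open>p\<close>, so their difference factors through \<open>p\<close>.\<close>
  have eq: "T x - G x = - K (p x)" for x
    by (simp add: pG(7) K_def blinfun.diff_left blinfun.diff_right)
  show thesis
  proof (rule that[OF _ GO Ops_inverse[OF GO pG(8,9)] pG(1-3) pG(5) pG(8,9)])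
    show "p \<in> Comp" using pO pG(4) by (simp add: Comp_iff)
    show "finite_rank (\<lambda>x. T x - G x)"
      unfolding eq
      by (rule finite_rank_minus, rule finite_rank_compose_right[OF finite_rank_Ops[OF pO pG(1)] Ops_endo[OF KO]])
        (simp add: pG(2))
  qed
qed

section \<open>Invertibility modulo compact operators\<close>

definition calkin_inverse :: "('a \<Rightarrow>\<^sub>L 'a) \<Rightarrow> ('a \<Rightarrow>\<^sub>L 'a) \<Rightarrow> bool" where
  "calkin_inverse A B \<longleftrightarrow> A \<in> Ops \<and> B \<in> Ops \<and> A o\<^sub>L B \<simeq>\<^sub>K id_blinfun \<and> B o\<^sub>L A \<simeq>\<^sub>K id_blinfun"

lemma calkin_inverse_sym: "calkin_inverse A B \<Longrightarrow> calkin_inverse B A"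
  by (simp add: calkin_inverse_def)

lemma calkin_inverse_compose:
  assumes "calkin_inverse A B" "calkin_inverse A' B'"
  shows "calkin_inverse (A o\<^sub>L A') (B' o\<^sub>L B)"
proof -
  note a = assms[unfolded calkin_inverse_def]
  have *: "(C o\<^sub>L C') o\<^sub>L (D' o\<^sub>L D) \<simeq>\<^sub>K id_blinfun"
    if "C \<in> Ops" "D \<in> Ops" "C o\<^sub>L D \<simeq>\<^sub>K id_blinfun" "C' o\<^sub>L D' \<simeq>\<^sub>K id_blinfun" for C C' D D'
  proof -
    have "(C o\<^sub>L C') o\<^sub>L (D' o\<^sub>L D) = C o\<^sub>L ((C' o\<^sub>L D') o\<^sub>L D)" by (simp add: blinfun_compose_assoc)
    also have "\<dots> \<simeq>\<^sub>K C o\<^sub>L (id_blinfun o\<^sub>L D)" using that by (intro ceq_left ceq_right)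
    also have "\<dots> = C o\<^sub>L D" by simp
    also have "\<dots> \<simeq>\<^sub>K id_blinfun" by (rule that)
    finally show ?thesis .
  qed
  show ?thesis using a by (auto simp: calkin_inverse_def Ops_compose *)
qed

lemma calkin_inverse_ceq:
  assumes "calkin_inverse A B" "A' \<in> Ops" "A' \<simeq>\<^sub>K A" shows "calkin_inverse A' B"
proof -
  note a = assms[unfolded calkin_inverse_def]
  have "A' o\<^sub>L B \<simeq>\<^sub>K A o\<^sub>L B" "B o\<^sub>L A' \<simeq>\<^sub>K B o\<^sub>L A" using a by (auto intro: ceq_left ceq_right)
  then show ?thesis using a ceq_trans by (auto simp: calkin_inverse_def)
qed

text \<open>Half of Atkinson's theorem. Decomposing \<open>B A\<close> gives the left parametrix
  \<open>G' B\<close>, decomposing \<open>A B\<close> gives the right parametrix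
  \<open>B J'\<close>, and \<open>parametrix_left_right\<close> merges them.\<close>

lemma calkin_inverse_parametrix:
  assumes "calkin_inverse A B"
  obtains g where "parametrix (blinfun_apply A) g"
proof -
  note a = assms[unfolded calkin_inverse_def]
  have AB: "A o\<^sub>L B \<in> Ops" "B o\<^sub>L A \<in> Ops" using a by (auto intro: Ops_compose)
  obtain G G' where G: "G' \<in> Ops" "\<And>x. blinfun_apply G' (blinfun_apply G x) = x"
    "finite_rank (\<lambda>x. (B o\<^sub>L A) x - G x)"
    by (rule ceq_id_decomposition[OF AB(2)]) (use a in auto)
  obtain J J' where J: "J' \<in> Ops" "\<And>x. blinfun_apply J (blinfun_apply J' x) = x"
    "finite_rank (\<lambda>x. (A o\<^sub>L B) x - J x)"
    by (rule ceq_id_decomposition[OF AB(1)]) (use a in auto)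
  note e = Ops_endo[OF G(1)] Ops_endo[OF J(1)]
  have 1: "(\<lambda>x. x - G' (B (A x))) = (\<lambda>x. - G' ((B o\<^sub>L A) x - G x))"
    by (simp add: blinfun.diff_right G(2))
  have 2: "(\<lambda>x. x - A (B (J' x))) = (\<lambda>x. - ((A o\<^sub>L B) (J' x) - J (J' x)))"
    by (simp add: J(2))
  have "parametrix (blinfun_apply A) (\<lambda>x. G' (B x))"
  proof (rule parametrix_left_right[where h = "\<lambda>x. B (J' x)"])
    show "endo (blinfun_apply A)" using a by (simp add: Ops_endo)
    show "endo (\<lambda>x. G' (B x))" by (rule endo_compose[OF e(1) Ops_endo]) (use a in simp)
    show "endo (\<lambda>x. B (J' x))" by (rule endo_compose[OF Ops_endo e(2)]) (use a in simp)
    show "finite_rank (\<lambda>x. x - G' (B (A x)))"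
      unfolding 1 by (rule finite_rank_minus, rule finite_rank_compose_right[OF G(3) e(1)])
    show "finite_rank (\<lambda>x. x - A (B (J' x)))"
      unfolding 2 by (rule finite_rank_minus, rule finite_rank_compose_left[OF J(3) e(2)])
  qed
  then show thesis by (rule that)
qed

abbreviation bindex :: "('a \<Rightarrow>\<^sub>L 'a) \<Rightarrow> 'k" where
  "bindex T \<equiv> index (blinfun_apply T)"

lemma bindex_compose:
  assumes "calkin_inverse A B" "calkin_inverse A' B'"
  shows "bindex (A o\<^sub>L A') = bindex A + bindex A'"
proof -
  obtain g g' where "parametrix (blinfun_apply A) g" "parametrix (blinfun_apply A') g'"
    using assms calkin_inverse_parametrix by metis
  then have "index (\<lambda>x. A (A' x)) = bindex A + bindex A'" by (rule index_compose)
  moreover have "blinfun_apply (A o\<^sub>L A') = (\<lambda>x. A (A' x))" by auto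
  ultimately show ?thesis by simp
qed

lemma bindex_inverse:
  assumes "G \<in> Ops" "G' \<in> Ops" "G o\<^sub>L G' = id_blinfun" "G' o\<^sub>L G = id_blinfun"
  shows "bindex G = 0"
proof (rule index_inverse[of _ "blinfun_apply G'"])
  show "G' (G x) = x" "G (G' x) = x" for x
    using assms(3,4) by (metis blinfun_apply_blinfun_compose id_blinfun.rep_eq)+
qed (use assms Ops_endo in auto)

text \<open>By the Riesz decomposition \<open>T\<close> is an invertible operator plus a finite-rank
  one.\<close>

lemma bindex_ceq_id:
  assumes T: "T \<in> Ops" "T \<simeq>\<^sub>K id_blinfun" shows "bindex T = 0"
proof -
  obtain G G' where G: "G \<in> Ops" "G' \<in> Ops" "\<And>x. blinfun_apply G' (blinfun_apply G x) = x"
    "\<And>x. blinfun_apply G (blinfun_apply G' x) = x" "finite_rank (\<lambda>x. T x - G x)"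
    by (rule ceq_id_decomposition[OF T]) blast
  note e = Ops_endo[OF G(1)] Ops_endo[OF G(2)]
  have "index (\<lambda>x. G x + (T x - G x)) = index (blinfun_apply G)"
    by (rule index_finite_rank[OF parametrix_inverse[OF e G(3,4)] G(5)])
  also have "\<dots> = 0" by (rule index_inverse[OF e G(3,4)])
  finally show ?thesis by simp
qed

lemma bindex_calkin_inverse:
  assumes "calkin_inverse A B" shows "bindex A = - bindex B"
proof -
  note a = assms[unfolded calkin_inverse_def]
  have "bindex (A o\<^sub>L B) = 0" using a by (intro bindex_ceq_id) (auto intro: Ops_compose)
  then show ?thesis
    using bindex_compose[OF assms calkin_inverse_sym[OF assms]] by (simp add: eq_neg_iff_add_eq_0)
qed

text \<open>The same \<open>B\<close> inverts \<open>A\<close> and \<open>A'\<close> modulo compact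
  operators, so both indices equal \<open>- bindex B\<close>.\<close>

lemma bindex_ceq:
  assumes "calkin_inverse A B" "A' \<in> Ops" "A' \<simeq>\<^sub>K A" shows "bindex A' = bindex A"
  using bindex_calkin_inverse[OF assms(1)] bindex_calkin_inverse[OF calkin_inverse_ceq[OF assms]] by simp

text \<open>For \<open>s\<close> near \<open>t\<close>, the product of \<open>A s\<close> and
  \<open>B t\<close> is congruent to the identity plus an operator of norm below 1, hence has index
  zero. By additivity \<open>A s\<close> and \<open>A t\<close> both have the index opposite to that
  of \<open>B t\<close>, and local constancy on a connected interval suffices.\<close>

lemma bindex_path_constant:
  fixes A :: "real \<Rightarrow> 'a \<Rightarrow>\<^sub>L 'a"
  assumes A: "continuous_on {0..1} A" and inv: "\<And>t. t \<in> {0..1} \<Longrightarrow> calkin_inverse (A t) (B t)"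
  shows "bindex (A 0) = bindex (A 1)"
proof (rule connected_local_const[of "{0..1::real}"])
  show "\<forall>t\<in>{0..1}. \<forall>\<^sub>F s in at t within {0..1}. bindex (A t) = bindex (A s)"
  proof
    fix t :: real assume t: "t \<in> {0..1}"
    note it = inv[OF t] and it' = inv[OF t, unfolded calkin_inverse_def]
    \<comment> \<open>Chosen so that \<open>e * norm (B t) < 1\<close>; the added 1 keeps the
      denominator positive when \<open>B t = 0\<close>.\<close>
    define e where "e = 1 / (norm (B t) + 1)"
    have nb: "0 < norm (B t) + 1" using norm_ge_zero[of "B t"] by linarith
    have e: "0 < e" using nb by (simp add: e_def)
    have "(A \<longlongrightarrow> A t) (at t within {0..1})" using A t by (simp add: continuous_on_def)
    then have "\<forall>\<^sub>F s in at t within {0..1}. dist (A s) (A t) < e" using e by (rule tendstoD)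
    moreover have "\<forall>\<^sub>F s in at t within {0..1}. s \<in> {0..1}" by (simp add: eventually_at_filter)
    ultimately show "\<forall>\<^sub>F s in at t within {0..1}. bindex (A t) = bindex (A s)"
    proof eventually_elim
      case (elim s)
      note ci_s = inv[OF elim(2)] and ci_s' = inv[OF elim(2), unfolded calkin_inverse_def]
      define C where "C = (A s - A t) o\<^sub>L B t"
      have "norm C \<le> norm (A s - A t) * norm (B t)" unfolding C_def by (rule norm_blinfun_compose)
      also have "\<dots> \<le> e * norm (B t)" using elim(1) by (intro mult_right_mono) (auto simp: dist_norm)
      also have "\<dots> < 1" using nb by (simp add: e_def)
      finally obtain D where D: "(id_blinfun + C) o\<^sub>L D = id_blinfun" "D o\<^sub>L (id_blinfun + C) = id_blinfun"
        by (rule neumann_inverse)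
      have CO: "id_blinfun + C \<in> Ops" unfolding C_def using it' ci_s' by (intro Ops_intros) auto
      have "D \<in> Ops"
        by (rule Ops_inverse[OF CO]) (metis D blinfun_apply_blinfun_compose id_blinfun.rep_eq)+
      then have 0: "bindex (id_blinfun + C) = 0" by (rule bindex_inverse[OF CO _ D])
      have ci: "calkin_inverse (id_blinfun + C) D"
        using CO \<open>D \<in> Ops\<close> D by (simp add: calkin_inverse_def)
      have "A s o\<^sub>L B t = (A t o\<^sub>L B t) + C" by (simp add: C_def blinfun_compose_distrib)
      also have "\<dots> \<simeq>\<^sub>K id_blinfun + C" using it' by (intro ceq_add) auto
      finally have "bindex (A s o\<^sub>L B t) = 0"
        using bindex_ceq[OF ci] it' ci_s' 0 by (simp add: Ops_compose)
      then show "bindex (A t) = bindex (A s)"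
        using bindex_compose[OF ci_s calkin_inverse_sym[OF it]] bindex_calkin_inverse[OF it]
        by (simp add: add_eq_0_iff)
    qed
  qed
qed auto

lemma bindex_integer:
  assumes "calkin_inverse A B" obtains n :: int where "bindex A = of_int n"
proof -
  obtain g where "parametrix (blinfun_apply A) g" by (rule calkin_inverse_parametrix[OF assms])
  then obtain h where "bindex A = of_nat (dim {x. A x = 0}) - of_nat (dim (range (\<lambda>x. x - A (h x))))"
    by (rule generalized_inverse_parametrix)
  then have "bindex A = of_int (int (dim {x. A x = 0}) - int (dim (range (\<lambda>x. x - A (h x)))))" by simp
  then show thesis by (rule that)
qed

text \<open>\<open>B (A x) = x - K x\<close> with \<open>K\<close> compact, so unit vectors with
  small images under \<open>A\<close> would have a subsequence converging to a unit vector in the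
  kernel. The bound later provides a bounded inverse for a bijective \<open>A\<close>.\<close>

lemma calkin_inverse_bounded_below:
  assumes AB: "calkin_inverse A B" and inj: "\<And>x. A x = 0 \<Longrightarrow> x = 0"
  obtains c where "0 < c" "\<And>x. c * norm x \<le> norm (A x)"
proof (rule ccontr)
  note witness = that
  assume neg: "\<not> thesis"
  have no: "\<exists>x. norm (A x) < c * norm x" if "0 < c" for c
    using neg witness[OF that] by (meson not_le)
  have "\<exists>x. norm (A x) < inverse (real (Suc n)) * norm x" for n by (rule no) simp
  then obtain x where x: "\<And>n. norm (A (x n)) < inverse (real (Suc n)) * norm (x n)" by metis
  have x0: "0 < norm (x n)" for n using x[of n] by (cases "x n = 0") auto
  define u where "u n = x n /\<^sub>R norm (x n)" for n
  have u: "norm (u n) = 1" for n using x0[of n] by (simp add: u_def)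
  have Au: "norm (A (u n)) \<le> inverse (real (Suc n))" for n
    using x[of n] x0[of n] by (simp add: u_def blinfun.scaleR_right divide_simps)
  have Au0: "(\<lambda>n. A (u n)) \<longlonglongrightarrow> 0"
    by (rule Lim_null_comparison[OF _ LIMSEQ_inverse_real_of_nat]) (rule always_eventually, rule allI, rule Au)
  define K where "K = id_blinfun - (B o\<^sub>L A)"
  have K: "compact_op K"
    using ceq_sym[of "B o\<^sub>L A" id_blinfun] AB by (simp add: K_def calkin_inverse_def ceq_def Comp_iff)
  have SK: "u n - K (u n) = B (A (u n))" for n by (simp add: K_def blinfun.diff_left)
  have "(\<lambda>n. B (A (u n))) \<longlonglongrightarrow> B 0" by (intro tendsto_intros Au0)
  then have "(\<lambda>n. u n - K (u n)) \<longlonglongrightarrow> 0" by (simp add: SK)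
  then obtain l and r :: "nat \<Rightarrow> nat" where r: "strict_mono r" "(\<lambda>n. u (r n)) \<longlonglongrightarrow> l"
    using convergent_subsequence[OF K, of u 1 0] u by (metis order_refl)
  have "(\<lambda>n. A (u (r n))) \<longlonglongrightarrow> A l" by (intro tendsto_intros r)
  moreover have "(\<lambda>n. A (u (r n))) \<longlonglongrightarrow> 0" using LIMSEQ_subseq_LIMSEQ[OF Au0 r(1)] by (simp add: o_def)
  ultimately have "l = 0" using inj LIMSEQ_unique by blast
  moreover have "norm l = 1" using tendsto_norm[OF r(2)] u by (simp add: LIMSEQ_const_iff)
  ultimately show False by simp
qed

section \<open>Projections of relative index zero\<close>

text \<open>The identity on the kernel of \<open>P\<close> turns the compression to the range of
  \<open>P\<close> into an operator on the whole space without altering its index.\<close>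

definition compression :: "('a \<Rightarrow>\<^sub>L 'a) \<Rightarrow> ('a \<Rightarrow>\<^sub>L 'a) \<Rightarrow> ('a \<Rightarrow>\<^sub>L 'a)" where
  "compression P g = (P o\<^sub>L g o\<^sub>L P) + (id_blinfun - P)"

lemma compression_Ops: "P \<in> Ops \<Longrightarrow> g \<in> Ops \<Longrightarrow> compression P g \<in> Ops"
  unfolding compression_def by (intro Ops_intros)

lemma compression_id: "P o\<^sub>L P = P \<Longrightarrow> compression P id_blinfun = id_blinfun"
  by (simp add: compression_def)

lemma compression_ceq:
  assumes "P \<in> Ops" "g \<simeq>\<^sub>K h" shows "compression P g \<simeq>\<^sub>K compression P h"
  unfolding compression_def using assms by (intro ceq_add ceq_refl ceq_right ceq_left)

text \<open>The defect is \<open>P g\<close> times the commutator of \<open>P\<close> and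
  \<open>h\<close> times \<open>P\<close>, so commutation is asked of the right factor
  alone.\<close>

lemma compression_compose:
  assumes P: "P \<in> Ops" "P o\<^sub>L P = P" and g: "g \<in> Ops" and h: "h \<in> Ops"
    and comm: "P o\<^sub>L h \<simeq>\<^sub>K h o\<^sub>L P"
  shows "compression P g o\<^sub>L compression P h \<simeq>\<^sub>K compression P (g o\<^sub>L h)"
proof -
  have PP: "P (P x) = P x" for x using P(2) by (metis blinfun_apply_blinfun_compose)
  have "(compression P g o\<^sub>L compression P h) - compression P (g o\<^sub>L h)
      = (P o\<^sub>L g) o\<^sub>L (((P o\<^sub>L h) - (h o\<^sub>L P)) o\<^sub>L P)"
    by (rule blinfun_eqI)
      (simp add: compression_def PP blinfun.add_left blinfun.diff_left blinfun.add_right blinfun.diff_right)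
  also have "\<dots> \<in> Comp"
    by (rule Comp_compose_left[OF Ops_compose[OF P(1) g] Comp_compose_right[OF P(1) comm[unfolded ceq_def]]])
  finally show ?thesis by (simp add: ceq_def)
qed

lemma calkin_inverse_compression:
  assumes P: "P \<in> Ops" "P o\<^sub>L P = P" and gh: "calkin_inverse g h"
    and g: "P o\<^sub>L g \<simeq>\<^sub>K g o\<^sub>L P" and h: "P o\<^sub>L h \<simeq>\<^sub>K h o\<^sub>L P"
  shows "calkin_inverse (compression P g) (compression P h)"
proof -
  note a = gh[unfolded calkin_inverse_def]
  have "compression P g o\<^sub>L compression P h \<simeq>\<^sub>K compression P (g o\<^sub>L h)"
    using a by (intro compression_compose P h) auto
  also have "\<dots> \<simeq>\<^sub>K compression P id_blinfun" using a by (intro compression_ceq P) auto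
  finally have 1: "compression P g o\<^sub>L compression P h \<simeq>\<^sub>K id_blinfun" by (simp add: compression_id P)
  have "compression P h o\<^sub>L compression P g \<simeq>\<^sub>K compression P (h o\<^sub>L g)"
    using a by (intro compression_compose P g) auto
  also have "\<dots> \<simeq>\<^sub>K compression P id_blinfun" using a by (intro compression_ceq P) auto
  finally have 2: "compression P h o\<^sub>L compression P g \<simeq>\<^sub>K id_blinfun" by (simp add: compression_id P)
  show ?thesis using a 1 2 by (simp add: calkin_inverse_def compression_Ops P)
qed

text \<open>The fibre of the quotient map over \<open>proj P\<close>: paths inside it become
  constant in the Calkin algebra.\<close>

definition compact_fibre :: "('a \<Rightarrow>\<^sub>L 'a) \<Rightarrow> ('a \<Rightarrow>\<^sub>L 'a) set" where
  "compact_fibre P = {Q \<in> Ops. Q o\<^sub>L Q = Q \<and> Q \<simeq>\<^sub>K P}"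

text \<open>Idempotents with a common range, or with a common kernel, form a convex set.\<close>

lemma path_component_compact_fibre:
  assumes X: "X \<in> compact_fibre P" and Y: "Y \<in> compact_fibre P"
    and XY: "X o\<^sub>L Y = Y \<and> Y o\<^sub>L X = X \<or> X o\<^sub>L Y = X \<and> Y o\<^sub>L X = Y"
  shows "path_component (compact_fibre P) X Y"
proof -
  have "closed_segment X Y \<subseteq> compact_fibre P"
  proof
    fix Z assume "Z \<in> closed_segment X Y"
    then obtain t where Z: "Z = (1 - t) *\<^sub>R X + t *\<^sub>R Y" by (auto simp: closed_segment_def)
    have "Z o\<^sub>L Z = (1 - t) *\<^sub>R (1 - t) *\<^sub>R X + ((1 - t) * t) *\<^sub>R (X + Y) + t *\<^sub>R t *\<^sub>R Y"
      using X Y XY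
      by (auto simp: Z compact_fibre_def blinfun_compose_distrib blinfun_compose_scale
          scaleR_add_right scaleR_add_left mult.commute)
    also have "\<dots> = Z" by (simp add: Z algebra_simps)
    finally have "Z o\<^sub>L Z = Z" .
    moreover have "Z - P = (1 - t) *\<^sub>R (X - P) + t *\<^sub>R (Y - P)" by (simp add: Z algebra_simps)
    then have "Z \<simeq>\<^sub>K P"
      using X Y Comp_add Comp_scaleR by (simp add: compact_fibre_def ceq_def)
    moreover have "Z \<in> Ops" using X Y by (simp add: Z compact_fibre_def Ops_intros)
    ultimately show "Z \<in> compact_fibre P" by (simp add: compact_fibre_def)
  qed
  moreover have "path_component (closed_segment X Y) X Y"
    using path_component_linepath[of X Y "closed_segment X Y"] by simp
  ultimately show ?thesis by (rule path_component_of_subset)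
qed

text \<open>Turns maps found by linear algebra into bounded operators: on the finite-dimensional
  range of \<open>p\<close> every linear map is bounded.\<close>

lemma bounded_extension_from_finite_span:
  fixes p :: "'a \<Rightarrow>\<^sub>L 'a"
  assumes f: "endo f" and B: "finite B" and p: "range (blinfun_apply p) = real_vector.span B" "p \<in> Ops"
  obtains J where "J \<in> Ops" "\<And>x. blinfun_apply J x = f (p x)"
proof -
  have fR: "f (r *\<^sub>R x) = r *\<^sub>R f x" for r x
    using endo_scale[OF f, of "of_real r" x] by (simp add: scale_of_real)
  obtain C where C: "\<And>v. v \<in> real_vector.span B \<Longrightarrow> norm (f v) \<le> C * norm v"
    using bounded_on_span_finite[OF B, of f] endo_add[OF f] fR by blast
  have "bounded_linear (\<lambda>x. f (p x))"
  proof (rule bounded_linear_intro)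
    show "f (p (x + y)) = f (p x) + f (p y)" for x y by (simp add: blinfun.add_right endo_add[OF f])
    show "f (p (r *\<^sub>R x)) = r *\<^sub>R f (p x)" for r x by (simp add: blinfun.scaleR_right fR)
    show "norm (f (p x)) \<le> norm x * (\<bar>C\<bar> * norm p)" for x
    proof -
      have "norm (f (p x)) \<le> C * norm (p x)" using C p(1) by blast
      also have "\<dots> \<le> \<bar>C\<bar> * norm (p x)" by (intro mult_right_mono) auto
      also have "\<dots> \<le> \<bar>C\<bar> * (norm p * norm x)" by (intro mult_left_mono norm_blinfun) auto
      finally show ?thesis by (simp add: mult_ac)
    qed
  qed
  then have J: "blinfun_apply (Blinfun (\<lambda>x. f (p x))) x = f (p x)" for x
    by (simp add: bounded_linear_Blinfun_apply)
  show thesis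
    by (rule that[OF _ J]) (use p(2) endo_scale[OF f] in \<open>simp add: Ops_iff J\<close>)
qed

text \<open>With \<open>Q = g P g\<^sup>-\<^sup>1\<close>, the finite-rank correction \<open>M\<close> tilts the kernel of \<open>Q\<close> along
  \<open>range Q\<close> so that it becomes a common complement of \<open>range P\<close> and \<open>range Q\<close>; this is possible
  because the kernel and the cokernel of \<open>Q\<close> on \<open>range P\<close> have the same dimension.\<close>

lemma kernel_correction:
  assumes P: "P \<in> Ops" "P o\<^sub>L P = P" and gh: "g \<in> Ops" "h \<in> Ops" "g o\<^sub>L h = id_blinfun" "h o\<^sub>L g = id_blinfun"
    and comm: "P o\<^sub>L g \<simeq>\<^sub>K g o\<^sub>L P" "P o\<^sub>L h \<simeq>\<^sub>K h o\<^sub>L P"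
    and ind: "bindex (compression P h) = 0"
  defines "Q \<equiv> g o\<^sub>L P o\<^sub>L h"
  obtains J where "J \<in> Comp"
    "bij (blinfun_apply (compression P h + (P o\<^sub>L J o\<^sub>L (id_blinfun - Q) o\<^sub>L P)))"
proof -
  define A where "A = compression P h"
  define B where "B = compression P g"
  have "calkin_inverse h g" using gh by (simp add: calkin_inverse_def)
  then have AB: "calkin_inverse A B"
    unfolding A_def B_def by (intro calkin_inverse_compression P comm)
  note ab = AB[unfolded calkin_inverse_def]
  note PP = P(2)[THEN arg_cong[where f = blinfun_apply], unfolded fun_eq_iff blinfun_apply_blinfun_compose o_apply, THEN spec]
  have gh': "g (h x) = x" "h (g x) = x" for x
    using gh(3,4) by (metis blinfun_apply_blinfun_compose id_blinfun.rep_eq)+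
  have A: "A x = P (h (P x)) + (x - P x)" for x
    by (simp add: A_def compression_def blinfun.add_left blinfun.diff_left)
  have Q: "Q x = g (P (h x))" for x by (simp add: Q_def)
  have eA: "endo (blinfun_apply A)" using ab Ops_endo by blast
  obtain f0 where "parametrix (blinfun_apply A) f0" by (rule calkin_inverse_parametrix[OF AB])
  then obtain f where f: "parametrix (blinfun_apply A) f" "\<And>x. A (f (A x)) = A x"
    and ker: "{x. A x = 0} = range (\<lambda>x. x - f (A x))"
    and indA: "index (blinfun_apply A) = of_nat (dim {x. A x = 0}) - of_nat (dim (range (\<lambda>x. x - A (f x))))"
    by (rule generalized_inverse_parametrix) blast
  note fp = parametrixD[OF f(1)]
  note fr = endo_rules[OF fp(2)]
  \<comment> \<open>The vanishing index equates the dimension of the kernel of \<open>A\<close> with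
    that of the chosen complement of its range; \<open>k\<close> will map one isomorphically onto
    the other.\<close>
  have "dim (range (\<lambda>x. x - f (A x))) = dim (range (\<lambda>x. x - A (f x)))"
    using indA ind by (simp add: A_def[symmetric] ker)
  then obtain k where k: "endo k" "k ` range (\<lambda>x. x - f (A x)) = range (\<lambda>x. x - A (f x))"
    "inj_on k (range (\<lambda>x. x - f (A x)))"
    by (rule finite_rank_iso_exists[OF fp(3,4)])
  \<comment> \<open>\<open>k\<close> is merely linear. A bounded projection \<open>p\<close> whose
    finite-dimensional range contains the kernel of \<open>A\<close> allows it to be realised by an
    operator \<open>J\<close>.\<close>
  obtain p Bs where p: "p \<in> Comp" "finite Bs" "range (blinfun_apply p) = real_vector.span Bs"
    "\<And>x. p (p x) = p x" "\<And>x. (B o\<^sub>L A) x = 0 \<Longrightarrow> p x = x"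
    by (rule ceq_id_decomposition[of "B o\<^sub>L A"]) (use ab Ops_compose in blast)+
  have p_ker: "p x = x" if "A x = 0" for x using p(5)[of x] that by simp
  have "endo (\<lambda>x. k (x - f (A x)))"
    by (rule endo_compose[OF k(1) endo_diff_id[OF endo_compose[OF fp(2) eA]]])
  then obtain J where J: "J \<in> Ops" "\<And>x. blinfun_apply J x = k (p x - f (A (p x)))"
    by (rule bounded_extension_from_finite_span[OF _ p(2,3) Comp_Ops[OF p(1)]]) blast
  have Jp: "J o\<^sub>L p = J" by (rule blinfun_eqI) (simp add: J(2) p(4))
  have JC: "J \<in> Comp" using Comp_compose_left[OF J(1) p(1)] unfolding Jp .
  \<comment> \<open>The values of \<open>J\<close> lie in the complement of the range of
    \<open>A\<close>, on which \<open>A f\<close> vanishes.\<close>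
  have J_cok: "J x - A (f (J x)) = J x" for x
  proof -
    have "J x \<in> range (\<lambda>x. x - A (f x))" unfolding J(2) k(2)[symmetric] by blast
    then obtain z where "J x = z - A (f z)" by blast
    then show ?thesis by (simp add: fr blinfun.diff_right f(2))
  qed
  have J_ker: "J x = k x" if "A x = 0" for x
    using that p_ker[OF that] by (simp add: J(2) fr)
  \<comment> \<open>\<open>A\<close> is the identity on the kernel of \<open>P\<close>, so replacing
    \<open>J\<close> by \<open>P J\<close> changes values only by elements of the range of
    \<open>A\<close>.\<close>
  have notP: "z - P z = A (z - P z)" for z by (simp add: A blinfun.diff_right PP)
  define A' where "A' = A + (P o\<^sub>L J o\<^sub>L (id_blinfun - Q) o\<^sub>L P)"
  have A': "A' x = A x + P (J (P x - Q (P x)))" for x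
    by (simp add: A'_def blinfun.add_left blinfun.diff_left)
  have kerA: "P x = x" "Q x = 0" if "A x = 0" for x
  proof -
    have "P (A x) = P (h (P x))" by (simp add: A blinfun.add_right blinfun.diff_right PP)
    then have 1: "P (h (P x)) = 0" using that by simp
    then show "P x = x" using that by (simp add: A)
    with 1 show "Q x = 0" by (simp add: Q)
  qed
  \<comment> \<open>If \<open>A' x = 0\<close>, then \<open>J y\<close> lies both in the range of
    \<open>A\<close> and in its complement, so \<open>J y = 0\<close> and \<open>A x = 0\<close>. On
    the kernel of \<open>A\<close>, however, \<open>y = x\<close> and \<open>J\<close> is the
    injective \<open>k\<close>.\<close>
  have inj: "x = 0" if "A' x = 0" for x
  proof -
    define y where "y = P x - Q (P x)"
    have "A x + P (J y) = 0" using that by (simp add: A' y_def)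
    then have PJy: "P (J y) = - A x" by (simp add: eq_neg_iff_add_eq_0 add.commute)
    have "J y = (J y - P (J y)) + P (J y)" by simp
    also have "\<dots> = A (J y - P (J y)) - A x" by (simp only: notP[of "J y", symmetric]) (simp add: PJy)
    also have "\<dots> = A (J y - P (J y) - x)" by (simp only: blinfun.diff_right)
    finally obtain w where w: "J y = A w" by blast
    have "A (f (J y)) = J y" unfolding w by (rule f(2))
    then have Jy: "J y = 0" using J_cok[of y] by simp
    then have Ax: "A x = 0" using \<open>A x + P (J y) = 0\<close> by simp
    then have "y = x" using kerA[OF Ax] by (simp add: y_def)
    then have "k x = k 0" using Jy J_ker[OF Ax] endo_zero[OF k(1)] by simp
    moreover have "x \<in> {x. A x = 0}" "0 \<in> {x. A x = 0}" using Ax by auto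
    ultimately show "x = 0" using k(3) unfolding ker[symmetric] by (auto dest: inj_onD)
  qed
  have surj: "\<exists>x. A' x = z" for z
  proof -
    \<comment> \<open>\<open>c\<close> is the part of \<open>z\<close> missed by \<open>A\<close>,
      and \<open>c = k n\<close> for some \<open>n\<close> in the kernel of \<open>A\<close>.
      Subtracting \<open>n'\<close> cancels the value \<open>J w\<close> that the correction already
      takes at \<open>f z\<close>; the summand \<open>c - P c\<close> of \<open>u\<close> supplies
      the part of \<open>c\<close> that \<open>P\<close> discards.\<close>
    define c where "c = z - A (f z)"
    define w where "w = P (f z) - Q (P (f z))"
    define n' where "n' = p w - f (A (p w))"
    have "c \<in> k ` {x. A x = 0}" unfolding ker k(2) c_def by blast
    then obtain n where n: "c = k n" "A n = 0" by blast
    have n': "A n' = 0" by (simp add: n'_def blinfun.diff_right f(2))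
    have Jw: "J w = k n'" by (simp add: J(2) n'_def)
    define u where "u = f z + (c - P c)"
    define m where "m = n - n'"
    have m: "A m = 0" using n n' by (simp add: m_def blinfun.diff_right)
    have Jm: "J m = c - J w" using J_ker[OF m] n(1) Jw by (simp add: m_def endo_diff[OF k(1)])
    have Pu: "P u = P (f z)" by (simp add: u_def blinfun.add_right blinfun.diff_right PP)
    have "A' (u + m) = A u + P (J (w + m))"
      using m kerA[OF m]
      by (simp add: A' blinfun.add_right blinfun.diff_right Pu w_def algebra_simps)
    also have "J (w + m) = c" by (simp add: blinfun.add_right Jm)
    also have "A u = A (f z) + (c - P c)"
      by (simp add: u_def blinfun.add_right notP[of c, symmetric])
    also have "A (f z) + (c - P c) + P c = z" unfolding c_def by simp
    finally show ?thesis by (rule exI)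
  qed
  have "bij (blinfun_apply A')"
  proof (rule bijI)
    show "inj (blinfun_apply A')"
    proof (rule injI)
      fix x y assume "A' x = A' y"
      then have "x - y = 0" by (rule_tac inj) (simp add: blinfun.diff_right)
      then show "x = y" by simp
    qed
    show "surj (blinfun_apply A')" using surj by (simp add: surj_def) metis
  qed
  then show thesis unfolding A'_def A_def by (rule that[OF JC])
qed

text \<open>\<open>Q = g P h\<close> reaches \<open>P\<close> by three segments: to
  \<open>Q' = Q + M\<close>, which has the range of \<open>Q\<close>; to \<open>R\<close>, with the
  kernel of \<open>Q'\<close> and the range of \<open>P\<close>; and to \<open>P\<close>.
  Bijectivity of \<open>A\<close> says that \<open>Q'\<close> maps the range of \<open>P\<close>
  isomorphically onto the range of \<open>Q\<close>, and this makes \<open>R\<close> exist.\<close>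

theorem compact_fibre_connected:
  assumes P: "P \<in> Ops" "P o\<^sub>L P = P" and gh: "g \<in> Ops" "h \<in> Ops" "g o\<^sub>L h = id_blinfun" "h o\<^sub>L g = id_blinfun"
    and comm: "P o\<^sub>L g \<simeq>\<^sub>K g o\<^sub>L P" "P o\<^sub>L h \<simeq>\<^sub>K h o\<^sub>L P"
    and ind: "bindex (compression P h) = 0"
  shows "path_component (compact_fibre P) (g o\<^sub>L P o\<^sub>L h) P"
proof -
  define Q where "Q = g o\<^sub>L P o\<^sub>L h"
  obtain J where J: "J \<in> Comp"
    and bij: "bij (blinfun_apply (compression P h + (P o\<^sub>L J o\<^sub>L (id_blinfun - Q) o\<^sub>L P)))"
    unfolding Q_def by (rule kernel_correction[OF assms])
  define A where "A = compression P h + (P o\<^sub>L J o\<^sub>L (id_blinfun - Q) o\<^sub>L P)"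
  note JO = Comp_Ops[OF J]
  have QO: "Q \<in> Ops" unfolding Q_def by (intro Ops_compose gh P)
  have PP: "P (P x) = P x" for x using P(2) by (metis blinfun_apply_blinfun_compose)
  have gh': "g (h x) = x" "h (g x) = x" for x
    using gh(3,4) by (metis blinfun_apply_blinfun_compose id_blinfun.rep_eq)+
  have Q: "Q x = g (P (h x))" for x by (simp add: Q_def)
  have hQ: "h (Q x) = P (h x)" for x by (simp add: Q gh')
  have QQ: "Q (Q x) = Q x" for x by (simp add: Q gh' PP)
  define M where "M = g o\<^sub>L P o\<^sub>L J o\<^sub>L (id_blinfun - Q)"
  have MC: "M \<in> Comp"
    unfolding M_def
    by (rule Comp_compose_right[OF Ops_diff[OF Ops_id QO] Comp_compose_left[OF Ops_compose[OF gh(1) P(1)] J]])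
  have M: "M x = g (P (J (x - Q x)))" for x by (simp add: M_def blinfun.diff_left)
  have QM: "Q (M x) = M x" for x by (simp add: M Q gh' PP)
  have MQ: "M (Q x) = 0" for x by (simp add: M QQ)
  have MM: "M (M x) = 0" for x using MQ[of "M x"] QM[of x] by simp
  define Q' where "Q' = Q + M"
  have Q': "Q' x = Q x + M x" for x by (simp add: Q'_def blinfun.add_left)
  have Q'O: "Q' \<in> Ops" unfolding Q'_def by (intro Ops_add QO Comp_Ops MC)
  \<comment> \<open>On the range of \<open>P\<close> the operator \<open>A\<close> is
    \<open>h Q'\<close>, with values in that range; on the kernel of \<open>P\<close> it is the
    identity. Hence \<open>A\<close>, and with it the inverse \<open>W\<close>, commutes with
    \<open>P\<close>.\<close>
  have A: "A x = h (Q' (P x)) + (x - P x)" for x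
    by (simp add: A_def compression_def Q' hQ M gh' blinfun.add_left blinfun.diff_left blinfun.add_right)
  have QP: "Q \<simeq>\<^sub>K P"
  proof -
    have "Q \<simeq>\<^sub>K (P o\<^sub>L g) o\<^sub>L h" unfolding Q_def using gh by (intro ceq_right ceq_sym[OF comm(1)])
    also have "\<dots> = P" by (simp add: blinfun_compose_assoc gh)
    finally show ?thesis .
  qed
  have Q'P: "Q' \<simeq>\<^sub>K P"
    using Comp_add[OF QP[unfolded ceq_def] MC] by (simp add: ceq_def Q'_def algebra_simps)
  have AO: "A \<in> Ops" unfolding A_def by (intro Ops_intros compression_Ops P gh JO QO)
  have ci: "calkin_inverse (compression P h) (compression P g)"
    using gh comm by (intro calkin_inverse_compression P) (simp_all add: calkin_inverse_def)
  have "P o\<^sub>L J o\<^sub>L (id_blinfun - Q) o\<^sub>L P \<in> Comp"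
    by (rule Comp_compose_right[OF P(1) Comp_compose_right[OF Ops_diff[OF Ops_id QO]
        Comp_compose_left[OF P(1) J]]])
  then have "A \<simeq>\<^sub>K compression P h" by (simp add: ceq_def A_def)
  then have ciA: "calkin_inverse A (compression P g)" by (rule calkin_inverse_ceq[OF ci AO])
  note bijA = bij[folded A_def]
  have injA: "x = 0" if "A x = 0" for x
    by (rule injD[OF bij_is_inj[OF bijA]]) (simp add: that)
  obtain c where c: "0 < c" "\<And>x. c * norm x \<le> norm (A x)"
    by (rule calkin_inverse_bounded_below[OF ciA injA]) blast+
  obtain W where W: "\<And>x. blinfun_apply W (A x) = x" "\<And>x. A (blinfun_apply W x) = x"
    by (rule bounded_inverse[OF c bij_is_surj[OF bijA]]) blast
  have WO: "W \<in> Ops" by (rule Ops_inverse[OF AO W])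
  have PhQ': "P (h (Q' x)) = h (Q' x)" for x
    by (simp add: Q' hQ blinfun.add_right PP M gh')
  have PA: "P (A x) = h (Q' (P x))" for x
    by (simp add: A blinfun.add_right blinfun.diff_right PP PhQ')
  have AP: "A (P x) = h (Q' (P x))" for x by (simp add: A PP)
  have PW: "P (W x) = W (P x)" for x
    using PA[of "W x"] AP[of "W x"] W by metis
  \<comment> \<open>Apply \<open>Q'\<close>, carry the result into the range of \<open>P\<close> by
    \<open>h\<close>, and undo \<open>A\<close> there; on the range of \<open>P\<close> this is the
    identity because \<open>A = h Q'\<close>.\<close>
  define R where "R = W o\<^sub>L h o\<^sub>L Q'"
  have RO: "R \<in> Ops" unfolding R_def by (intro Ops_compose WO gh Q'O)
  have R: "R x = W (h (Q' x))" for x by (simp add: R_def)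
  have Q'Q': "Q' (Q' x) = Q' x" for x by (simp add: Q' blinfun.add_right QQ QM MQ MM)
  have RP: "R (P x) = P x" for x by (simp add: R W flip: AP)
  have PR: "P (R x) = R x" for x by (simp add: R PW PhQ')
  have RQ': "R (Q' x) = R x" for x by (simp add: R Q'Q')
  have Q'R: "Q' (R x) = Q' x" for x
  proof -
    have "h (Q' (R x)) = A (P (R x))" unfolding AP by (simp add: PR)
    also have "\<dots> = A (R x)" by (simp add: PR)
    also have "\<dots> = h (Q' x)" by (simp add: R W)
    finally show ?thesis using gh' by metis
  qed
  have RR: "R (R x) = R x" for x using RP[of "R x"] PR[of x] by simp
  \<comment> \<open>\<open>R Q' = R\<close> and \<open>R P = P\<close>, so compactness passes from
    \<open>Q' - P\<close> to \<open>R - P\<close>.\<close>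
  have "R - P = R o\<^sub>L (Q' - P)"
    by (rule blinfun_eqI) (simp add: blinfun.diff_left blinfun.diff_right RQ' RP)
  then have RcP: "R \<simeq>\<^sub>K P"
    using Comp_compose_left[OF RO Q'P[unfolded ceq_def]] by (simp add: ceq_def)
  have idem: "Q o\<^sub>L Q = Q" "Q' o\<^sub>L Q' = Q'" "R o\<^sub>L R = R"
    by (rule blinfun_eqI, simp add: QQ Q'Q' RR)+
  have mem: "P \<in> compact_fibre P" "Q \<in> compact_fibre P" "Q' \<in> compact_fibre P" "R \<in> compact_fibre P"
    using P QO Q'O RO QP Q'P RcP idem by (simp_all add: compact_fibre_def)
  have "Q o\<^sub>L Q' = Q'" "Q' o\<^sub>L Q = Q"
    by (rule blinfun_eqI, simp add: Q' QQ QM MQ blinfun.add_right)+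
  then have 1: "path_component (compact_fibre P) Q Q'"
    using path_component_compact_fibre[OF mem(2,3)] by simp
  have "Q' o\<^sub>L R = Q'" "R o\<^sub>L Q' = R"
    by (rule blinfun_eqI, simp add: Q'R RQ')+
  then have 2: "path_component (compact_fibre P) Q' R"
    using path_component_compact_fibre[OF mem(3,4)] by simp
  have "R o\<^sub>L P = P" "P o\<^sub>L R = R"
    by (rule blinfun_eqI, simp add: RP PR)+
  then have 3: "path_component (compact_fibre P) R P"
    using path_component_compact_fibre[OF mem(4,1)] by simp
  show ?thesis
    using path_component_trans[OF path_component_trans[OF 1 2] 3] by (simp add: Q_def)
qed

section \<open>Lifting paths of idempotents by conjugation\<close>

text \<open>The inverse path is carried along as data, together with its continuity.\<close>

definition inverse_paths :: "(real \<Rightarrow> 'a \<Rightarrow>\<^sub>L 'a) \<Rightarrow> (real \<Rightarrow> 'a \<Rightarrow>\<^sub>L 'a) \<Rightarrow> bool" where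
  "inverse_paths g h \<longleftrightarrow> continuous_on {0..1} g \<and> continuous_on {0..1} h \<and> g 0 = id_blinfun \<and>
     (\<forall>t\<in>{0..1}. g t \<in> Ops \<and> h t \<in> Ops \<and> g t o\<^sub>L h t = id_blinfun \<and> h t o\<^sub>L g t = id_blinfun)"

lemma inverse_pathsD:
  assumes "inverse_paths g h"
  shows "continuous_on {0..1} g" "continuous_on {0..1} h" "g 0 = id_blinfun" "h 0 = id_blinfun"
    and "\<And>t. t \<in> {0..1} \<Longrightarrow> g t \<in> Ops" "\<And>t. t \<in> {0..1} \<Longrightarrow> h t \<in> Ops"
    and "\<And>t. t \<in> {0..1} \<Longrightarrow> g t o\<^sub>L h t = id_blinfun" "\<And>t. t \<in> {0..1} \<Longrightarrow> h t o\<^sub>L g t = id_blinfun"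
proof -
  show "continuous_on {0..1} g" "continuous_on {0..1} h" and g0: "g 0 = id_blinfun"
    "\<And>t. t \<in> {0..1} \<Longrightarrow> g t \<in> Ops" "\<And>t. t \<in> {0..1} \<Longrightarrow> h t \<in> Ops"
    "\<And>t. t \<in> {0..1} \<Longrightarrow> g t o\<^sub>L h t = id_blinfun"
    and hg: "\<And>t. t \<in> {0..1} \<Longrightarrow> h t o\<^sub>L g t = id_blinfun"
    using assms unfolding inverse_paths_def by blast+
  show "h 0 = id_blinfun" using hg[of 0] g0 by simp
qed

end

text \<open>Used for the compact operators and, to lift paths of projections exactly, for the zero ideal.\<close>

locale operator_ideal = banach_space_over smul
  for smul :: "'k::real_normed_field \<Rightarrow> 'a::banach \<Rightarrow> 'a" +
  fixes I :: "('a \<Rightarrow>\<^sub>L 'a) set"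
  assumes sub: "Real_Vector_Spaces.subspace I"
    and left: "A \<in> Ops \<Longrightarrow> T \<in> I \<Longrightarrow> A o\<^sub>L T \<in> I"
    and right: "A \<in> Ops \<Longrightarrow> T \<in> I \<Longrightarrow> T o\<^sub>L A \<in> I"
begin

lemmas I_add = real_vector.subspace_add[OF sub] and I_diff = real_vector.subspace_diff[OF sub]
  and I_zero = real_vector.subspace_0[OF sub] and I_scaleR = real_vector.subspace_scale[OF sub]
  and I_minus = real_vector.subspace_neg[OF sub]

definition conj_lift :: "('a \<Rightarrow>\<^sub>L 'a) \<Rightarrow> (real \<Rightarrow> 'a \<Rightarrow>\<^sub>L 'a) \<Rightarrow> (real \<Rightarrow> 'a \<Rightarrow>\<^sub>L 'a) \<Rightarrow> (real \<Rightarrow> 'a \<Rightarrow>\<^sub>L 'a) \<Rightarrow> bool" where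
  "conj_lift P A g h \<longleftrightarrow> inverse_paths g h \<and> (\<forall>t\<in>{0..1}. A t - (g t o\<^sub>L P o\<^sub>L h t) \<in> I)"

text \<open>\<open>id + (B - A) (2 A - id)\<close> is congruent to \<open>B A + (id - B) (id - A)\<close>, hence intertwines
  \<open>A\<close> and \<open>B\<close>.\<close>

lemma intertwining_mod_ideal:
  assumes "A \<in> Ops" "B \<in> Ops" "(A o\<^sub>L A) - A \<in> I" "(B o\<^sub>L B) - B \<in> I"
    and a: "a - (id_blinfun + ((B - A) o\<^sub>L (2 *\<^sub>R A - id_blinfun))) \<in> I"
  shows "(B o\<^sub>L a) - (a o\<^sub>L A) \<in> I"
proof -
  define e where "e = (A o\<^sub>L A) - A"
  define f where "f = (B o\<^sub>L B) - B"
  define a0 where "a0 = id_blinfun + ((B - A) o\<^sub>L (2 *\<^sub>R A - id_blinfun))"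
  define d where "d = a - a0"
  have e: "A (A x) = A x + e x" and f: "B (B x) = B x + f x" for x
    by (simp_all add: e_def f_def blinfun.diff_left)
  have ad: "a = a0 + d" by (simp add: d_def)
  \<comment> \<open>\<open>d\<close> is the deviation of \<open>a\<close> from the model
    \<open>a0\<close>, while \<open>e\<close> and \<open>f\<close> measure the failure of
    \<open>A\<close> and \<open>B\<close> to be idempotent. Every summand on the right contains one
    of these three elements of \<open>I\<close>.\<close>
  have "(B o\<^sub>L a) - (a o\<^sub>L A) =
     (B o\<^sub>L d) - (d o\<^sub>L A) + (f o\<^sub>L (2 *\<^sub>R A - id_blinfun)) - ((4 *\<^sub>R B - 2 *\<^sub>R A - id_blinfun) o\<^sub>L e)"
  proof (rule blinfun_eqI)
    fix x
    have 1: "A (A (A x)) = A x + e x + A (e x)" by (simp add: e blinfun.add_right)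
    have 2: "B (A (A x)) = B (A x) + B (e x)" by (simp add: e blinfun.add_right)
    have two: "2 *\<^sub>R v = v + v" for v :: 'a by (rule scaleR_2)
    have 4: "4 *\<^sub>R v = v + v + (v + v)" for v :: 'a
      by (simp flip: two scaleR_add_left)
    show "((B o\<^sub>L a) - (a o\<^sub>L A)) x =
       ((B o\<^sub>L d) - (d o\<^sub>L A) + (f o\<^sub>L (2 *\<^sub>R A - id_blinfun)) - ((4 *\<^sub>R B - 2 *\<^sub>R A - id_blinfun) o\<^sub>L e)) x"
      by (simp add: ad a0_def blinfun.add_left blinfun.diff_left blinfun.add_right blinfun.diff_right
          blinfun.scaleR_left blinfun.scaleR_right e f 1 2 two 4 algebra_simps)
  qed
  moreover have "d \<in> I" "e \<in> I" "f \<in> I" using assms by (simp_all add: d_def a0_def e_def f_def)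
  ultimately show ?thesis
    using assms(1,2) by (simp add: I_add I_diff left right Ops_intros)
qed

text \<open>The new lift is \<open>a g\<close> with inverse \<open>h b\<close>, where
  \<open>b\<close> is inverse to \<open>a = 1 + c\<close>. Subtracting from \<open>c0\<close> a
  linear interpolation of elements of \<open>I\<close> keeps the congruence and makes
  \<open>a 0\<close> the identity, as well as \<open>a 1\<close> when the right ends agree modulo
  \<open>I\<close>.\<close>

lemma conj_lift_step:
  assumes A: "continuous_on {0..1} A" "\<And>t. t \<in> {0..1} \<Longrightarrow> A t \<in> Ops" "\<And>t. t \<in> {0..1} \<Longrightarrow> (A t o\<^sub>L A t) - A t \<in> I"
    and B: "continuous_on {0..1} B" "\<And>t. t \<in> {0..1} \<Longrightarrow> B t \<in> Ops" "\<And>t. t \<in> {0..1} \<Longrightarrow> (B t o\<^sub>L B t) - B t \<in> I"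
    and BA0: "B 0 - A 0 \<in> I"
    and small: "\<And>t. t \<in> {0..1} \<Longrightarrow> norm ((B t - A t) o\<^sub>L (2 *\<^sub>R A t - id_blinfun)) \<le> 1/6"
    and lift: "conj_lift P A g h" and P: "P \<in> Ops"
  obtains g' h' where "conj_lift P B g' h'" "B 1 - A 1 \<in> I \<Longrightarrow> g' 1 = g 1"
proof -
  note gh = lift[unfolded conj_lift_def, THEN conjunct1]
  note ip = inverse_pathsD[OF gh]
  define c0 where "c0 t = (B t - A t) o\<^sub>L (2 *\<^sub>R A t - id_blinfun)" for t
  \<comment> \<open>\<open>c0 1\<close> is known to lie in \<open>I\<close> only if the right ends
    agree modulo \<open>I\<close>; otherwise nothing may be subtracted there.\<close>
  define e1 where "e1 = (if B 1 - A 1 \<in> I then c0 1 else 0)"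
  define c where "c t = c0 t - (1 - t) *\<^sub>R c0 0 - t *\<^sub>R e1" for t
  have c0O: "c0 t \<in> Ops" if "t \<in> {0..1}" for t
    unfolding c0_def using that by (intro Ops_intros A B)
  have c0I: "c0 0 \<in> I" "e1 \<in> I"
    using A(2) BA0 by (auto simp: c0_def e1_def I_zero intro!: right Ops_intros)
  have e1O: "e1 \<in> Ops" using c0O[of 1] by (simp add: e1_def Ops_zero)
  have cO: "c t \<in> Ops" if "t \<in> {0..1}" for t
    unfolding c_def using that by (intro Ops_intros c0O e1O) auto
  have e1n: "norm e1 \<le> 1/6" using small[of 1] by (simp add: e1_def c0_def)
  \<comment> \<open>Three summands of norm at most 1/6 give 1/2, so the Neumann inverses below have
    norm at most 2.\<close>
  have cn: "norm (c t) \<le> 1/2" if t: "t \<in> {0..1}" for t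
  proof -
    have "norm (c t) \<le> norm (c0 t) + norm ((1 - t) *\<^sub>R c0 0) + norm (t *\<^sub>R e1)"
      unfolding c_def by (intro order.trans[OF norm_triangle_ineq4] add_mono norm_triangle_ineq4 order_refl)
    moreover have "norm (c0 t) \<le> 1/6" using small[OF t] by (simp add: c0_def)
    moreover have "norm (c0 0) \<le> 1/6" using small[of 0] by (simp add: c0_def)
    then have "\<bar>1 - t\<bar> * norm (c0 0) \<le> 1 * (1/6)" using t by (intro mult_mono) auto
    moreover have "\<bar>t\<bar> * norm e1 \<le> 1 * (1/6)" using t e1n by (intro mult_mono) auto
    ultimately show ?thesis by simp
  qed
  have cc: "continuous_on {0..1} c"
    unfolding c_def c0_def by (intro continuous_intros A B)
  define a where "a t = id_blinfun + c t" for t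
  have aO: "a t \<in> Ops" if "t \<in> {0..1}" for t unfolding a_def by (intro Ops_intros cO that)
  have ca: "continuous_on {0..1} a" unfolding a_def by (intro continuous_intros cc)
  have "\<exists>b. a t o\<^sub>L b = id_blinfun \<and> b o\<^sub>L a t = id_blinfun \<and> norm b \<le> 2" if t: "t \<in> {0..1}" for t
  proof -
    obtain D where "(id_blinfun + c t) o\<^sub>L D = id_blinfun" "D o\<^sub>L (id_blinfun + c t) = id_blinfun"
      "norm D \<le> 1 / (1 - norm (c t))"
      by (rule neumann_inverse[of "c t"]) (use cn[OF t] in auto)
    moreover have "1 / (1 - norm (c t)) \<le> 2" using cn[OF t] by (simp add: field_simps)
    ultimately show ?thesis unfolding a_def by (intro exI[of _ D]) auto
  qed
  then obtain b where b: "\<And>t. t \<in> {0..1} \<Longrightarrow> a t o\<^sub>L b t = id_blinfun"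
    "\<And>t. t \<in> {0..1} \<Longrightarrow> b t o\<^sub>L a t = id_blinfun" "\<And>t. t \<in> {0..1} \<Longrightarrow> norm (b t) \<le> 2" by metis
  have bO: "b t \<in> Ops" if t: "t \<in> {0..1}" for t
  proof (rule Ops_inverse[OF aO[OF t]])
    show "b t (a t x) = x" "a t (b t x) = x" for x
      using b(1,2)[OF t] by (metis blinfun_apply_blinfun_compose id_blinfun.rep_eq)+
  qed
  have cb: "continuous_on {0..1} b"
    unfolding continuous_on_def
  proof
    fix t :: real assume t: "t \<in> {0..1}"
    have "((\<lambda>s. 4 * norm (a t - a s)) \<longlongrightarrow> 4 * norm (a t - a t)) (at t within {0..1})"
      using ca t unfolding continuous_on_def by (intro tendsto_intros) auto
    then have lim: "((\<lambda>s. 4 * norm (a t - a s)) \<longlongrightarrow> 0) (at t within {0..1})" by simp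
    have "\<forall>\<^sub>F s in at t within {0..1}. norm (b s - b t) \<le> 4 * norm (a t - a s)"
      unfolding eventually_at_filter
    proof (intro always_eventually allI impI)
      fix s :: real assume s: "s \<in> {0..1}"
      \<comment> \<open>The resolvent identity; the bound 2 on both inverses yields the Lipschitz
        factor 4.\<close>
      have "b s - b t = b s o\<^sub>L ((a t - a s) o\<^sub>L b t)"
      proof -
        have "b s o\<^sub>L (a s o\<^sub>L b t) = b t"
          by (simp only: blinfun_compose_assoc[symmetric] b(2)[OF s] id_compose_blinfun)
        then show ?thesis
          by (simp only: blinfun_compose_distrib b(1)[OF t] id_compose_blinfun)
      qed
      then have "norm (b s - b t) \<le> norm (b s) * (norm (a t - a s) * norm (b t))"
        by (simp add: order.trans[OF norm_blinfun_compose mult_left_mono[OF norm_blinfun_compose]])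
      also have "\<dots> \<le> 2 * (norm (a t - a s) * 2)"
        using b(3)[OF s] b(3)[OF t] by (intro mult_mono) auto
      finally show "norm (b s - b t) \<le> 4 * norm (a t - a s)" by simp
    qed
    from Lim_null_comparison[OF this lim] show "(b \<longlongrightarrow> b t) (at t within {0..1})"
      by (rule LIM_zero_cancel)
  qed
  have c_0: "c 0 = 0" and c_1: "B 1 - A 1 \<in> I \<Longrightarrow> c 1 = 0" by (simp_all add: c_def e1_def)
  show thesis
  proof
    show "conj_lift P B (\<lambda>t. a t o\<^sub>L g t) (\<lambda>t. h t o\<^sub>L b t)"
      unfolding conj_lift_def inverse_paths_def
    proof (intro conjI ballI)
      show "continuous_on {0..1} (\<lambda>t. a t o\<^sub>L g t)" "continuous_on {0..1} (\<lambda>t. h t o\<^sub>L b t)"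
        by (intro continuous_intros ca cb ip)+
      show "a 0 o\<^sub>L g 0 = id_blinfun" by (simp add: a_def c_0 ip)
      fix t :: real assume t: "t \<in> {0..1}"
      show "a t o\<^sub>L g t \<in> Ops" by (rule Ops_compose[OF aO[OF t] ip(5)[OF t]])
      show "h t o\<^sub>L b t \<in> Ops" by (rule Ops_compose[OF ip(6)[OF t] bO[OF t]])
      have "(a t o\<^sub>L g t) o\<^sub>L (h t o\<^sub>L b t) = a t o\<^sub>L ((g t o\<^sub>L h t) o\<^sub>L b t)" by (simp add: blinfun_compose_assoc)
      then show "(a t o\<^sub>L g t) o\<^sub>L (h t o\<^sub>L b t) = id_blinfun" using t by (simp add: ip b)
      have "(h t o\<^sub>L b t) o\<^sub>L (a t o\<^sub>L g t) = h t o\<^sub>L ((b t o\<^sub>L a t) o\<^sub>L g t)" by (simp add: blinfun_compose_assoc)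
      then show "(h t o\<^sub>L b t) o\<^sub>L (a t o\<^sub>L g t) = id_blinfun" using t by (simp add: ip b)
      define X where "X = g t o\<^sub>L P o\<^sub>L h t"
      have XO: "X \<in> Ops" unfolding X_def using t by (intro Ops_compose ip P)
      have AX: "A t - X \<in> I" using lift t by (simp add: conj_lift_def X_def)
      have "a t - (id_blinfun + c0 t) = - ((1 - t) *\<^sub>R c0 0 + t *\<^sub>R e1)"
        by (simp add: a_def c_def)
      then have "a t - (id_blinfun + c0 t) \<in> I" by (simp only:) (intro I_minus I_add I_scaleR c0I)
      then have "(B t o\<^sub>L a t) - (a t o\<^sub>L A t) \<in> I"
        using t by (intro intertwining_mod_ideal A B) (simp_all add: c0_def)
      then have 1: "((B t o\<^sub>L a t) - (a t o\<^sub>L A t)) o\<^sub>L b t \<in> I" by (intro right bO t)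
      have 2: "(a t o\<^sub>L (A t - X)) o\<^sub>L b t \<in> I" by (intro right left bO aO t AX)
      have "B t - (a t o\<^sub>L X o\<^sub>L b t) =
         (((B t o\<^sub>L a t) - (a t o\<^sub>L A t)) o\<^sub>L b t) + ((a t o\<^sub>L (A t - X)) o\<^sub>L b t)"
        using t by (simp add: blinfun_compose_distrib blinfun_compose_assoc b)
      then have "B t - (a t o\<^sub>L X o\<^sub>L b t) \<in> I" using I_add[OF 1 2] by simp
      then show "B t - (a t o\<^sub>L g t o\<^sub>L P o\<^sub>L (h t o\<^sub>L b t)) \<in> I"
        by (simp add: X_def blinfun_compose_assoc)
    qed
    show "a 1 o\<^sub>L g 1 = g 1" if "B 1 - A 1 \<in> I" using c_1[OF that] by (simp add: a_def)
  qed
qed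

text \<open>Uniform continuity cuts the homotopy into \<open>n\<close> steps short enough for
  \<open>conj_lift_step\<close>; each of them preserves \<open>g 1\<close> if the right edge is
  constant modulo \<open>I\<close>.\<close>

theorem homotopy_conj_lift:
  fixes H :: "real \<times> real \<Rightarrow> 'a \<Rightarrow>\<^sub>L 'a"
  assumes H: "continuous_on ({0..1} \<times> {0..1}) H"
    and HO: "\<And>s t. s \<in> {0..1} \<Longrightarrow> t \<in> {0..1} \<Longrightarrow> H (s, t) \<in> Ops"
    and HI: "\<And>s t. s \<in> {0..1} \<Longrightarrow> t \<in> {0..1} \<Longrightarrow> (H (s, t) o\<^sub>L H (s, t)) - H (s, t) \<in> I"
    and H0: "\<And>s. s \<in> {0..1} \<Longrightarrow> H (s, 0) - P \<in> I" and P: "P \<in> Ops"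
    and lift: "conj_lift P (\<lambda>t. H (0, t)) g h"
  obtains g' h' where "conj_lift P (\<lambda>t. H (1, t)) g' h'"
    "(\<And>s. s \<in> {0..1} \<Longrightarrow> H (s, 1) - H (0, 1) \<in> I) \<Longrightarrow> g' 1 = g 1"
proof -
  let ?Q = "{0..1::real} \<times> {0..1::real}"
  have cQ: "compact ?Q" by (intro compact_Times) auto
  have "bounded ((\<lambda>z. 2 *\<^sub>R H z - id_blinfun) ` ?Q)"
    by (intro compact_imp_bounded compact_continuous_image continuous_intros H cQ)
  then obtain M where M: "0 < M" "\<And>z. z \<in> ?Q \<Longrightarrow> norm (2 *\<^sub>R H z - id_blinfun) \<le> M"
    unfolding bounded_pos by auto
  have "uniformly_continuous_on ?Q H" by (rule compact_uniformly_continuous[OF H cQ])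
  \<comment> \<open>\<open>M\<close> bounds the factor \<open>2 H - id\<close>, so a distance below
    \<open>1 / (6 * M)\<close> gives the product bound 1/6.\<close>
  then obtain d where d: "0 < d" "\<And>z z'. z \<in> ?Q \<Longrightarrow> z' \<in> ?Q \<Longrightarrow> dist z' z < d \<Longrightarrow> dist (H z') (H z) < 1 / (6 * M)"
    unfolding uniformly_continuous_on_def using M(1) by (metis divide_pos_pos mult_pos_pos zero_less_numeral zero_less_one)
  obtain n where n: "n > 0" "inverse (real n) < d"
    using d(1) by (metis ex_inverse_of_nat_less)
  have "\<exists>g' h'. conj_lift P (\<lambda>t. H (real k / real n, t)) g' h' \<and>
     ((\<forall>s\<in>{0..1}. H (s, 1) - H (0, 1) \<in> I) \<longrightarrow> g' 1 = g 1)" if "k \<le> n" for k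
    using that
  proof (induction k)
    case 0 then show ?case using lift by auto
  next
    case (Suc k)
    then obtain g' h' where gh': "conj_lift P (\<lambda>t. H (real k / real n, t)) g' h'"
      "(\<forall>s\<in>{0..1}. H (s, 1) - H (0, 1) \<in> I) \<longrightarrow> g' 1 = g 1" by auto
    define s where "s = real k / real n"
    define s' where "s' = real (Suc k) / real n"
    have s: "s \<in> {0..1}" "s' \<in> {0..1}" using Suc.prems n by (auto simp: s_def s'_def field_simps)
    have ss: "\<bar>s' - s\<bar> < d" using n by (simp add: s_def s'_def field_simps)
    have cont: "continuous_on {0..1} (\<lambda>t. H (r, t))" if "r \<in> {0..1}" for r
      by (rule continuous_on_compose2[OF H]) (use that in \<open>auto intro!: continuous_intros\<close>)
    have small: "norm ((H (s', t) - H (s, t)) o\<^sub>L (2 *\<^sub>R H (s, t) - id_blinfun)) \<le> 1/6"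
      if t: "t \<in> {0..1}" for t
    proof -
      have "dist (H (s', t)) (H (s, t)) < 1 / (6 * M)"
        using s t ss by (intro d(2)) (auto simp: dist_Pair_Pair dist_real_def)
      then have "norm (H (s', t) - H (s, t)) * norm (2 *\<^sub>R H (s, t) - id_blinfun) \<le> 1 / (6 * M) * M"
        using M s t by (intro mult_mono) (auto simp: dist_norm)
      also have "\<dots> = 1/6" using M(1) by simp
      finally show ?thesis using norm_blinfun_compose order.trans by blast
    qed
    have "H (s', 0) - H (s, 0) \<in> I"
      using I_diff[OF H0[OF s(2)] H0[OF s(1)]] by simp
    then obtain g'' h'' where gh'': "conj_lift P (\<lambda>t. H (s', t)) g'' h''"
      "H (s', 1) - H (s, 1) \<in> I \<Longrightarrow> g'' 1 = g' 1"
      using conj_lift_step[of "\<lambda>t. H (s, t)" "\<lambda>t. H (s', t)" P g' h'] cont s HO HI small gh'(1) P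
      unfolding s_def[symmetric] by blast
    have "g'' 1 = g 1" if "\<forall>s\<in>{0..1}. H (s, 1) - H (0, 1) \<in> I"
    proof -
      have "H (s', 1) - H (s, 1) \<in> I"
        using I_diff[OF that[rule_format, OF s(2)] that[rule_format, OF s(1)]] by simp
      then show ?thesis using gh''(2) gh'(2) that by auto
    qed
    then show ?case using gh''(1) unfolding s'_def by blast
  qed
  from this[of n] n obtain g' h' where "conj_lift P (\<lambda>t. H (1, t)) g' h'"
    "(\<forall>s\<in>{0..1}. H (s, 1) - H (0, 1) \<in> I) \<longrightarrow> g' 1 = g 1" by auto
  then show thesis by (intro that[of g' h']) blast+
qed

text \<open>Contract the path to its starting point: \<open>A (s * t)\<close> is a homotopy from the
  constant path at \<open>A 0\<close>, for which the constant identity is a lift.\<close>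

corollary path_conj_lift:
  assumes A: "continuous_on {0..1} A" "\<And>t. t \<in> {0..1} \<Longrightarrow> A t \<in> Ops" "\<And>t. t \<in> {0..1} \<Longrightarrow> (A t o\<^sub>L A t) - A t \<in> I"
    and A0: "A 0 - P \<in> I" and P: "P \<in> Ops"
  obtains g h where "conj_lift P A g h"
proof -
  define H where "H = (\<lambda>(s, t). A (s * t))"
  have st: "s * t \<in> {0..1}" if "s \<in> {0..1}" "t \<in> {0..1}" for s t :: real
    using that by (auto intro: mult_le_one)
  have cont: "continuous_on ({0..1} \<times> {0..1}) H"
    unfolding H_def case_prod_unfold
    by (rule continuous_on_compose2[OF A(1)]) (auto intro!: continuous_intros mult_le_one)
  have "conj_lift P (\<lambda>t. H (0, t)) (\<lambda>_. id_blinfun) (\<lambda>_. id_blinfun)"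
    using A0 by (simp add: conj_lift_def inverse_paths_def H_def Ops_id)
  then obtain g h where "conj_lift P (\<lambda>t. H (1, t)) g h"
  proof (rule homotopy_conj_lift[OF cont _ _ _ P, rotated 3])
    show "H (s, t) \<in> Ops" "(H (s, t) o\<^sub>L H (s, t)) - H (s, t) \<in> I" if "s \<in> {0..1}" "t \<in> {0..1}" for s t
      using A(2,3)[OF st[OF that]] by (simp_all add: H_def)
    show "H (s, 0) - P \<in> I" if "s \<in> {0..1}" for s using A0 by (simp add: H_def)
  qed blast
  then show thesis using that by (simp add: H_def)
qed

end

section \<open>The index homomorphism\<close>

context banach_space_over
begin

lemma continuous_map_proj:
  "continuous_map (projector_space smul) (calkin_projector_space smul) proj"
proof -
  interpret O: Metric_space Ops "ring_dist (op_algebra smul) norm" by (rule Metric_space_Ops)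
  interpret C: Metric_space "carrier (calkin smul)" "ring_dist (calkin smul) quotient_norm"
    by (rule Metric_space_calkin)
  let ?I = "idempotents (op_algebra smul)"
  have top: "topspace (projector_space smul) = ?I"
    by (auto simp: projector_space_def idempotent_space_def O.topspace_mtopology idempotents_Ops)
  have "continuous_map (projector_space smul) C.mtopology proj"
    unfolding C.continuous_map_to_metric top
  proof (intro ballI allI impI)
    fix T and e :: real assume T: "T \<in> ?I" and e: "0 < e"
    let ?U = "?I \<inter> O.mball T e"
    have "T \<in> Ops" using T by (simp add: idempotents_Ops)
    show "\<exists>U. openin (projector_space smul) U \<and> T \<in> U \<and> (\<forall>S\<in>U. proj S \<in> C.mball (proj T) e)"
    proof (intro exI[of _ ?U] conjI ballI)
      show "openin (projector_space smul) ?U"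
        unfolding projector_space_def idempotent_space_def openin_subtopology
        using O.openin_mball by blast
      show "T \<in> ?U" using T \<open>T \<in> Ops\<close> e by simp
      fix S assume "S \<in> ?U"
      then have S: "S \<in> Ops" "dist T S < e" using \<open>T \<in> Ops\<close> by (auto simp: ring_dist_Ops)
      have "infdist (T - S) Comp \<le> dist T S"
        using infdist_subspace_le_norm[OF subspace_Comp] by (simp add: dist_norm)
      moreover have "proj S \<in> carrier (calkin smul)" "proj T \<in> carrier (calkin smul)"
        using S \<open>T \<in> Ops\<close> by (auto simp: carrier_calkin)
      ultimately show "proj S \<in> C.mball (proj T) e"
        using S \<open>T \<in> Ops\<close> by (simp add: ring_dist_calkin)
    qed
  qed
  moreover have "proj T \<in> idempotents (calkin smul)" if "T \<in> ?I" for T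
    using that idempotents_calkin[of T] Comp_zero by (simp add: idempotents_Ops)
  ultimately show ?thesis
    unfolding calkin_projector_space_def idempotent_space_def continuous_map_in_subtopology top
    by (auto simp: idempotent_space_def projector_space_def)
qed

lemma topspace_projector_space: "P \<in> topspace (projector_space smul) \<longleftrightarrow> P \<in> Ops \<and> P o\<^sub>L P = P"
proof -
  interpret O: Metric_space Ops "ring_dist (op_algebra smul) norm" by (rule Metric_space_Ops)
  show ?thesis
    by (auto simp: projector_space_def idempotent_space_def O.topspace_mtopology idempotents_Ops)
qed

lemma loops_projector_space:
  "f \<in> loops (projector_space smul) P \<longleftrightarrow>
    continuous_on {0..1} f \<and> (\<forall>t\<in>{0..1}. f t \<in> Ops \<and> f t o\<^sub>L f t = f t) \<and> f 0 = P \<and> f 1 = P"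
  by (auto simp: loops_def pathin_def continuous_map_projector_space)

end

sublocale banach_space_over \<subseteq> Comp: operator_ideal smul "compact_ops smul"
  by unfold_locales (rule subspace_Comp Comp_compose_left Comp_compose_right; assumption)+

context banach_space_over
begin

section \<open>Lifts of loops in the Calkin algebra and their index\<close>

definition calkin_lift ::
    "('a \<Rightarrow>\<^sub>L 'a) \<Rightarrow> (real \<Rightarrow> ('a \<Rightarrow>\<^sub>L 'a) set) \<Rightarrow> (real \<Rightarrow> 'a \<Rightarrow>\<^sub>L 'a) \<Rightarrow> (real \<Rightarrow> 'a \<Rightarrow>\<^sub>L 'a) \<Rightarrow> bool" where
  "calkin_lift P \<alpha> g h \<longleftrightarrow> inverse_paths g h \<and> (\<forall>t\<in>{0..1}. \<alpha> t = proj (g t o\<^sub>L P o\<^sub>L h t))"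

lemma calkin_lift_iff:
  assumes "\<And>t. t \<in> {0..1} \<Longrightarrow> \<alpha> t = proj (A t)"
  shows "calkin_lift P \<alpha> g h \<longleftrightarrow> Comp.conj_lift P A g h"
  using assms by (auto simp: calkin_lift_def Comp.conj_lift_def proj_eq_iff)

lemma calkin_lift_exists:
  assumes P: "P \<in> Ops" and \<alpha>: "\<alpha> \<in> loops (calkin_projector_space smul) (proj P)"
  obtains g h where "calkin_lift P \<alpha> g h"
proof -
  have "continuous_map (top_of_set {0..1}) (calkin_projector_space smul) \<alpha>" and \<alpha>0: "\<alpha> 0 = proj P"
    using \<alpha> by (simp_all add: loops_def pathin_def)
  then obtain A where A: "continuous_on {0..1} A" "\<And>t. t \<in> {0..1} \<Longrightarrow> A t \<in> Ops"
    "\<And>t. t \<in> {0..1} \<Longrightarrow> (A t o\<^sub>L A t) - A t \<in> Comp" "\<And>t. t \<in> {0..1} \<Longrightarrow> \<alpha> t = proj (A t)"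
    by (subst (asm) continuous_map_calkin_projector_space) auto
  have A0: "A 0 - P \<in> Comp" using A(4)[of 0] \<alpha>0 by (simp flip: proj_eq_iff)
  obtain g h where "Comp.conj_lift P A g h"
    by (rule Comp.path_conj_lift[OF A(1-3) A0 P])
  then show thesis by (intro that[of g h]) (simp only: calkin_lift_iff[where \<alpha> = \<alpha> and A = A, OF A(4)])
qed

text \<open>Along its right edge the homotopy is constant modulo compact operators, the condition
  under which \<open>homotopy_conj_lift\<close> preserves \<open>g 1\<close>.\<close>

lemma calkin_lift_homotopic:
  assumes P: "P \<in> Ops" and \<alpha>\<beta>: "(\<alpha>, \<beta>) \<in> loop_homotopy (calkin_projector_space smul) (proj P)"
    and lift: "calkin_lift P \<alpha> g h"
  obtains g' h' where "calkin_lift P \<beta> g' h'" "g' 1 = g 1"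
proof -
  obtain F :: "real \<times> real \<Rightarrow> ('a \<Rightarrow>\<^sub>L 'a) set" where
    F: "continuous_map (top_of_set ({0..1} \<times> {0..1})) (calkin_projector_space smul) F"
    and F': "\<And>t. t \<in> {0..1} \<Longrightarrow> F (0, t) = \<alpha> t \<and> F (1, t) = \<beta> t"
      "\<And>s. s \<in> {0..1} \<Longrightarrow> F (s, 0) = proj P \<and> F (s, 1) = proj P"
    using \<alpha>\<beta> unfolding loop_homotopy_iff by blast
  have "compact ({0..1::real} \<times> {0..1::real})" by (intro compact_Times) auto
  from F[unfolded continuous_map_calkin_projector_space[OF this]]
  obtain H where H: "continuous_on ({0..1} \<times> {0..1}) H"
    and H': "\<And>z. z \<in> {0..1} \<times> {0..1} \<Longrightarrow> H z \<in> Ops \<and> (H z o\<^sub>L H z) - H z \<in> Comp \<and> F z = proj (H z)"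
    by blast
  have HO: "H (s, t) \<in> Ops" and HI: "(H (s, t) o\<^sub>L H (s, t)) - H (s, t) \<in> Comp"
    and HF: "F (s, t) = proj (H (s, t))" if "s \<in> {0..1}" "t \<in> {0..1}" for s t
    using H'[of "(s, t)"] that by auto
  have H0: "H (s, 0) - P \<in> Comp" and H1: "H (s, 1) - P \<in> Comp" if "s \<in> {0..1}" for s
    using HF[OF that, of 0] HF[OF that, of 1] F'(2)[OF that] by (simp_all flip: proj_eq_iff)
  have l0: "Comp.conj_lift P (\<lambda>t. H (0, t)) g h"
    using lift HF[of 0] F'(1) by (subst (asm) calkin_lift_iff) auto
  obtain g' h' where gh': "Comp.conj_lift P (\<lambda>t. H (1, t)) g' h'"
    "(\<And>s. s \<in> {0..1} \<Longrightarrow> H (s, 1) - H (0, 1) \<in> Comp) \<Longrightarrow> g' 1 = g 1"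
    by (rule Comp.homotopy_conj_lift[OF H HO HI H0 P l0]) blast+
  have "H (s, 1) - H (0, 1) \<in> Comp" if "s \<in> {0..1}" for s
    using Comp_diff[OF H1[OF that] H1[of 0]] by simp
  then have "g' 1 = g 1" by (rule gh'(2))
  moreover have "calkin_lift P \<beta> g' h'"
    using gh'(1) by (subst calkin_lift_iff[of \<beta> "\<lambda>t. H (1, t)"]) (use F'(1) HF[of 1] in force)+
  ultimately show thesis using that by blast
qed

lemma conjugate_ceq_commute:
  assumes P: "P \<in> Ops" and g: "g \<in> Ops" "h \<in> Ops" "g o\<^sub>L h = id_blinfun" "h o\<^sub>L g = id_blinfun"
    and eq: "g o\<^sub>L P o\<^sub>L h \<simeq>\<^sub>K P"
  shows "P o\<^sub>L g \<simeq>\<^sub>K g o\<^sub>L P" "P o\<^sub>L h \<simeq>\<^sub>K h o\<^sub>L P"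
proof -
  have "(g o\<^sub>L P o\<^sub>L h) o\<^sub>L g \<simeq>\<^sub>K P o\<^sub>L g" by (rule ceq_right[OF eq g(1)])
  then have "g o\<^sub>L P \<simeq>\<^sub>K P o\<^sub>L g" using g by (simp add: blinfun_compose_assoc)
  then show "P o\<^sub>L g \<simeq>\<^sub>K g o\<^sub>L P" by (rule ceq_sym)
  have "h o\<^sub>L (g o\<^sub>L P o\<^sub>L h) \<simeq>\<^sub>K h o\<^sub>L P" by (rule ceq_left[OF eq g(2)])
  then show "P o\<^sub>L h \<simeq>\<^sub>K h o\<^sub>L P" using g by (simp flip: blinfun_compose_assoc)
qed

lemma calkin_lift_end:
  assumes P: "P \<in> Ops" "P o\<^sub>L P = P" and lift: "calkin_lift P \<alpha> g h" and \<alpha>: "\<alpha> 1 = proj P"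
  shows "P o\<^sub>L g 1 \<simeq>\<^sub>K g 1 o\<^sub>L P" "P o\<^sub>L h 1 \<simeq>\<^sub>K h 1 o\<^sub>L P"
    "calkin_inverse (compression P (g 1)) (compression P (h 1))"
proof -
  note ip = inverse_pathsD[OF lift[unfolded calkin_lift_def, THEN conjunct1]]
  have "g 1 o\<^sub>L P o\<^sub>L h 1 \<simeq>\<^sub>K P" using lift \<alpha> by (simp add: calkin_lift_def ceq_proj)
  then show c: "P o\<^sub>L g 1 \<simeq>\<^sub>K g 1 o\<^sub>L P" "P o\<^sub>L h 1 \<simeq>\<^sub>K h 1 o\<^sub>L P"
    using conjugate_ceq_commute[OF P(1), of "g 1" "h 1"] ip(5-8)[of 1] by auto
  have "calkin_inverse (g 1) (h 1)" using ip(5-8)[of 1] by (simp add: calkin_inverse_def)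
  then show "calkin_inverse (compression P (g 1)) (compression P (h 1))"
    by (rule calkin_inverse_compression[OF P _ c])
qed

text \<open>Two lifts differ by a path of operators commuting with \<open>P\<close> modulo compact operators,
  along which the index cannot change.\<close>

lemma lift_index_unique:
  assumes P: "P \<in> Ops" "P o\<^sub>L P = P" and lift: "calkin_lift P \<alpha> g h" and lift': "calkin_lift P \<alpha> g' h'"
    and \<alpha>: "\<alpha> 1 = proj P"
  shows "bindex (compression P (g 1)) = bindex (compression P (g' 1))"
proof -
  note ip = inverse_pathsD[OF lift[unfolded calkin_lift_def, THEN conjunct1]]
  note ip' = inverse_pathsD[OF lift'[unfolded calkin_lift_def, THEN conjunct1]]
  \<comment> \<open>The quotient of the two lifts: \<open>u 0\<close> is the identity, whose
    compression has index zero, and \<open>g 1\<close> composed with \<open>u 1\<close> is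
    \<open>g' 1\<close>.\<close>
  define u where "u t = h t o\<^sub>L g' t" for t
  define v where "v t = h' t o\<^sub>L g t" for t
  have uv: "u t \<in> Ops" "v t \<in> Ops" "u t o\<^sub>L v t = id_blinfun" "v t o\<^sub>L u t = id_blinfun"
    if t: "t \<in> {0..1}" for t
  proof -
    show "u t \<in> Ops" unfolding u_def by (rule Ops_compose[OF ip(6)[OF t] ip'(5)[OF t]])
    show "v t \<in> Ops" unfolding v_def by (rule Ops_compose[OF ip'(6)[OF t] ip(5)[OF t]])
    have "u t o\<^sub>L v t = h t o\<^sub>L ((g' t o\<^sub>L h' t) o\<^sub>L g t)" "v t o\<^sub>L u t = h' t o\<^sub>L ((g t o\<^sub>L h t) o\<^sub>L g' t)"
      by (simp_all add: u_def v_def blinfun_compose_assoc)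
    then show "u t o\<^sub>L v t = id_blinfun" "v t o\<^sub>L u t = id_blinfun" using t by (simp_all add: ip ip')
  qed
  have comm: "P o\<^sub>L u t \<simeq>\<^sub>K u t o\<^sub>L P" "P o\<^sub>L v t \<simeq>\<^sub>K v t o\<^sub>L P" if t: "t \<in> {0..1}" for t
  proof -
    have "g' t o\<^sub>L P o\<^sub>L h' t \<simeq>\<^sub>K g t o\<^sub>L P o\<^sub>L h t"
      using lift lift' t by (simp add: calkin_lift_def ceq_proj)
    then have "(h t o\<^sub>L (g' t o\<^sub>L P o\<^sub>L h' t)) o\<^sub>L g t \<simeq>\<^sub>K (h t o\<^sub>L (g t o\<^sub>L P o\<^sub>L h t)) o\<^sub>L g t"
      using t by (intro ceq_right ceq_left ip)
    moreover have "(h t o\<^sub>L (g t o\<^sub>L P o\<^sub>L h t)) o\<^sub>L g t = (h t o\<^sub>L g t) o\<^sub>L P o\<^sub>L (h t o\<^sub>L g t)"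
      by (simp add: blinfun_compose_assoc)
    moreover have "(h t o\<^sub>L (g' t o\<^sub>L P o\<^sub>L h' t)) o\<^sub>L g t = u t o\<^sub>L P o\<^sub>L v t"
      by (simp add: u_def v_def blinfun_compose_assoc)
    ultimately have "u t o\<^sub>L P o\<^sub>L v t \<simeq>\<^sub>K P" using t by (simp add: ip)
    then show "P o\<^sub>L u t \<simeq>\<^sub>K u t o\<^sub>L P" "P o\<^sub>L v t \<simeq>\<^sub>K v t o\<^sub>L P"
      using conjugate_ceq_commute[OF P(1) uv[OF t]] by auto
  qed
  have ci: "calkin_inverse (compression P (u t)) (compression P (v t))" if t: "t \<in> {0..1}" for t
    using uv[OF t] by (intro calkin_inverse_compression P comm t) (simp add: calkin_inverse_def)
  have "continuous_on {0..1} (\<lambda>t. compression P (u t))"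
    unfolding compression_def u_def by (intro continuous_intros ip ip')
  then have "bindex (compression P (u 0)) = bindex (compression P (u 1))"
    by (rule bindex_path_constant[OF _ ci])
  moreover have "bindex (compression P (u 0)) = 0"
    using bindex_inverse[of id_blinfun id_blinfun] by (simp add: u_def ip ip' compression_id P Ops_id)
  ultimately have u1: "bindex (compression P (u 1)) = 0" by simp
  note ci_g = calkin_lift_end(3)[OF P lift \<alpha>]
  have gu: "g 1 o\<^sub>L u 1 = g' 1" by (simp add: u_def ip flip: blinfun_compose_assoc)
  have one: "(1::real) \<in> {0..1}" by simp
  have "compression P (g 1) o\<^sub>L compression P (u 1) \<simeq>\<^sub>K compression P (g 1 o\<^sub>L u 1)"
    by (rule compression_compose[OF P ip(5)[OF one] uv(1)[OF one] comm(1)[OF one]])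
  then have "bindex (compression P (g' 1)) = bindex (compression P (g 1) o\<^sub>L compression P (u 1))"
    unfolding gu
    by (rule bindex_ceq[OF calkin_inverse_compose[OF ci_g ci[OF one]]
          compression_Ops[OF P(1) ip'(5)[OF one]] ceq_sym])
  also have "\<dots> = bindex (compression P (g 1)) + bindex (compression P (u 1))"
    by (rule bindex_compose[OF ci_g ci]) simp
  finally show ?thesis using u1 by simp
qed

text \<open>The description picks out one integer because all lifts of all loops in a homotopy class
  have the same index, see \<open>loop_index_eq\<close>.\<close>

definition loop_index :: "('a \<Rightarrow>\<^sub>L 'a) \<Rightarrow> (real \<Rightarrow> ('a \<Rightarrow>\<^sub>L 'a) set) set \<Rightarrow> int" where
  "loop_index P C = (THE n. \<exists>\<alpha>\<in>C. \<exists>g h. calkin_lift P \<alpha> g h \<and> bindex (compression P (g 1)) = of_int n)"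

text \<open>A lift of \<open>\<alpha>\<close> is carried along a homotopy to any other
  representative, keeping \<open>g 1\<close>; there \<open>lift_index_unique\<close> compares it
  with every other lift.\<close>

lemma loop_index_eq:
  assumes P: "P \<in> Ops" "P o\<^sub>L P = P"
    and \<alpha>: "\<alpha> \<in> loops (calkin_projector_space smul) (proj P)" and lift: "calkin_lift P \<alpha> g h"
  shows "of_int (loop_index P (loop_homotopy (calkin_projector_space smul) (proj P) `` {\<alpha>}))
       = bindex (compression P (g 1))"
proof -
  let ?r = "loop_homotopy (calkin_projector_space smul) (proj P)"
  have \<alpha>1: "\<alpha> 1 = proj P" using \<alpha> by (simp add: loops_def)
  obtain n :: int where n: "bindex (compression P (g 1)) = of_int n"
    by (rule bindex_integer[OF calkin_lift_end(3)[OF P lift \<alpha>1]])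
  have "loop_index P (?r `` {\<alpha>}) = n"
    unfolding loop_index_def
  proof (rule the_equality)
    show "\<exists>\<beta>\<in>?r `` {\<alpha>}. \<exists>g h. calkin_lift P \<beta> g h \<and> bindex (compression P (g 1)) = of_int n"
      using lift n loop_homotopy_refl[OF \<alpha>] by blast
    fix m :: int
    assume "\<exists>\<beta>\<in>?r `` {\<alpha>}. \<exists>g h. calkin_lift P \<beta> g h \<and> bindex (compression P (g 1)) = of_int m"
    then obtain \<beta> g' h' where \<beta>: "(\<alpha>, \<beta>) \<in> ?r" "calkin_lift P \<beta> g' h'"
      "bindex (compression P (g' 1)) = of_int m" by blast
    obtain g'' h'' where gh'': "calkin_lift P \<beta> g'' h''" "g'' 1 = g 1"
      by (rule calkin_lift_homotopic[OF P(1) \<beta>(1) lift])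
    have "\<beta> 1 = proj P" using \<beta>(1) loop_homotopy_equiv by (fastforce simp: equiv_def loops_def)
    then have "(of_int m :: 'k) = of_int n"
      using lift_index_unique[OF P gh''(1) \<beta>(2)] \<beta>(3) gh''(2) n by simp
    then show "m = n" by simp
  qed
  then show ?thesis using n by simp
qed

text \<open>The second half has to start at \<open>g 1\<close>, hence the right factor
  \<open>g 1\<close>. It still lifts \<open>\<beta>\<close>, because conjugating \<open>P\<close> by
  \<open>g 1\<close> changes it only by a compact operator.\<close>

lemma calkin_lift_join:
  assumes P: "P \<in> Ops" and \<alpha>: "\<alpha> 1 = proj P"
    and lift: "calkin_lift P \<alpha> g h" and lift': "calkin_lift P \<beta> g' h'"
  shows "calkin_lift P (loop_join \<alpha> \<beta>) (loop_join g (\<lambda>t. g' t o\<^sub>L g 1)) (loop_join h (\<lambda>t. h 1 o\<^sub>L h' t))"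
proof -
  note ip = inverse_pathsD[OF lift[unfolded calkin_lift_def, THEN conjunct1]]
  note ip' = inverse_pathsD[OF lift'[unfolded calkin_lift_def, THEN conjunct1]]
  let ?g = "loop_join g (\<lambda>t. g' t o\<^sub>L g 1)" and ?h = "loop_join h (\<lambda>t. h 1 o\<^sub>L h' t)"
  have c1: "continuous_on {0..1} (\<lambda>t. g' t o\<^sub>L g 1)" "continuous_on {0..1} (\<lambda>t. h 1 o\<^sub>L h' t)"
    by (intro continuous_intros ip')+
  have "continuous_on {0..1} ?g" "continuous_on {0..1} ?h"
    using pathin_loop_join[of euclidean g "\<lambda>t. g' t o\<^sub>L g 1"] pathin_loop_join[of euclidean h "\<lambda>t. h 1 o\<^sub>L h' t"]
      ip(1,2) c1 by (simp_all add: pathin_def ip'(3,4))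
  moreover have "?g t \<in> Ops \<and> ?h t \<in> Ops \<and> ?g t o\<^sub>L ?h t = id_blinfun \<and> ?h t o\<^sub>L ?g t = id_blinfun \<and>
      loop_join \<alpha> \<beta> t = proj (?g t o\<^sub>L P o\<^sub>L ?h t)" if t: "t \<in> {0..1}" for t
  proof (cases "t \<le> 1/2")
    case True
    then have "2 * t \<in> {0..1}" using t by simp
    then show ?thesis using True lift by (simp add: loop_join_def ip calkin_lift_def)
  next
    case False
    define s where "s = 2 * t - 1"
    have s: "s \<in> {0..1}" using t False by (simp add: s_def)
    have j: "?g t = g' s o\<^sub>L g 1" "?h t = h 1 o\<^sub>L h' s" "loop_join \<alpha> \<beta> t = \<beta> s"
      using False by (simp_all add: loop_join_def s_def)
    have "(g' s o\<^sub>L g 1) o\<^sub>L (h 1 o\<^sub>L h' s) = g' s o\<^sub>L ((g 1 o\<^sub>L h 1) o\<^sub>L h' s)"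
      "(h 1 o\<^sub>L h' s) o\<^sub>L (g' s o\<^sub>L g 1) = h 1 o\<^sub>L ((h' s o\<^sub>L g' s) o\<^sub>L g 1)"
      by (simp_all add: blinfun_compose_assoc)
    then have inv: "(g' s o\<^sub>L g 1) o\<^sub>L (h 1 o\<^sub>L h' s) = id_blinfun" "(h 1 o\<^sub>L h' s) o\<^sub>L (g' s o\<^sub>L g 1) = id_blinfun"
      using s by (simp_all add: ip ip')
    have "g 1 o\<^sub>L P o\<^sub>L h 1 \<simeq>\<^sub>K P" using lift \<alpha> by (simp add: calkin_lift_def ceq_proj)
    then have "(g' s o\<^sub>L (g 1 o\<^sub>L P o\<^sub>L h 1)) o\<^sub>L h' s \<simeq>\<^sub>K (g' s o\<^sub>L P) o\<^sub>L h' s"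
      using s by (intro ceq_right ceq_left ip')
    then have "g' s o\<^sub>L g 1 o\<^sub>L P o\<^sub>L (h 1 o\<^sub>L h' s) \<simeq>\<^sub>K g' s o\<^sub>L P o\<^sub>L h' s"
      by (simp add: blinfun_compose_assoc)
    then have "\<beta> s = proj (g' s o\<^sub>L g 1 o\<^sub>L P o\<^sub>L (h 1 o\<^sub>L h' s))"
      using lift' s by (simp add: calkin_lift_def ceq_proj)
    then show ?thesis unfolding j using inv s by (auto intro!: Ops_compose simp: ip ip')
  qed
  moreover have "?g 0 = id_blinfun" by (simp add: loop_join_def ip)
  ultimately show ?thesis unfolding calkin_lift_def inverse_paths_def by blast
qed

text \<open>The joined lift ends at \<open>g' 1\<close> composed with \<open>g 1\<close>, in the
  order opposite to the loops; the index is additive and its values commute, so this is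
  harmless.\<close>

lemma loop_index_hom:
  assumes P: "P \<in> Ops" "P o\<^sub>L P = P"
  shows "loop_index P \<in> hom (fundamental_group (calkin_projector_space smul) (proj P)) integer_group"
proof (rule homI)
  let ?Y = "calkin_projector_space smul"
  let ?H = "fundamental_group ?Y (proj P)"
  show "loop_index P A \<in> carrier integer_group" for A by (simp add: integer_group_def)
  fix A B assume "A \<in> carrier ?H" "B \<in> carrier ?H"
  then obtain \<alpha> \<beta> where \<alpha>: "\<alpha> \<in> loops ?Y (proj P)" "A = loop_homotopy ?Y (proj P) `` {\<alpha>}"
    and \<beta>: "\<beta> \<in> loops ?Y (proj P)" "B = loop_homotopy ?Y (proj P) `` {\<beta>}"
    by (metis fundamental_group_carrierE)
  have ends: "\<alpha> 1 = proj P" "\<beta> 1 = proj P" using \<alpha> \<beta> by (simp_all add: loops_def)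
  obtain g h where l: "calkin_lift P \<alpha> g h" by (rule calkin_lift_exists[OF P(1) \<alpha>(1)])
  obtain g' h' where l': "calkin_lift P \<beta> g' h'" by (rule calkin_lift_exists[OF P(1) \<beta>(1)])
  note ip = inverse_pathsD[OF l[unfolded calkin_lift_def, THEN conjunct1]]
  note ip' = inverse_pathsD[OF l'[unfolded calkin_lift_def, THEN conjunct1]]
  note e = calkin_lift_end[OF P l ends(1)] and e' = calkin_lift_end[OF P l' ends(2)]
  have one: "(1::real) \<in> {0..1}" by simp
  have "compression P (g' 1) o\<^sub>L compression P (g 1) \<simeq>\<^sub>K compression P (g' 1 o\<^sub>L g 1)"
    by (rule compression_compose[OF P ip'(5)[OF one] ip(5)[OF one] e(1)])
  then have "bindex (compression P (g' 1 o\<^sub>L g 1)) = bindex (compression P (g' 1) o\<^sub>L compression P (g 1))"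
    by (rule bindex_ceq[OF calkin_inverse_compose[OF e'(3) e(3)]
          compression_Ops[OF P(1) Ops_compose[OF ip'(5)[OF one] ip(5)[OF one]]] ceq_sym])
  also have "\<dots> = bindex (compression P (g' 1)) + bindex (compression P (g 1))"
    by (rule bindex_compose[OF e'(3) e(3)])
  finally have sum: "bindex (compression P (g' 1 o\<^sub>L g 1)) = bindex (compression P (g' 1)) + bindex (compression P (g 1))" .
  have "loop_join g (\<lambda>t. g' t o\<^sub>L g 1) 1 = g' 1 o\<^sub>L g 1" by (simp add: loop_join_def)
  then have "(of_int (loop_index P (A \<otimes>\<^bsub>?H\<^esub> B)) :: 'k) = bindex (compression P (g' 1 o\<^sub>L g 1))"
    using loop_index_eq[OF P loop_join_loops[OF \<alpha>(1) \<beta>(1)] calkin_lift_join[OF P(1) ends(1) l l']] \<alpha> \<beta>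
    by (simp add: fundamental_group_mult)
  also have "\<dots> = of_int (loop_index P A + loop_index P B)"
    using loop_index_eq[OF P \<alpha>(1) l] loop_index_eq[OF P \<beta>(1) l'] \<alpha>(2) \<beta>(2) sum by simp
  finally have "loop_index P (A \<otimes>\<^bsub>?H\<^esub> B) = loop_index P A + loop_index P B"
    by (simp only: of_int_eq_iff)
  then show "loop_index P (A \<otimes>\<^bsub>?H\<^esub> B) = loop_index P A \<otimes>\<^bsub>integer_group\<^esub> loop_index P B"
    by (simp add: integer_group_def)
qed

text \<open>A loop of genuine projectors lifts exactly, by means of the zero ideal. Then
  \<open>g 1\<close> commutes with \<open>P\<close>, and its compression is inverted by the
  compression of \<open>h 1\<close>.\<close>

lemma loop_index_proj:
  assumes P: "P \<in> Ops" "P o\<^sub>L P = P" and \<Gamma>: "\<Gamma> \<in> loops (projector_space smul) P"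
  shows "loop_index P (loop_homotopy (calkin_projector_space smul) (proj P) `` {proj \<circ> \<Gamma>}) = 0"
proof -
  interpret Z: operator_ideal smul "{0}"
    by unfold_locales (auto simp: real_vector.subspace_def blinfun_compose_scale)
  note \<Gamma>' = \<Gamma>[unfolded loops_projector_space]
  obtain g h where gh: "Z.conj_lift P \<Gamma> g h"
    by (rule Z.path_conj_lift[of \<Gamma> P]) (use \<Gamma>' P in auto)
  then have lift: "calkin_lift P (proj \<circ> \<Gamma>) g h"
    by (simp add: Z.conj_lift_def calkin_lift_def)
  note ip = inverse_pathsD[OF lift[unfolded calkin_lift_def, THEN conjunct1]]
  have "g 1 o\<^sub>L P o\<^sub>L h 1 = P" using gh \<Gamma>' by (simp add: Z.conj_lift_def)
  then have "(g 1 o\<^sub>L P o\<^sub>L h 1) o\<^sub>L g 1 = P o\<^sub>L g 1" by simp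
  then have Pg: "g 1 o\<^sub>L P = P o\<^sub>L g 1" by (simp add: blinfun_compose_assoc ip)
  have gP: "g 1 (P x) = P (g 1 x)" for x using Pg by (metis blinfun_apply_blinfun_compose)
  have PP: "P (P x) = P x" for x using P(2) by (metis blinfun_apply_blinfun_compose)
  have gh1: "g 1 (h 1 x) = x" "h 1 (g 1 x) = x" for x
    using ip(7,8)[of 1] by (metis atLeastAtMost_iff blinfun_apply_blinfun_compose id_blinfun.rep_eq order_refl zero_le_one)+
  have hP: "h 1 (P x) = P (h 1 x)" for x using gP[of "h 1 x"] gh1 by metis
  have "bindex (compression P (g 1)) = 0"
  proof (rule bindex_inverse[of _ "compression P (h 1)"])
    show "compression P (g 1) o\<^sub>L compression P (h 1) = id_blinfun"
      "compression P (h 1) o\<^sub>L compression P (g 1) = id_blinfun"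
      by (rule blinfun_eqI, simp add: compression_def blinfun.add_left blinfun.diff_left blinfun.add_right
          blinfun.diff_right gP hP PP gh1)+
  qed (use P ip(5,6)[of 1] compression_Ops in auto)
  moreover have "proj \<circ> \<Gamma> \<in> loops (calkin_projector_space smul) (proj P)"
    by (rule loops_compose[OF continuous_map_proj \<Gamma>])
  ultimately have "(of_int (loop_index P (loop_homotopy (calkin_projector_space smul) (proj P) `` {proj \<circ> \<Gamma>})) :: 'k) = 0"
    using loop_index_eq[OF P _ lift] by simp
  then show ?thesis by simp
qed

text \<open>Conjugating \<open>P\<close> along a lift gives a path \<open>\<delta>\<close> of
  projectors over \<open>\<alpha>\<close> that ends in the fibre of \<open>proj P\<close>. A path
  \<open>\<gamma>\<close> inside the fibre returns to \<open>P\<close> and adds only a constant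
  piece in the Calkin algebra.\<close>

lemma loop_index_zero_lift:
  assumes P: "P \<in> Ops" "P o\<^sub>L P = P" and \<alpha>: "\<alpha> \<in> loops (calkin_projector_space smul) (proj P)"
    and zero: "loop_index P (loop_homotopy (calkin_projector_space smul) (proj P) `` {\<alpha>}) = 0"
  obtains \<Gamma> where "\<Gamma> \<in> loops (projector_space smul) P"
    "(proj \<circ> \<Gamma>, \<alpha>) \<in> loop_homotopy (calkin_projector_space smul) (proj P)"
proof -
  have \<alpha>1: "\<alpha> 1 = proj P" using \<alpha> by (simp add: loops_def)
  obtain g h where lift: "calkin_lift P \<alpha> g h" by (rule calkin_lift_exists[OF P(1) \<alpha>])
  note ip = inverse_pathsD[OF lift[unfolded calkin_lift_def, THEN conjunct1]]
  note e = calkin_lift_end[OF P lift \<alpha>1]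
  have "bindex (compression P (g 1)) = 0" using loop_index_eq[OF P \<alpha> lift] zero by simp
  \<comment> \<open>\<open>compact_fibre_connected\<close> is stated for the inverse: it is
    \<open>h 1\<close> that carries the range of the conjugated projector back to the range of
    \<open>P\<close>.\<close>
  then have "bindex (compression P (h 1)) = 0" using bindex_calkin_inverse[OF e(3)] by simp
  then have "path_component (compact_fibre P) (g 1 o\<^sub>L P o\<^sub>L h 1) P"
    using ip(5-8)[of 1] by (intro compact_fibre_connected P e) auto
  then obtain \<gamma> where \<gamma>: "path \<gamma>" "path_image \<gamma> \<subseteq> compact_fibre P" "\<gamma> 0 = g 1 o\<^sub>L P o\<^sub>L h 1" "\<gamma> 1 = P"
    unfolding path_component_def pathstart_def pathfinish_def by blast
  have \<gamma>': "\<gamma> t \<in> Ops" "\<gamma> t o\<^sub>L \<gamma> t = \<gamma> t" "proj (\<gamma> t) = proj P" if "t \<in> {0..1}" for t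
    using \<gamma>(2) that by (auto simp: path_image_def compact_fibre_def image_subset_iff ceq_proj)
  define \<delta> where "\<delta> t = g t o\<^sub>L P o\<^sub>L h t" for t
  have \<delta>: "pathin (projector_space smul) \<delta>"
    unfolding pathin_def continuous_map_projector_space
  proof (intro conjI ballI)
    show "continuous_on {0..1} \<delta>" unfolding \<delta>_def by (intro continuous_intros ip)
    fix t :: real assume t: "t \<in> {0..1}"
    show "\<delta> t \<in> Ops" unfolding \<delta>_def using t by (intro Ops_compose ip P)
    have "\<delta> t o\<^sub>L \<delta> t = g t o\<^sub>L (P o\<^sub>L (h t o\<^sub>L g t) o\<^sub>L P) o\<^sub>L h t" by (simp add: \<delta>_def blinfun_compose_assoc)
    then show "\<delta> t o\<^sub>L \<delta> t = \<delta> t" using t by (simp add: ip P \<delta>_def)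
  qed
  have "pathin (projector_space smul) \<gamma>"
    using \<gamma>(1) \<gamma>' by (simp add: pathin_def continuous_map_projector_space path_def)
  then have "pathin (projector_space smul) (loop_join \<delta> \<gamma>)"
    using \<delta> \<gamma>(3) by (intro pathin_loop_join) (simp_all add: \<delta>_def)
  then have \<Gamma>: "loop_join \<delta> \<gamma> \<in> loops (projector_space smul) P"
    using \<gamma>(4) by (simp add: loops_def) (simp add: loop_join_def \<delta>_def ip)
  have eq: "(proj \<circ> loop_join \<delta> \<gamma>) t = loop_join \<alpha> (\<lambda>_. proj P) t" if t: "t \<in> {0..1}" for t
    using lift \<gamma>'(3)[of "2 * t - 1"] t by (auto simp: loop_join_def calkin_lift_def \<delta>_def)
  show thesis
    by (rule that[OF \<Gamma> loop_homotopy_trans[OF loop_homotopy_eq_on[OF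
        loops_compose[OF continuous_map_proj \<Gamma>] eq] loop_join_const_right[OF \<alpha>]]])
qed

end

theorem theorem8p1:
  fixes smul :: "'k::real_normed_field \<Rightarrow> 'a::banach \<Rightarrow> 'a"
    and P :: "'a \<Rightarrow>\<^sub>L 'a"
  assumes "banach_space_over smul"
    and "P \<in> idempotents (op_algebra smul)"
  defines "G \<equiv> fundamental_group (projector_space smul) P"
    and "H \<equiv> fundamental_group (calkin_projector_space smul) (calkin_proj smul P)"
    and "p_star \<equiv> fundamental_group_map (calkin_projector_space smul) (calkin_proj smul P)
                    (calkin_proj smul)"
  shows "\<exists>\<phi>. group_hom G H p_star \<and> group_hom H integer_group \<phi> \<and>
             p_star ` carrier G = kernel H integer_group \<phi>"
proof -
  interpret banach_space_over smul by fact
  have P: "P \<in> Ops" "P o\<^sub>L P = P" using assms(2) by (simp_all add: idempotents_Ops)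
  have top: "P \<in> topspace (projector_space smul)" using P by (simp add: topspace_projector_space)
  have hom: "group_hom G H p_star"
    unfolding G_def H_def p_star_def by (rule group_hom_fundamental_group_map[OF continuous_map_proj top])
  then have gH: "Group.group H" by (simp add: group_hom_def)
  have "group_hom H integer_group (loop_index P)"
    using gH loop_index_hom[OF P] abelian_integer_group
    by (simp add: group_hom_def group_hom_axioms_def H_def comm_group_def)
  moreover have "p_star ` carrier G = kernel H integer_group (loop_index P)"
  proof (intro equalityI subsetI)
    fix B assume "B \<in> p_star ` carrier G"
    then obtain A where "A \<in> carrier G" "B = p_star A" by blast
    then obtain \<Gamma> where \<Gamma>: "\<Gamma> \<in> loops (projector_space smul) P"
      "B = loop_homotopy (calkin_projector_space smul) (proj P) `` {proj \<circ> \<Gamma>}"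
      unfolding G_def p_star_def
      by (metis fundamental_group_carrierE fundamental_group_map_class[OF continuous_map_proj])
    then show "B \<in> kernel H integer_group (loop_index P)"
      using loop_index_proj[OF P \<Gamma>(1)] loops_compose[OF continuous_map_proj \<Gamma>(1)]
      by (simp add: kernel_def H_def fundamental_group_carrierI integer_group_def)
  next
    fix B assume "B \<in> kernel H integer_group (loop_index P)"
    then have "B \<in> carrier H" and B0: "loop_index P B = 0"
      by (simp_all add: kernel_def integer_group_def)
    then obtain \<alpha> where \<alpha>: "\<alpha> \<in> loops (calkin_projector_space smul) (proj P)"
      "B = loop_homotopy (calkin_projector_space smul) (proj P) `` {\<alpha>}"
      unfolding H_def by (metis fundamental_group_carrierE)
    obtain \<Gamma> where \<Gamma>: "\<Gamma> \<in> loops (projector_space smul) P"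
      "(proj \<circ> \<Gamma>, \<alpha>) \<in> loop_homotopy (calkin_projector_space smul) (proj P)"
      by (rule loop_index_zero_lift[OF P \<alpha>(1) B0[unfolded \<alpha>(2)]])
    have "B = p_star (loop_homotopy (projector_space smul) P `` {\<Gamma>})"
      unfolding p_star_def fundamental_group_map_class[OF continuous_map_proj \<Gamma>(1)] \<alpha>(2)
      by (rule loop_homotopy_class_eq[OF \<Gamma>(2), symmetric])
    then show "B \<in> p_star ` carrier G"
      unfolding G_def using fundamental_group_carrierI[OF \<Gamma>(1)] by blast
  qed
  ultimately show ?thesis using hom by blast
qed

end
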